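(* Let $h\colon\mathbb{R}\to\mathbb{R}$ be of class $\mathcal{D}^{(4)}$ and such that $\mu_h(dx):=e^{-h(x)}\,dx$ is a probability measure. Set $$V(x):=\tfrac12\bigl(1-h''(x)\bigr)-\tfrac14\bigl(x^2-h'(x)^2\bigr),\qquad x\in\mathbb{R},$$ and assume that $V$ is bounded from below. Let $(\mathcal{P}_t)_{t\ge 0}$ be the semi-group associated to the diffusion operator $L_hf:=f''-h'f'$. Then, for every non-negative $f\in\mathbb{L}^2(\mu_h)$ that is not ($\mu_h$-a.e.) zero, all $x\in\mathbb{R}$ and all $t>0$, $$(\log\mathcal{P}_tf)''(x)\ \ge\ -c_t^2-\tfrac12\bigl(1-h''(x)\bigr)-\tfrac12\sup_{y\in\mathbb{R}}V''(y),$$ where $c_t:=\dfrac{e^{-t}}{\sqrt{1-e^{-2t}}}$.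
   Context: $\mathcal{D}^{(k)}$ denotes the set of $\mathcal{C}^k$ real-valued functions which, together with their derivatives (up to order $k$), have polynomial growth. The operator $L_h$ is essentially self-adjoint on $\mathcal{C}^\infty_K$ (smooth compactly supported functions) in $\mathbb{L}^2(\mu_h)$, and $(\mathcal{P}_t)_{t\ge0}$ is the semi-group on $\mathbb{L}^2(\mu_h)$ generated by it. For $t>0$, $\mathcal{P}_tf$ is understood pointwise through the representation $\mathcal{P}_tf(x)=e^{-W(x)/2}\,\mathbb{E}\bigl[e^{W(X_t^x)/2}f(X_t^x)e^{-\int_0^tV(X_s^x)\,ds}\bigr]$, where $W(x)=\frac{x^2}{2}-h(x)$ and $(X^x_s)_{s\ge0}$ is the Ornstein-Uhlenbeck process solving $X_t^x=x+\sqrt2\,B_t-\int_0^tX_s^x\,ds$, with $B$ a standard Brownian motion on $\mathbb{R}$. If $\sup V''=+\infty$ the inequality is trivial. *)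

theory Defs
  imports "HOL-Probability.Probability"
begin

definition poly_growth :: "(real \<Rightarrow> real) \<Rightarrow> bool" where
  "poly_growth g \<longleftrightarrow> (\<exists>C n. \<forall>x. \<bar>g x\<bar> \<le> C * (1 + \<bar>x\<bar>) ^ n)"

definition C_class :: "nat \<Rightarrow> (real \<Rightarrow> real) set" where
  "C_class k = {g. (\<forall>j<k. \<forall>x. (deriv ^^ j) g differentiable at x) \<and>
                   continuous_on UNIV ((deriv ^^ k) g)}"

definition D_class :: "nat \<Rightarrow> (real \<Rightarrow> real) set" where
  "D_class k = {g \<in> C_class k. \<forall>j\<le>k. poly_growth ((deriv ^^ j) g)}"

definition test_functions :: "(real \<Rightarrow> real) set" where
  "test_functions = {\<phi>. (\<forall>k. \<phi> \<in> C_class k) \<and> compact (closure {x. \<phi> x \<noteq> 0})}"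

definition mu :: "(real \<Rightarrow> real) \<Rightarrow> real measure" where
  "mu h = density lborel (\<lambda>x. ennreal (exp (- h x)))"

definition V_fun :: "(real \<Rightarrow> real) \<Rightarrow> real \<Rightarrow> real" where
  "V_fun h x = 1 / 2 * (1 - deriv (deriv h) x) - 1 / 4 * (x\<^sup>2 - (deriv h x)\<^sup>2)"

definition W_fun :: "(real \<Rightarrow> real) \<Rightarrow> real \<Rightarrow> real" where
  "W_fun h x = x\<^sup>2 / 2 - h x"

definition L_op :: "(real \<Rightarrow> real) \<Rightarrow> (real \<Rightarrow> real) \<Rightarrow> real \<Rightarrow> real" where
  "L_op h f x = deriv (deriv f) x - deriv h x * deriv f x"

text \<open>Elements of \<open>L2 M\<close> are functions, not classes modulo null sets; the identities
  between them below are therefore almost everywhere identities.\<close>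

definition L2 :: "'a measure \<Rightarrow> ('a \<Rightarrow> real) set" where
  "L2 M = {f \<in> borel_measurable M. integrable M (\<lambda>x. (f x)\<^sup>2)}"

definition L2_norm :: "'a measure \<Rightarrow> ('a \<Rightarrow> real) \<Rightarrow> real" where
  "L2_norm M f = sqrt (\<integral>x. (f x)\<^sup>2 \<partial>M)"

definition L2_lim :: "'a measure \<Rightarrow> ('b \<Rightarrow> 'a \<Rightarrow> real) \<Rightarrow> ('a \<Rightarrow> real) \<Rightarrow> 'b filter \<Rightarrow> bool" where
  "L2_lim M u f F \<longleftrightarrow> ((\<lambda>i. L2_norm M (\<lambda>x. u i x - f x)) \<longlongrightarrow> 0) F"

definition C0_semigroup_L2 ::
  "'a measure \<Rightarrow> (real \<Rightarrow> ('a \<Rightarrow> real) \<Rightarrow> 'a \<Rightarrow> real) \<Rightarrow> bool" where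
  "C0_semigroup_L2 M P \<longleftrightarrow>
     (\<forall>t\<ge>0. \<forall>f\<in>L2 M. P t f \<in> L2 M) \<and>
     (\<forall>t\<ge>0. \<forall>f\<in>L2 M. \<forall>g\<in>L2 M. \<forall>a b.
        AE x in M. P t (\<lambda>y. a * f y + b * g y) x = a * P t f x + b * P t g x) \<and>
     (\<forall>t\<ge>0. \<exists>C. \<forall>f\<in>L2 M. L2_norm M (P t f) \<le> C * L2_norm M f) \<and>
     (\<forall>f\<in>L2 M. AE x in M. P 0 f x = f x) \<and>
     (\<forall>s\<ge>0. \<forall>t\<ge>0. \<forall>f\<in>L2 M. AE x in M. P (s + t) f x = P s (P t f) x) \<and>
     (\<forall>f\<in>L2 M. L2_lim M (\<lambda>t. P t f) f (at_right 0))"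

text \<open>\<open>P\<close> is the semigroup on \<open>L2 (mu h)\<close> whose infinitesimal generator is the closure of
  \<open>L_op h\<close> restricted to the test functions: the graph of the generator (left-hand side of the
  equivalence) is the closure of the graph of the restriction (right-hand side). As this
  restriction is essentially self-adjoint, the closure is its unique self-adjoint extension.\<close>

definition semigroup_generated_by_L ::
  "(real \<Rightarrow> real) \<Rightarrow> (real \<Rightarrow> (real \<Rightarrow> real) \<Rightarrow> real \<Rightarrow> real) \<Rightarrow> bool" where
  "semigroup_generated_by_L h P \<longleftrightarrow>
     C0_semigroup_L2 (mu h) P \<and>
     (\<forall>f\<in>L2 (mu h). \<forall>g\<in>L2 (mu h).
        L2_lim (mu h) (\<lambda>t x. (P t f x - f x) / t) g (at_right 0) \<longleftrightarrow>
        (\<exists>\<phi> :: nat \<Rightarrow> real \<Rightarrow> real. (\<forall>n. \<phi> n \<in> test_functions) \<and>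
             L2_lim (mu h) \<phi> f sequentially \<and>
             L2_lim (mu h) (\<lambda>n. L_op h (\<phi> n)) g sequentially))"

definition brownian_motion :: "'w measure \<Rightarrow> (real \<Rightarrow> 'w \<Rightarrow> real) \<Rightarrow> bool" where
  "brownian_motion M B \<longleftrightarrow>
     prob_space M \<and>
     (\<forall>t\<ge>0. B t \<in> borel_measurable M) \<and>
     (AE \<omega> in M. B 0 \<omega> = 0) \<and>
     (AE \<omega> in M. continuous_on {0..} (\<lambda>t. B t \<omega>)) \<and>
     (\<forall>s t. 0 \<le> s \<and> s < t \<longrightarrow>
        distributed M lborel (\<lambda>\<omega>. B t \<omega> - B s \<omega>) (normal_density 0 (sqrt (t - s)))) \<and>
     (\<forall>(\<tau> :: nat \<Rightarrow> real) n. 0 \<le> \<tau> 0 \<and> mono \<tau> \<longrightarrow>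
        prob_space.indep_vars M (\<lambda>_. borel) (\<lambda>i \<omega>. B (\<tau> (Suc i)) \<omega> - B (\<tau> i) \<omega>) {..<n})"

text \<open>All paths of the solution, not only almost all, are required to be continuous: \<open>M\<close> need
  not be complete, and this makes the path integrals below measurable.\<close>

definition OU_process ::
  "'w measure \<Rightarrow> (real \<Rightarrow> 'w \<Rightarrow> real) \<Rightarrow> real \<Rightarrow> (real \<Rightarrow> 'w \<Rightarrow> real) \<Rightarrow> bool" where
  "OU_process M B x X \<longleftrightarrow>
     (\<forall>t\<ge>0. X t \<in> borel_measurable M) \<and>
     (\<forall>\<omega>\<in>space M. continuous_on {0..} (\<lambda>t. X t \<omega>)) \<and>
     (AE \<omega> in M. \<forall>t\<ge>0. X t \<omega> = x + sqrt 2 * B t \<omega> - integral {0..t} (\<lambda>s. X s \<omega>))"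

text \<open>In \<open>X x t\<close> the first argument is the starting point and the second one the time.\<close>

definition FK_repr ::
  "'w measure \<Rightarrow> (real \<Rightarrow> real \<Rightarrow> 'w \<Rightarrow> real) \<Rightarrow> (real \<Rightarrow> real) \<Rightarrow> real \<Rightarrow> (real \<Rightarrow> real)
     \<Rightarrow> real \<Rightarrow> real" where
  "FK_repr M X h t f x =
     exp (- W_fun h x / 2) *
     (\<integral>\<omega>. exp (W_fun h (X x t \<omega>) / 2) * f (X x t \<omega>) *
           exp (- integral {0..t} (\<lambda>s. V_fun h (X x s \<omega>))) \<partial>M)"

definition c_coeff :: "real \<Rightarrow> real" where
  "c_coeff t = exp (- t) / sqrt (1 - exp (- 2 * t))"

end

theory Submission
  imports Defs
begin

text \<open>Let \<open>Z\<close> be the Ornstein--Uhlenbeck process started at \<open>0\<close>. The process started at \<open>x\<close> is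
  \<open>exp (- s) * x + Z s\<close>, and the part of this translation that moves the end point, at time \<open>t\<close>,
  can be absorbed into a change of measure. With
  \<open>a s = sinh (t - s) / sinh t\<close> one has
  \<open>exp (- s) * x + Z s = a s * x + (Z s + exp (- t) * x * (sinh s / sinh t))\<close>, and \<open>sinh s / sinh t\<close> is
  \<open>Cov (Z s) (Z t) / Var (Z t)\<close>; by the Cameron--Martin theorem, translating \<open>Z\<close> by \<open>e\<close> times this
  function multiplies its law by \<open>exp (e * \<kappa> * Z t - e\<^sup>2 * \<kappa> / 2)\<close>, where
  \<open>\<kappa> = 1 / (1 - exp (- 2 * t))\<close> is the inverse of \<open>Var (Z t)\<close>. Hence
  \<open>exp (W x / 2) * P t f x\<close> is the expectation of \<open>q (Z t) * exp (E x)\<close>, where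
  \<open>q = exp (W / 2) * f\<close> and
  \<open>E x = exp (- t) * x * \<kappa> * Z t - (exp (- t) * x)\<^sup>2 * \<kappa> / 2 - (integral of V (a s * x + Z s) over s in {0..t})\<close>.

  The argument of the merely measurable function \<open>f\<close> no longer depends on \<open>x\<close>, and \<open>E\<close> is twice differentiable in \<open>x\<close>, with second
  derivative \<open>- (c_coeff t)\<^sup>2\<close> minus the integral of \<open>(a s)\<^sup>2 * V'' (a s * x + Z s)\<close>. Since
  \<open>0 \<le> a s \<le> exp (- s)\<close>, the integral of \<open>(a s)\<^sup>2\<close> is at most \<open>1 / 2\<close>; and \<open>sup V''\<close>, which may be
  assumed finite, is nonnegative because \<open>V\<close> is bounded below. So the second derivative of \<open>E\<close> is at least
  \<open>- (c_coeff t)\<^sup>2 - sup V'' / 2\<close>. This bound passes to the logarithm of the expectation by the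
  Cauchy--Schwarz inequality (\<open>log_second_derivative_ge\<close>), and subtracting \<open>W / 2\<close> yields the term with
  \<open>h''\<close>.

  The Cameron--Martin identity (\<open>cameron_martin\<close>) is obtained from its elementary version for finitely many
  independent Gaussian increments of the Brownian motion: the path is replaced by a step function, for which
  the Ornstein--Uhlenbeck path is a finite linear combination of increments, and the mesh tends to \<open>0\<close>.
  The Gaussian law of \<open>Z t\<close> is then a consequence of the identity (\<open>Z_normal\<close>). It justifies the
  differentiation under the expectation (\<open>dominated_log_weight\<close>): since \<open>\<kappa> > 1\<close>, the density of \<open>Z t\<close>
  decays faster than \<open>exp (- y\<^sup>2 / 2)\<close>, so that \<open>q (Z t)\<close> is square integrable even after multiplication
  by \<open>exp (l * \<bar>Z t\<bar>)\<close>.\<close>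

section \<open>Translating a Gaussian vector\<close>

lemma density_PiM:
  fixes f :: "'i \<Rightarrow> 'a \<Rightarrow> ennreal"
  assumes "product_sigma_finite N" and I: "finite I"
    and f[measurable]: "\<And>i. i \<in> I \<Longrightarrow> f i \<in> borel_measurable (N i)"
    and sf: "product_sigma_finite (\<lambda>i. density (N i) (f i))"
  shows "density (PiM I N) (\<lambda>x. \<Prod>i\<in>I. f i (x i)) = PiM I (\<lambda>i. density (N i) (f i))"
proof -
  interpret N: product_sigma_finite N by fact
  interpret D: product_sigma_finite "\<lambda>i. density (N i) (f i)" by fact
  show ?thesis
  proof (rule D.PiM_eqI[OF I])
    show "sets (density (PiM I N) (\<lambda>x. \<Prod>i\<in>I. f i (x i))) = sets (PiM I (\<lambda>i. density (N i) (f i)))"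
      by (simp cong: sets_PiM_cong)
    fix A assume A: "\<And>i. i \<in> I \<Longrightarrow> A i \<in> sets (density (N i) (f i))"
    have A'[measurable]: "\<And>i. i \<in> I \<Longrightarrow> A i \<in> sets (N i)" using A by simp
    have AE: "Pi\<^sub>E I A \<in> sets (PiM I N)" using A' I by (intro sets_PiM_I_finite) auto
    have "emeasure (density (PiM I N) (\<lambda>x. \<Prod>i\<in>I. f i (x i))) (Pi\<^sub>E I A)
       = (\<integral>\<^sup>+x. (\<Prod>i\<in>I. f i (x i)) * indicator (Pi\<^sub>E I A) x \<partial>PiM I N)"
      using I AE by (subst emeasure_density) auto
    also have "\<dots> = (\<integral>\<^sup>+x. (\<Prod>i\<in>I. f i (x i) * indicator (A i) (x i)) \<partial>PiM I N)"
    proof (rule nn_integral_cong)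
      fix x assume x: "x \<in> space (PiM I N)"
      have "indicator (Pi\<^sub>E I A) x = (\<Prod>i\<in>I. indicator (A i) (x i) :: ennreal)"
        using I x by (auto simp: indicator_def PiE_def space_PiM Pi_def prod_zero_iff)
      then show "(\<Prod>i\<in>I. f i (x i)) * indicator (Pi\<^sub>E I A) x = (\<Prod>i\<in>I. f i (x i) * indicator (A i) (x i))"
        by (simp add: prod.distrib)
    qed
    also have "\<dots> = (\<Prod>i\<in>I. \<integral>\<^sup>+x. f i x * indicator (A i) x \<partial>N i)"
      using I by (intro N.product_nn_integral_prod) auto
    also have "\<dots> = (\<Prod>i\<in>I. emeasure (density (N i) (f i)) (A i))"
      by (intro prod.cong refl) (auto simp: emeasure_density)
    finally show "emeasure (density (PiM I N) (\<lambda>x. \<Prod>i\<in>I. f i (x i))) (Pi\<^sub>E I A) = (\<Prod>i\<in>I. emeasure (density (N i) (f i)) (A i))" .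
  qed
qed

text \<open>The density of the normal law with mean \<open>m\<close> and variance \<open>v\<close> relative to the centred one with
  the same variance.\<close>

definition shift_density :: "real \<Rightarrow> real \<Rightarrow> real \<Rightarrow> real" where
  "shift_density m v y = exp (m * y / v - m\<^sup>2 / (2 * v))"

lemma shift_density_pos: "0 < shift_density m v y"
  by (simp add: shift_density_def)

lemma borel_measurable_shift_density[measurable]: "shift_density m v \<in> borel_measurable borel"
  by (simp add: shift_density_def[abs_def])

lemma normal_density_shift:
  assumes "0 < \<sigma>"
  shows "normal_density m \<sigma> y = normal_density 0 \<sigma> y * shift_density m (\<sigma>\<^sup>2) y"
proof -
  have "- (y - m)\<^sup>2 / (2 * \<sigma>\<^sup>2) = - (y - 0)\<^sup>2 / (2 * \<sigma>\<^sup>2) + (m * y / \<sigma>\<^sup>2 - m\<^sup>2 / (2 * \<sigma>\<^sup>2))"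
    using assms by (simp add: field_simps power2_eq_square)
  then show ?thesis
    unfolding normal_density_def shift_density_def by (simp only: exp_add)
qed

lemma (in prob_space) distr_shift_indep_normal:
  fixes D :: "'i \<Rightarrow> 'a \<Rightarrow> real"
  assumes I: "finite I" "I \<noteq> {}" and \<sigma>: "0 < \<sigma>"
    and indep: "indep_vars (\<lambda>_. borel) D I"
    and normal: "\<And>i. i \<in> I \<Longrightarrow> distributed M lborel (D i) (normal_density 0 \<sigma>)"
  shows "distr M (PiM I (\<lambda>_. borel)) (\<lambda>\<omega>. \<lambda>i\<in>I. D i \<omega> + m i) =
    density (distr M (PiM I (\<lambda>_. borel)) (\<lambda>\<omega>. \<lambda>i\<in>I. D i \<omega>))
      (\<lambda>x. ennreal (\<Prod>i\<in>I. shift_density (m i) (\<sigma>\<^sup>2) (x i)))"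
proof -
  have D[measurable]: "D i \<in> borel_measurable M" if "i \<in> I" for i
    using distributed_measurable[OF normal[OF that]] by simp
  have dD: "distr M borel (D i) = density lborel (normal_density 0 \<sigma>)" if "i \<in> I" for i
    using distributed_distr_eq_density[OF normal[OF that]]
    by (metis (no_types, lifting) distr_cong sets_lborel)
  have shifted: "distributed M lborel (\<lambda>\<omega>. D i \<omega> + m i) (normal_density (m i) \<sigma>)" if "i \<in> I" for i
    using normal_density_affine[OF normal[OF that] \<sigma>, of 1 "m i"] by (simp add: add.commute)
  have dDs: "distr M borel (\<lambda>\<omega>. D i \<omega> + m i) = density lborel (normal_density (m i) \<sigma>)" if "i \<in> I" for i
    using distributed_distr_eq_density[OF shifted[OF that]]
    by (metis (no_types, lifting) distr_cong sets_lborel)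
  have indep': "indep_vars (\<lambda>_. borel) (\<lambda>i \<omega>. D i \<omega> + m i) I"
    using indep_vars_compose2[OF indep, of "\<lambda>i y. y + m i" "\<lambda>_. borel"] by simp
  let ?N = "\<lambda>i. density lborel (normal_density 0 \<sigma>)"
  have ps: "prob_space (density lborel (normal_density mm \<sigma>))" for mm
    using prob_space_normal_density[OF \<sigma>] .
  have eqd: "density (density lborel (normal_density 0 \<sigma>)) (\<lambda>y. ennreal (shift_density mm (\<sigma>\<^sup>2) y))
      = density lborel (normal_density mm \<sigma>)" for mm
    by (subst density_density_eq)
       (auto simp: normal_density_shift[OF \<sigma>, of mm] ennreal_mult shift_density_pos less_imp_le
             intro!: density_cong)
  have pN: "product_sigma_finite ?N"
    by (simp add: product_sigma_finite_def ps prob_space_imp_sigma_finite)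
  have "distr M (PiM I (\<lambda>_. borel)) (\<lambda>\<omega>. \<lambda>i\<in>I. D i \<omega> + m i) = PiM I (\<lambda>i. distr M borel (\<lambda>\<omega>. D i \<omega> + m i))"
    using indep' by (subst (asm) indep_vars_iff_distr_eq_PiM'[OF I(2)]) auto
  also have "\<dots> = PiM I (\<lambda>i. density (?N i) (\<lambda>y. ennreal (shift_density (m i) (\<sigma>\<^sup>2) y)))"
    by (intro PiM_cong refl) (simp add: dDs eqd)
  also have "\<dots> = density (PiM I ?N) (\<lambda>x. \<Prod>i\<in>I. ennreal (shift_density (m i) (\<sigma>\<^sup>2) (x i)))"
    by (subst density_PiM[OF pN I(1)])
       (auto simp: eqd product_sigma_finite_def ps prob_space_imp_sigma_finite)
  also have "PiM I ?N = PiM I (\<lambda>i. distr M borel (D i))"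
    by (intro PiM_cong refl) (simp add: dD)
  also have "\<dots> = distr M (PiM I (\<lambda>_. borel)) (\<lambda>\<omega>. \<lambda>i\<in>I. D i \<omega>)"
    using indep by (subst (asm) indep_vars_iff_distr_eq_PiM'[OF I(2)]) auto
  also have "(\<lambda>x. \<Prod>i\<in>I. ennreal (shift_density (m i) (\<sigma>\<^sup>2) (x i))) =
      (\<lambda>x. ennreal (\<Prod>i\<in>I. shift_density (m i) (\<sigma>\<^sup>2) (x i)))"
    by (simp add: prod_ennreal shift_density_pos less_imp_le)
  finally show ?thesis .
qed

text \<open>The Cameron--Martin formula in finite dimension.\<close>

lemma (in prob_space) expectation_shift_indep_normal:
  fixes D :: "'i \<Rightarrow> 'a \<Rightarrow> real" and F :: "('i \<Rightarrow> real) \<Rightarrow> real"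
  assumes I: "finite I" "I \<noteq> {}" and \<sigma>: "0 < \<sigma>"
    and indep: "indep_vars (\<lambda>_. borel) D I"
    and normal: "\<And>i. i \<in> I \<Longrightarrow> distributed M lborel (D i) (normal_density 0 \<sigma>)"
    and F[measurable]: "F \<in> borel_measurable (PiM I (\<lambda>_. borel))"
  shows "expectation (\<lambda>\<omega>. F (\<lambda>i\<in>I. D i \<omega> + m i)) =
    expectation (\<lambda>\<omega>. exp ((\<Sum>i\<in>I. m i * D i \<omega>) / \<sigma>\<^sup>2 - (\<Sum>i\<in>I. (m i)\<^sup>2) / (2 * \<sigma>\<^sup>2)) * F (\<lambda>i\<in>I. D i \<omega>))"
proof -
  have D[measurable]: "D i \<in> borel_measurable M" if "i \<in> I" for i
    using distributed_measurable[OF normal[OF that]] by simp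
  let ?P = "PiM I (\<lambda>_. borel :: real measure)"
  let ?G = "\<lambda>x. \<Prod>i\<in>I. shift_density (m i) (\<sigma>\<^sup>2) (x i)"
  have "expectation (\<lambda>\<omega>. F (\<lambda>i\<in>I. D i \<omega> + m i)) = integral\<^sup>L (distr M ?P (\<lambda>\<omega>. \<lambda>i\<in>I. D i \<omega> + m i)) F"
    by (subst integral_distr) auto
  also have "\<dots> = integral\<^sup>L (density (distr M ?P (\<lambda>\<omega>. \<lambda>i\<in>I. D i \<omega>)) (\<lambda>x. ennreal (?G x))) F"
    by (subst distr_shift_indep_normal[OF I \<sigma> indep normal]) auto
  also have "\<dots> = integral\<^sup>L (distr M ?P (\<lambda>\<omega>. \<lambda>i\<in>I. D i \<omega>)) (\<lambda>x. ?G x * F x)"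
    by (subst integral_density) (auto intro!: AE_I2 prod_nonneg simp: shift_density_pos less_imp_le)
  also have "\<dots> = expectation (\<lambda>\<omega>. ?G (\<lambda>i\<in>I. D i \<omega>) * F (\<lambda>i\<in>I. D i \<omega>))"
    by (subst integral_distr) auto
  also have "(\<lambda>\<omega>. ?G (\<lambda>i\<in>I. D i \<omega>)) =
      (\<lambda>\<omega>. exp ((\<Sum>i\<in>I. m i * D i \<omega>) / \<sigma>\<^sup>2 - (\<Sum>i\<in>I. (m i)\<^sup>2) / (2 * \<sigma>\<^sup>2)))"
    using I by (auto simp: shift_density_def exp_sum[symmetric] sum_subtractf sum_divide_distrib)
  finally show ?thesis .
qed

section \<open>The Ornstein--Uhlenbeck path driven by a given path\<close>

lemma bounded_continuous_interval:
  fixes w :: "real \<Rightarrow> real"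
  assumes "continuous_on {a..b} w"
  obtains C where "\<And>r. a \<le> r \<Longrightarrow> r \<le> b \<Longrightarrow> \<bar>w r\<bar> \<le> C"
  using compact_imp_bounded[OF compact_continuous_image[OF assms compact_Icc]]
  unfolding bounded_iff by (metis atLeastAtMost_iff image_eqI real_norm_def)

text \<open>The solution of \<open>X s = sqrt 2 * w s - (integral of X over {0..s})\<close>, obtained from the stochastic
  integral of \<open>exp (r - s)\<close> against \<open>sqrt 2 * w\<close> by parts, so that it makes sense for every locally
  integrable path \<open>w\<close>.\<close>

definition OU_path :: "(real \<Rightarrow> real) \<Rightarrow> real \<Rightarrow> real" where
  "OU_path w s = sqrt 2 * (w s - (LINT r:{0..s}|lborel. exp (r - s) * w r))"

lemma OU_equation_solution:
  fixes w X :: "real \<Rightarrow> real"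
  assumes w: "continuous_on {0..} w" and X: "continuous_on {0..} X"
    and eq: "\<And>t. t \<ge> 0 \<Longrightarrow> X t = x + sqrt 2 * w t - integral {0..t} X"
    and t: "t \<ge> 0"
  shows "X t = exp (- t) * x + OU_path w t"
proof -
  \<comment> \<open>\<open>exp s * J s\<close> has the derivative \<open>exp s * (x + sqrt 2 * w s)\<close>.\<close>
  define J where "J s = integral {0..s} X" for s
  have Xt: "continuous_on {0..t} X" using X by (rule continuous_on_subset) auto
  have wt: "continuous_on {0..t} w" using w by (rule continuous_on_subset) auto
  have J: "(J has_real_derivative X s) (at s within {0..t})" if "s \<in> {0..t}" for s
    unfolding J_def using integral_has_real_derivative[OF Xt that] .
  have "((\<lambda>s. exp s * J s) has_vector_derivative exp s * (x + sqrt 2 * w s)) (at s within {0..t})"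
    if "s \<in> {0..t}" for s
  proof -
    have "x + sqrt 2 * w s = X s + J s" using that eq[of s] by (simp add: J_def)
    then show ?thesis
      unfolding has_real_derivative_iff_has_vector_derivative[symmetric]
      by (auto intro!: derivative_eq_intros J that simp: distrib_left)
  qed
  from fundamental_theorem_of_calculus[OF t this]
  have 1: "((\<lambda>s. exp s * (x + sqrt 2 * w s)) has_integral exp t * J t) {0..t}"
    by (simp add: J_def)
  have int_e: "((\<lambda>s. exp s * x) has_integral exp t * x - exp 0 * x) {0..t}"
    by (rule fundamental_theorem_of_calculus[OF t])
       (auto intro!: derivative_eq_intros simp: has_real_derivative_iff_has_vector_derivative[symmetric])
  have 2: "((\<lambda>s. exp (- t) / sqrt 2 * (exp s * (x + sqrt 2 * w s) - exp s * x)) has_integral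
      exp (- t) / sqrt 2 * (exp t * J t - (exp t * x - exp 0 * x))) {0..t}"
    by (intro has_integral_mult_right has_integral_diff 1 int_e)
  have "(\<lambda>s. exp (- t) / sqrt 2 * (exp s * (x + sqrt 2 * w s) - exp s * x)) = (\<lambda>s. exp (s - t) * w s)"
    by (auto simp: fun_eq_iff algebra_simps exp_diff exp_minus divide_simps)
  then have "integral {0..t} (\<lambda>s. exp (s - t) * w s) =
      exp (- t) / sqrt 2 * (exp t * J t - (exp t * x - exp 0 * x))"
    using 2 by (simp add: integral_unique)
  also have "\<dots> = (J t - x + exp (- t) * x) / sqrt 2"
    by (simp add: exp_minus field_simps)
  finally have 3: "integral {0..t} (\<lambda>s. exp (s - t) * w s) = (J t - x + exp (- t) * x) / sqrt 2" .
  have "set_integrable lborel {0..t} (\<lambda>s. exp (s - t) * w s)"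
    by (intro borel_integrable_atLeastAtMost' continuous_intros wt)
  from set_borel_integral_eq_integral(2)[OF this] 3
  have "OU_path w t = sqrt 2 * w t - (J t - x + exp (- t) * x)"
    unfolding OU_path_def by (simp add: right_diff_distrib)
  with eq[OF t] show ?thesis by (simp add: J_def)
qed

text \<open>The step function whose value at \<open>r\<close> in \<open>{0..t}\<close> is \<open>w p - w 0\<close>, where \<open>p\<close> is the last of the grid points
  \<open>t * j / n\<close> that is at most \<open>r\<close>. Written as a sum over the increments of \<open>w\<close>, it depends on them linearly.\<close>

definition step_path :: "real \<Rightarrow> nat \<Rightarrow> (real \<Rightarrow> real) \<Rightarrow> real \<Rightarrow> real" where
  "step_path t n w r =
    (\<Sum>j<n. (w (t * real (Suc j) / n) - w (t * real j / n)) * indicator {t * real (Suc j) / n..} r)"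

text \<open>The Ornstein--Uhlenbeck path driven by a unit jump at the grid point \<open>t * Suc j / n\<close>.\<close>

definition step_kernel :: "real \<Rightarrow> nat \<Rightarrow> nat \<Rightarrow> real \<Rightarrow> real" where
  "step_kernel t n j s =
    sqrt 2 * (indicator {t * real (Suc j) / n..} s * exp (t * real (Suc j) / n - s))"

lemma step_path_eq:
  assumes "0 < t" "0 < n" "0 \<le> r" "r \<le> t" "w 0 = 0"
  shows "step_path t n w r = w (t * real (nat \<lfloor>r * n / t\<rfloor>) / n)"
proof -
  define k where "k = nat \<lfloor>r * n / t\<rfloor>"
  have le: "t * real (Suc j) / n \<le> r \<longleftrightarrow> j < k" for j
  proof -
    have "t * real (Suc j) / n \<le> r \<longleftrightarrow> real (Suc j) \<le> r * n / t"
      using assms by (simp add: field_simps)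
    also have "\<dots> \<longleftrightarrow> Suc j \<le> k"
      unfolding k_def using assms by (simp add: le_nat_iff le_floor_iff)
    finally show ?thesis by auto
  qed
  have "r * n / t \<le> n" using assms by (simp add: field_simps)
  then have "k \<le> n" unfolding k_def by linarith
  have "step_path t n w r = (\<Sum>j<n. if j < k then w (t * real (Suc j) / n) - w (t * real j / n) else 0)"
    unfolding step_path_def by (intro sum.cong refl) (simp add: indicator_def le del: of_nat_Suc)
  also have "\<dots> = (\<Sum>j<k. w (t * real (Suc j) / n) - w (t * real j / n))"
    using \<open>k \<le> n\<close> by (simp add: sum.If_cases Int_absorb1 lessThan_def[symmetric] subset_eq)
  also have "\<dots> = w (t * real k / n) - w (t * real 0 / n)"
    by (rule sum_lessThan_telescope)
  finally show ?thesis using assms by (simp add: k_def)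
qed

lemma step_point_bounds:
  assumes "0 < t" "0 < n" "0 \<le> r" "r \<le> t"
  defines "p \<equiv> t * real (nat \<lfloor>r * n / t\<rfloor>) / n"
  shows "0 \<le> p" "p \<le> r" "r - t / n \<le> p"
proof -
  define q where "q = r * n / t"
  have q: "0 \<le> q" using assms by (simp add: q_def)
  have f: "real (nat \<lfloor>q\<rfloor>) \<le> q" "q - 1 \<le> real (nat \<lfloor>q\<rfloor>)" using q by linarith+
  have r: "r = t * q / n" using assms by (simp add: q_def)
  have p: "p = t * real (nat \<lfloor>q\<rfloor>) / n" by (simp add: p_def q_def)
  show "0 \<le> p" using assms by (simp add: p)
  show "p \<le> r" unfolding p r using f assms by (intro divide_right_mono mult_left_mono) auto
  have "r - t / n = t * (q - 1) / n" by (simp add: r diff_divide_distrib right_diff_distrib)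
  also have "\<dots> \<le> p" unfolding p using f assms by (intro divide_right_mono mult_left_mono) auto
  finally show "r - t / n \<le> p" .
qed

lemma step_path_bound:
  assumes "0 < t" "0 < n" "0 \<le> r" "r \<le> t" "w 0 = 0"
    and "\<And>s. 0 \<le> s \<Longrightarrow> s \<le> t \<Longrightarrow> \<bar>w s\<bar> \<le> C"
  shows "\<bar>step_path t n w r\<bar> \<le> C"
  using step_path_eq[of t n r w] step_point_bounds[of t n r] assms by auto

lemma step_path_tendsto:
  assumes t: "0 < t" and r: "0 \<le> r" "r \<le> t" and w0: "w 0 = 0" and w: "continuous_on {0..t} w"
  shows "(\<lambda>n. step_path t (Suc n) w r) \<longlonglongrightarrow> w r"
proof -
  define p where "p n = t * real (nat \<lfloor>r * Suc n / t\<rfloor>) / Suc n" for n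
  have p: "0 \<le> p n" "p n \<le> r" "r - t / Suc n \<le> p n" for n
    unfolding p_def by (rule step_point_bounds; use t r in simp)+
  have lim: "(\<lambda>n. r - t / Suc n) \<longlonglongrightarrow> r"
    using tendsto_diff[OF tendsto_const[of r] LIMSEQ_Suc[OF lim_const_over_n[of t]]] by simp
  have "p \<longlonglongrightarrow> r"
    by (rule tendsto_sandwich[OF _ _ lim tendsto_const[of r]]) (use p in auto)
  then have "(\<lambda>n. w (p n)) \<longlonglongrightarrow> w r"
    by (rule continuous_on_tendsto_compose[OF w]) (use p r order_trans[OF p(2) r(2)] in auto)
  then show ?thesis
    unfolding p_def using step_path_eq[where w=w, OF t zero_less_Suc r w0] by (simp del: of_nat_Suc)
qed

lemma borel_measurable_step_path[measurable]: "step_path t n w \<in> borel_measurable borel"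
  unfolding step_path_def[abs_def] by measurable

lemma OU_path_step_path:
  assumes t: "0 < t" and s: "0 \<le> s"
  shows "OU_path (step_path t n w) s =
    (\<Sum>j<n. (w (t * real (Suc j) / n) - w (t * real j / n)) * step_kernel t n j s)"
proof -
  define c where "c j = t * real (Suc j) / n" for j
  define d where "d j = w (t * real (Suc j) / n) - w (t * real j / n)" for j
  have c: "0 \<le> c j" for j using t by (simp add: c_def)
  have int: "set_integrable lborel {0..s} (\<lambda>r. exp (r - s) * (d j * indicator {c j..} r))"
    and val: "(LINT r:{0..s}|lborel. exp (r - s) * (d j * indicator {c j..} r)) =
       d j * (indicator {c j..} s * (1 - exp (c j - s)))" for j
  proof -
    have eq: "indicator {0..s} r *\<^sub>R (exp (r - s) * (d j * indicator {c j..} r)) =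
        d j * (indicator {c j..s} r *\<^sub>R exp (r - s))" for r
      using c[of j] by (auto simp: indicator_def)
    have I: "set_integrable lborel {c j..s} (\<lambda>r. exp (r - s))"
      by (intro borel_integrable_atLeastAtMost' continuous_intros)
    then show "set_integrable lborel {0..s} (\<lambda>r. exp (r - s) * (d j * indicator {c j..} r))"
      unfolding set_integrable_def eq by simp
    have "(LINT r:{c j..s}|lborel. exp (r - s)) = indicator {c j..} s * (1 - exp (c j - s))"
    proof (cases "c j \<le> s")
      case True
      have "((\<lambda>r. exp (r - s)) has_integral exp (s - s) - exp (c j - s)) {c j..s}"
        by (rule fundamental_theorem_of_calculus[OF True])
           (auto intro!: derivative_eq_intros simp: has_real_derivative_iff_has_vector_derivative[symmetric])
      then show ?thesis
        using set_borel_integral_eq_integral(2)[OF I] True by (simp add: integral_unique)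
    qed (simp add: set_lebesgue_integral_def)
    then show "(LINT r:{0..s}|lborel. exp (r - s) * (d j * indicator {c j..} r)) =
       d j * (indicator {c j..} s * (1 - exp (c j - s)))"
      unfolding set_lebesgue_integral_def eq by simp
  qed
  have "(LINT r:{0..s}|lborel. exp (r - s) * step_path t n w r) =
      (LINT r:{0..s}|lborel. (\<Sum>j<n. exp (r - s) * (d j * indicator {c j..} r)))"
    unfolding step_path_def c_def d_def sum_distrib_left ..
  also have "\<dots> = (\<Sum>j<n. d j * (indicator {c j..} s * (1 - exp (c j - s))))"
    unfolding val[symmetric] using int
    unfolding set_lebesgue_integral_def set_integrable_def scaleR_sum_right
    by (intro Bochner_Integration.integral_sum) auto
  finally have I: "(LINT r:{0..s}|lborel. exp (r - s) * step_path t n w r) =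
    (\<Sum>j<n. d j * (indicator {c j..} s * (1 - exp (c j - s))))" .
  have "OU_path (step_path t n w) s = (\<Sum>j<n. sqrt 2 * (d j * indicator {c j..} s -
      d j * (indicator {c j..} s * (1 - exp (c j - s)))))"
    unfolding OU_path_def I unfolding step_path_def
    by (simp add: c_def d_def sum_subtractf sum_distrib_left right_diff_distrib)
  also have "\<dots> = (\<Sum>j<n. d j * step_kernel t n j s)"
    by (intro sum.cong refl) (simp add: step_kernel_def c_def algebra_simps)
  finally show ?thesis by (simp add: d_def)
qed

lemma OU_path_step_path_bound:
  assumes t: "0 < t" and s: "0 \<le> s" "s \<le> t" and w0: "w 0 = 0"
    and C: "\<And>r. 0 \<le> r \<Longrightarrow> r \<le> t \<Longrightarrow> \<bar>w r\<bar> \<le> C"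
  shows "\<bar>OU_path (step_path t (Suc n) w) s\<bar> \<le> sqrt 2 * (C + C * t)"
proof -
  let ?p = "step_path t (Suc n) w"
  have C0: "0 \<le> C" using C[of 0] t by auto
  have "\<bar>LINT r:{0..s}|lborel. exp (r - s) * ?p r\<bar> \<le> (LINT r:{0..s}|lborel. C)"
    unfolding set_lebesgue_integral_def real_norm_def[symmetric]
  proof (rule Bochner_Integration.integral_norm_bound_integral)
    have 1: "norm (indicator {0..s} r *\<^sub>R (exp (r - s) * ?p r)) \<le> indicator {0..s} r *\<^sub>R C" for r
    proof (cases "r \<in> {0..s}")
      case True
      then have "\<bar>?p r\<bar> \<le> C" using s by (intro step_path_bound[where w=w and C=C, OF t zero_less_Suc _ _ w0 C]) auto
      moreover have "exp (r - s) \<le> 1" using True by simp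
      ultimately have "exp (r - s) * \<bar>?p r\<bar> \<le> 1 * C" by (intro mult_mono) auto
      then show ?thesis using True by (simp add: abs_mult)
    qed simp
    show iC: "integrable lborel (\<lambda>r. indicator {0..s} r *\<^sub>R C)"
      using borel_integrable_atLeastAtMost'[OF continuous_on_const[of "{0..s}" C]]
      by (simp add: set_integrable_def)
    show "integrable lborel (\<lambda>r. indicator {0..s} r *\<^sub>R (exp (r - s) * ?p r))"
      by (rule Bochner_Integration.integrable_bound[OF iC]) (use 1 C0 in \<open>auto intro!: AE_I2\<close>)
    show "norm (indicator {0..s} r *\<^sub>R (exp (r - s) * ?p r)) \<le> indicator {0..s} r *\<^sub>R C" for r
      using 1[of r] by simp
  qed
  also have "\<dots> = C * s" using s by (simp add: set_lebesgue_integral_def)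
  also have "\<dots> \<le> C * t" using s C0 by (intro mult_left_mono) auto
  finally have "\<bar>LINT r:{0..s}|lborel. exp (r - s) * ?p r\<bar> \<le> C * t" .
  moreover have "\<bar>?p s\<bar> \<le> C" using s by (intro step_path_bound[where w=w and C=C, OF t zero_less_Suc _ _ w0 C]) auto
  ultimately have "\<bar>?p s - (LINT r:{0..s}|lborel. exp (r - s) * ?p r)\<bar> \<le> C + C * t" by linarith
  then show ?thesis unfolding OU_path_def by (simp add: abs_mult)
qed

lemma OU_path_step_path_tendsto:
  assumes t: "0 < t" and s: "0 \<le> s" "s \<le> t" and w0: "w 0 = 0" and w: "continuous_on {0..t} w"
  shows "(\<lambda>n. OU_path (step_path t (Suc n) w) s) \<longlonglongrightarrow> OU_path w s"
proof -
  obtain C where C: "\<And>r. 0 \<le> r \<Longrightarrow> r \<le> t \<Longrightarrow> \<bar>w r\<bar> \<le> C"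
    by (rule bounded_continuous_interval[OF w]) blast
  have ws: "set_integrable lborel {0..s} (\<lambda>r. exp (r - s) * w r)"
    by (intro borel_integrable_atLeastAtMost' continuous_intros continuous_on_subset[OF w]) (use s in auto)
  have "(\<lambda>n. LINT r:{0..s}|lborel. exp (r - s) * step_path t (Suc n) w r)
      \<longlonglongrightarrow> (LINT r:{0..s}|lborel. exp (r - s) * w r)"
    unfolding set_lebesgue_integral_def
  proof (rule integral_dominated_convergence[where w="\<lambda>r. indicator {0..s} r *\<^sub>R C"])
    show "(\<lambda>r. indicator {0..s} r *\<^sub>R (exp (r - s) * w r)) \<in> borel_measurable lborel"
      using ws unfolding set_integrable_def by (rule borel_measurable_integrable)
    show "AE r in lborel. (\<lambda>n. indicator {0..s} r *\<^sub>R (exp (r - s) * step_path t (Suc n) w r))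
        \<longlonglongrightarrow> indicator {0..s} r *\<^sub>R (exp (r - s) * w r)"
    proof (rule AE_I2)
      fix r show "(\<lambda>n. indicator {0..s} r *\<^sub>R (exp (r - s) * step_path t (Suc n) w r))
        \<longlonglongrightarrow> indicator {0..s} r *\<^sub>R (exp (r - s) * w r)"
      proof (cases "r \<in> {0..s}")
        case True
        then have "(\<lambda>n. step_path t (Suc n) w r) \<longlonglongrightarrow> w r"
          using s by (intro step_path_tendsto[OF t _ _ w0 w]) auto
        then show ?thesis by (intro tendsto_intros)
      qed simp
    qed
    show "AE r in lborel. norm (indicator {0..s} r *\<^sub>R (exp (r - s) * step_path t (Suc n) w r))
        \<le> indicator {0..s} r *\<^sub>R C" for n
    proof (rule AE_I2)
      fix r show "norm (indicator {0..s} r *\<^sub>R (exp (r - s) * step_path t (Suc n) w r))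
        \<le> indicator {0..s} r *\<^sub>R C"
      proof (cases "r \<in> {0..s}")
        case True
        then have "\<bar>step_path t (Suc n) w r\<bar> \<le> C"
          using s by (intro step_path_bound[where w=w and C=C, OF t zero_less_Suc _ _ w0 C]) auto
        moreover have "exp (r - s) \<le> 1" using True by simp
        ultimately have "exp (r - s) * \<bar>step_path t (Suc n) w r\<bar> \<le> 1 * C" by (intro mult_mono) auto
        then show ?thesis using True by (simp add: abs_mult)
      qed simp
    qed
    show "integrable lborel (\<lambda>r. indicator {0..s} r *\<^sub>R C)"
      using borel_integrable_atLeastAtMost'[OF continuous_on_const[of "{0..s}" C]]
      by (simp add: set_integrable_def)
  qed auto
  then show ?thesis
    unfolding OU_path_def by (intro tendsto_intros step_path_tendsto[OF t s w0 w])
qed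

lemma OU_path_exp:
  assumes s: "0 \<le> s"
  shows "OU_path (\<lambda>r. (exp r - 1) / (sqrt 2 * a)) s = sinh s / a"
proof -
  define c where "c = 1 / (sqrt 2 * a)"
  define A where "A r = c * (exp (2 * r - s) / 2 - exp (r - s))" for r
  have eq: "exp (r - s) * ((exp r - 1) / (sqrt 2 * a)) = c * (exp (2 * r - s) - exp (r - s))" for r
    by (simp add: c_def right_diff_distrib diff_divide_distrib exp_add[symmetric])
  have D: "(A has_vector_derivative c * (exp (2 * r - s) - exp (r - s))) (at r within {0..s})" for r
    unfolding A_def has_real_derivative_iff_has_vector_derivative[symmetric]
    by (rule derivative_eq_intros refl | simp)+
  have I1: "((\<lambda>r. exp (r - s) * ((exp r - 1) / (sqrt 2 * a))) has_integral A s - A 0) {0..s}"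
    unfolding eq by (rule fundamental_theorem_of_calculus[OF s D])
  have si: "set_integrable lborel {0..s} (\<lambda>r. exp (r - s) * ((exp r - 1) / (sqrt 2 * a)))"
    unfolding eq by (intro borel_integrable_atLeastAtMost' continuous_intros)
  have I: "(LINT r:{0..s}|lborel. exp (r - s) * ((exp r - 1) / (sqrt 2 * a))) = A s - A 0"
    by (rule trans[OF set_borel_integral_eq_integral(2)[OF si] integral_unique[OF I1]])
  have "OU_path (\<lambda>r. (exp r - 1) / (sqrt 2 * a)) s =
      (exp s - 1 - ((exp s / 2 - 1) - (exp (- s) / 2 - exp (- s)))) / a"
    unfolding OU_path_def I A_def c_def by (cases "a = 0") (simp_all add: field_simps)
  then show ?thesis by (simp add: sinh_def algebra_simps)
qed

text \<open>The Brownian translation that moves the Ornstein--Uhlenbeck path by \<open>sinh s / sinh t\<close>. The increments of an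
  exponential over a uniform grid are proportional to its values; therefore the discrete Cameron--Martin
  density for this direction involves the increments of the Brownian motion only through the end point
  of the discretised Ornstein--Uhlenbeck path.\<close>

definition cm_direction :: "real \<Rightarrow> real \<Rightarrow> real" where
  "cm_direction t r = (exp r - 1) / (sqrt 2 * sinh t)"

lemma OU_path_cm_direction: "0 \<le> s \<Longrightarrow> OU_path (cm_direction t) s = sinh s / sinh t"
  using OU_path_exp[of s "sinh t"] by (simp add: cm_direction_def[abs_def])

section \<open>The Cameron--Martin identity for the Ornstein--Uhlenbeck process\<close>

text \<open>The time is cut off at \<open>0\<close> because nothing is assumed about \<open>Z s\<close> for negative \<open>s\<close>.\<close>

lemma continuous_paths_jointly_measurable:
  fixes Z :: "real \<Rightarrow> 'a \<Rightarrow> real"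
  assumes meas: "\<And>s. s \<ge> 0 \<Longrightarrow> Z s \<in> borel_measurable M"
    and cont: "\<And>\<omega>. \<omega> \<in> space M \<Longrightarrow> continuous_on {0..} (\<lambda>s. Z s \<omega>)"
  shows "(\<lambda>(\<omega>, s). Z (max 0 s) \<omega>) \<in> borel_measurable (M \<Otimes>\<^sub>M borel)"
proof -
  define g where "g n s = nat \<lfloor>max 0 s * real (Suc n)\<rfloor>" for n and s :: real
  have "(\<lambda>p. Z (real (g n (snd p)) / real (Suc n)) (fst p)) \<in> borel_measurable (M \<Otimes>\<^sub>M borel)" for n
  proof (rule measurable_compose_countable[where f="\<lambda>i p. Z (real i / real (Suc n)) (fst p)" and g="\<lambda>p. g n (snd p)"])
    show "(\<lambda>p. Z (real i / real (Suc n)) (fst p)) \<in> borel_measurable (M \<Otimes>\<^sub>M borel)" for i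
      using meas[of "real i / real (Suc n)"] by (intro measurable_compose[OF measurable_fst]) simp
    show "(\<lambda>p. g n (snd p)) \<in> measurable (M \<Otimes>\<^sub>M borel) (count_space UNIV)"
      unfolding g_def by measurable
  qed
  then show ?thesis
  proof (rule borel_measurable_LIMSEQ_real[rotated])
    fix p :: "'a \<times> real" assume "p \<in> space (M \<Otimes>\<^sub>M borel)"
    then have \<omega>: "fst p \<in> space M" by (auto simp: space_pair_measure)
    define u where "u = max 0 (snd p)"
    have b: "u - 1 / Suc n \<le> real (g n (snd p)) / Suc n" "real (g n (snd p)) / Suc n \<le> u" for n
    proof -
      have "0 \<le> u * real (Suc n)" by (simp add: u_def)
      then have "u * Suc n - 1 \<le> real (g n (snd p))" "real (g n (snd p)) \<le> u * Suc n"
        unfolding g_def u_def[symmetric] by linarith+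
      moreover have "u - 1 / Suc n = (u * Suc n - 1) / Suc n" "u = u * Suc n / Suc n"
        by (simp_all add: diff_divide_distrib del: of_nat_Suc)
      ultimately show "u - 1 / Suc n \<le> real (g n (snd p)) / Suc n" "real (g n (snd p)) / Suc n \<le> u"
        by (metis divide_right_mono of_nat_0_le_iff)+
    qed
    have lim: "(\<lambda>n. u - 1 / Suc n) \<longlonglongrightarrow> u"
      using tendsto_diff[OF tendsto_const[of u] LIMSEQ_Suc[OF lim_const_over_n[of 1]]] by simp
    have "(\<lambda>n. real (g n (snd p)) / Suc n) \<longlonglongrightarrow> u"
      by (rule tendsto_sandwich[OF _ _ lim tendsto_const]) (use b in auto)
    from continuous_on_tendsto_compose[OF cont[OF \<omega>] this]
    have "(\<lambda>n. Z (real (g n (snd p)) / Suc n) (fst p)) \<longlonglongrightarrow> Z u (fst p)"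
      by (simp add: u_def)
    then show "(\<lambda>n. Z (real (g n (snd p)) / real (Suc n)) (fst p)) \<longlonglongrightarrow> (case p of (\<omega>, s) \<Rightarrow> Z (max 0 s) \<omega>)"
      by (simp add: u_def split_beta)
  qed
qed

lemma path_integral_measurable:
  fixes U :: "real \<Rightarrow> real \<Rightarrow> real" and Z :: "real \<Rightarrow> 'a \<Rightarrow> real"
  assumes meas: "\<And>s. s \<ge> 0 \<Longrightarrow> Z s \<in> borel_measurable M"
    and cont: "\<And>\<omega>. \<omega> \<in> space M \<Longrightarrow> continuous_on {0..} (\<lambda>s. Z s \<omega>)"
    and U: "continuous_on UNIV (\<lambda>(s, z). U s z)"
  shows "(\<lambda>\<omega>. LINT s:{0..t}|lborel. U s (Z s \<omega>)) \<in> borel_measurable M"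
proof -
  have [measurable]: "(\<lambda>(\<omega>, s). Z (max 0 s) \<omega>) \<in> borel_measurable (M \<Otimes>\<^sub>M borel)"
    using meas cont by (rule continuous_paths_jointly_measurable)
  have [measurable]: "(\<lambda>(s, z). U s z) \<in> borel_measurable (borel \<Otimes>\<^sub>M borel)"
    using borel_measurable_continuous_onI[OF U] by (simp add: borel_prod)
  have "(\<lambda>\<omega>. LINT s|lborel. indicator {0..t} s *\<^sub>R U s (Z s \<omega>)) =
      (\<lambda>\<omega>. LINT s|lborel. indicator {0..t} s *\<^sub>R U s (Z (max 0 s) \<omega>))"
    by (intro ext Bochner_Integration.integral_cong refl) (auto simp: indicator_def)
  moreover have "(\<lambda>\<omega>. LINT s|lborel. indicator {0..t} s *\<^sub>R U s (Z (max 0 s) \<omega>)) \<in> borel_measurable M"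
    by measurable
  ultimately show ?thesis by (simp add: set_lebesgue_integral_def)
qed

text \<open>The Ornstein--Uhlenbeck path driven by the step function \<open>step_path t n w\<close> (see \<open>OU_step_eq\<close>).\<close>

definition OU_step :: "real \<Rightarrow> nat \<Rightarrow> (real \<Rightarrow> real) \<Rightarrow> real \<Rightarrow> real" where
  "OU_step t n w s =
    (\<Sum>j<n. (w (t * real (Suc j) / n) - w (t * real j / n)) * step_kernel t n j s)"

lemma step_kernel_measurable[measurable]: "step_kernel t n j \<in> borel_measurable borel"
  unfolding step_kernel_def[abs_def] by measurable

lemma OU_step_measurable[measurable]: "OU_step t n w \<in> borel_measurable borel"
  unfolding OU_step_def[abs_def] by measurable

lemma OU_step_eq: "0 < t \<Longrightarrow> 0 \<le> s \<Longrightarrow> OU_step t n w s = OU_path (step_path t n w) s"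
  by (simp add: OU_path_step_path OU_step_def)

lemma path_integral_tendsto:
  fixes U :: "real \<Rightarrow> real \<Rightarrow> real"
  assumes U: "continuous_on UNIV (\<lambda>(s, z). U s z)"
    and z[measurable]: "\<And>n. zs n \<in> borel_measurable borel"
    and lim: "\<And>s. 0 \<le> s \<Longrightarrow> s \<le> t \<Longrightarrow> (\<lambda>n. zs n s) \<longlonglongrightarrow> z s"
    and bound: "\<And>n s. 0 \<le> s \<Longrightarrow> s \<le> t \<Longrightarrow> \<bar>zs n s\<bar> \<le> R"
  shows "(\<lambda>n. LINT s:{0..t}|lborel. U s (zs n s)) \<longlonglongrightarrow> (LINT s:{0..t}|lborel. U s (z s))"
proof -
  have [measurable]: "(\<lambda>(s, z). U s z) \<in> borel_measurable (borel \<Otimes>\<^sub>M borel)"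
    using borel_measurable_continuous_onI[OF U] by (simp add: borel_prod)
  have "compact ((\<lambda>(s, z). U s z) ` ({0..t} \<times> {-R..R}))"
    by (intro compact_continuous_image compact_Times continuous_on_subset[OF U]) auto
  then obtain C where "\<forall>u\<in>(\<lambda>(s, z). U s z) ` ({0..t} \<times> {-R..R}). norm u \<le> C"
    using compact_imp_bounded bounded_iff by blast
  then have C: "\<bar>U s z\<bar> \<le> C" if "0 \<le> s" "s \<le> t" "\<bar>z\<bar> \<le> R" for s z
    using that by (force simp: abs_le_iff)
  have U1: "isCont (\<lambda>(s, z). U s z) p" for p
    using U by (cases p) (simp add: continuous_on_eq_continuous_at)
  have UL: "(\<lambda>n. indicator {0..t} s *\<^sub>R U s (zs n s)) \<longlonglongrightarrow> indicator {0..t} s *\<^sub>R U s (z s)" for s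
  proof (cases "s \<in> {0..t}")
    case True
    then have "(\<lambda>n. (s, zs n s)) \<longlonglongrightarrow> (s, z s)"
      using lim by (intro tendsto_intros) auto
    from isCont_tendsto_compose[OF U1 this] show ?thesis by (simp add: tendsto_intros)
  qed simp
  show ?thesis
    unfolding set_lebesgue_integral_def
  proof (rule integral_dominated_convergence[where w="\<lambda>s. indicator {0..t} s *\<^sub>R C"])
    show "(\<lambda>s. indicator {0..t} s *\<^sub>R U s (z s)) \<in> borel_measurable lborel"
      by (rule borel_measurable_LIMSEQ_real[OF UL]) simp
    show "integrable lborel (\<lambda>s. indicator {0..t} s *\<^sub>R C)"
      using borel_integrable_atLeastAtMost'[OF continuous_on_const[of "{0..t}" C]]
      by (simp add: set_integrable_def)
    show "AE s in lborel. norm (indicator {0..t} s *\<^sub>R U s (zs n s)) \<le> indicator {0..t} s *\<^sub>R C" for n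
      using C bound by (auto intro!: AE_I2 simp: indicator_def)
  qed (use UL in auto)
qed

text \<open>Integrability of \<open>U\<close> is not needed: otherwise the integral is \<open>0\<close> by convention.\<close>

lemma exp_neg_path_integral_le:
  fixes U :: "real \<Rightarrow> real"
  assumes "\<And>s. - K \<le> U s" "0 \<le> K" "0 \<le> t"
  shows "exp (- (LINT s:{0..t}|lborel. U s)) \<le> exp (K * t)"
proof -
  have "- (K * t) \<le> (LINT s:{0..t}|lborel. U s)"
  proof (cases "set_integrable lborel {0..t} U")
    case True
    have "(LINT s:{0..t}|lborel. - K) \<le> (LINT s:{0..t}|lborel. U s)"
      using assms True borel_integrable_atLeastAtMost'[OF continuous_on_const[of "{0..t}" "- K"]]
      by (intro set_integral_mono) auto
    then show ?thesis using assms by (simp add: set_lebesgue_integral_def mult.commute)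
  next
    case False
    then have "(LINT s:{0..t}|lborel. U s) = 0"
      unfolding set_lebesgue_integral_def set_integrable_def by (rule not_integrable_integral_eq)
    then show ?thesis using assms by simp
  qed
  then show ?thesis by simp
qed

text \<open>\<open>Z\<close> is the Ornstein--Uhlenbeck process driven by the Brownian motion \<open>B\<close> and started at \<open>0\<close>.\<close>

locale OU_from_zero =
  fixes M :: "'w measure" and B Z :: "real \<Rightarrow> 'w \<Rightarrow> real"
  assumes brownian: "brownian_motion M B" and OU: "OU_process M B 0 Z"
begin

sublocale prob_space M
  using brownian by (simp add: brownian_motion_def)

lemma B_measurable: "s \<ge> 0 \<Longrightarrow> B s \<in> borel_measurable M"
  using brownian by (simp add: brownian_motion_def)

lemma brownian_increment:
  "0 \<le> s \<Longrightarrow> s < u \<Longrightarrow>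
    distributed M lborel (\<lambda>\<omega>. B u \<omega> - B s \<omega>) (normal_density 0 (sqrt (u - s)))"
  using brownian by (simp add: brownian_motion_def)

lemma brownian_indep:
  fixes \<tau> :: "nat \<Rightarrow> real"
  assumes "0 \<le> \<tau> 0 \<and> mono \<tau>"
  shows "indep_vars (\<lambda>_. borel) (\<lambda>i \<omega>. B (\<tau> (Suc i)) \<omega> - B (\<tau> i) \<omega>) {..<n}"
proof -
  have "\<forall>(\<tau> :: nat \<Rightarrow> real) n. 0 \<le> \<tau> 0 \<and> mono \<tau> \<longrightarrow>
      indep_vars (\<lambda>_. borel) (\<lambda>i \<omega>. B (\<tau> (Suc i)) \<omega> - B (\<tau> i) \<omega>) {..<n}"
    using brownian unfolding brownian_motion_def by (elim conjE)
  then show ?thesis using assms by (elim allE impE)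
qed

lemma Z_measurable: "s \<ge> 0 \<Longrightarrow> Z s \<in> borel_measurable M"
  using OU by (simp add: OU_process_def)

lemma Z_continuous: "\<omega> \<in> space M \<Longrightarrow> continuous_on {0..} (\<lambda>s. Z s \<omega>)"
  using OU by (simp add: OU_process_def)

lemma AE_paths:
  "AE \<omega> in M. B 0 \<omega> = 0 \<and> continuous_on {0..} (\<lambda>r. B r \<omega>) \<and>
     (\<forall>s\<ge>0. Z s \<omega> = OU_path (\<lambda>r. B r \<omega>) s)"
proof -
  have "AE \<omega> in M. B 0 \<omega> = 0" "AE \<omega> in M. continuous_on {0..} (\<lambda>r. B r \<omega>)"
    using brownian by (simp_all add: brownian_motion_def)
  moreover have "AE \<omega> in M. \<forall>t\<ge>0. Z t \<omega> = 0 + sqrt 2 * B t \<omega> - integral {0..t} (\<lambda>s. Z s \<omega>)"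
    using OU by (simp add: OU_process_def)
  ultimately show ?thesis
    using AE_space
  proof eventually_elim
    case (elim \<omega>)
    then have "Z s \<omega> = exp (- s) * 0 + OU_path (\<lambda>r. B r \<omega>) s" if "s \<ge> 0" for s
      using that by (intro OU_equation_solution) (auto intro: Z_continuous)
    then show ?case using elim by simp
  qed
qed

lemma AE_OU_process_eq:
  assumes X: "OU_process M B x X"
  shows "AE \<omega> in M. \<forall>s\<ge>0. X s \<omega> = exp (- s) * x + Z s \<omega>"
proof -
  have "AE \<omega> in M. \<forall>t\<ge>0. X t \<omega> = x + sqrt 2 * B t \<omega> - integral {0..t} (\<lambda>s. X s \<omega>)"
    using X by (simp add: OU_process_def)
  then show ?thesis
    using AE_paths AE_space
  proof eventually_elim
    case (elim \<omega>)
    then have "X s \<omega> = exp (- s) * x + OU_path (\<lambda>r. B r \<omega>) s" if "s \<ge> 0" for s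
      using that X by (intro OU_equation_solution) (auto simp: OU_process_def)
    then show ?case using elim by simp
  qed
qed

lemma Z_jointly_measurable: "(\<lambda>(\<omega>, s). Z (max 0 s) \<omega>) \<in> borel_measurable (M \<Otimes>\<^sub>M borel)"
  by (rule continuous_paths_jointly_measurable) (auto intro: Z_measurable Z_continuous)

lemma Z_path_integral_measurable:
  fixes U :: "real \<Rightarrow> real \<Rightarrow> real"
  assumes "continuous_on UNIV (\<lambda>(s, z). U s z)"
  shows "(\<lambda>\<omega>. LINT s:{0..t}|lborel. U s (Z s \<omega>)) \<in> borel_measurable M"
  by (rule path_integral_measurable[where Z=Z, OF _ _ assms]) (auto intro: Z_measurable Z_continuous)

text \<open>The Cameron--Martin identity for the path \<open>Y \<omega>\<close> driven by the step approximation of the Brownian path.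
  The number \<open>\<kappa>\<close> tends to \<open>OU_precision t\<close>, and the translation of the end point to \<open>1\<close>, as the mesh
  \<open>\<delta>\<close> tends to \<open>0\<close>.\<close>

lemma cameron_martin_discrete:
  fixes U :: "real \<Rightarrow> real \<Rightarrow> real" and \<phi> :: "real \<Rightarrow> real"
  assumes t: "0 < t" and n: "0 < n" and U: "continuous_on UNIV (\<lambda>(s, z). U s z)"
    and \<phi>[measurable]: "\<phi> \<in> borel_measurable borel"
  defines "\<delta> \<equiv> t / n"
  defines "\<kappa> \<equiv> (1 - exp (- \<delta>)) / \<delta> * exp t / (2 * sinh t)"
  defines "Y \<equiv> \<lambda>\<omega>. OU_step t n (\<lambda>r. B r \<omega>)"
  shows "expectation (\<lambda>\<omega>. \<phi> (Y \<omega> t + e * OU_step t n (cm_direction t) t) *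
      exp (- (LINT s:{0..t}|lborel. U s (Y \<omega> s + e * OU_step t n (cm_direction t) s)))) =
    expectation (\<lambda>\<omega>. exp (e * \<kappa> * Y \<omega> t - e\<^sup>2 * \<kappa> * OU_step t n (cm_direction t) t / 2) *
      (\<phi> (Y \<omega> t) * exp (- (LINT s:{0..t}|lborel. U s (Y \<omega> s)))))"
    and "0 \<le> OU_step t n (cm_direction t) t"
proof -
  define D where "D j \<omega> = B (t * real (Suc j) / n) \<omega> - B (t * real j / n) \<omega>" for j \<omega>
  define k where "k j s = step_kernel t n j s" for j s
  define m where "m j = cm_direction t (t * real (Suc j) / n) - cm_direction t (t * real j / n)" for j
  define F where "F x = \<phi> (\<Sum>j<n. x j * k j t) * exp (- (LINT s:{0..t}|lborel. U s (\<Sum>j<n. x j * k j s)))" for x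
  have \<delta>: "0 < \<delta>" using t n by (simp add: \<delta>_def)
  have sinh_t: "0 < sinh t" using t by simp
  have [measurable]: "(\<lambda>(s, z). U s z) \<in> borel_measurable (borel \<Otimes>\<^sub>M borel)"
    using borel_measurable_continuous_onI[OF U] by (simp add: borel_prod)
  have [measurable]: "k j \<in> borel_measurable borel" for j
    unfolding k_def[abs_def] by measurable
  have F[measurable]: "F \<in> borel_measurable (PiM {..<n} (\<lambda>_. borel))"
    unfolding F_def[abs_def] set_lebesgue_integral_def by measurable
  \<comment> \<open>The proportionality that turns the sum of \<open>m j * D j \<omega>\<close> into a multiple of \<open>Y \<omega> t\<close>.\<close>
  have mk: "m j = \<kappa> * \<delta> * k j t" if "j < n" for j
  proof -
    have 1: "t * real j / n = t * real (Suc j) / n - \<delta>"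
      using n by (simp add: \<delta>_def field_simps)
    have 2: "t * real (Suc j) / n \<le> t"
      using that t n by (simp add: field_simps del: of_nat_Suc)
    have sq2: "sqrt 2 * (sqrt 2 * y) = 2 * y" for y :: real by (simp add: mult.assoc[symmetric])
    have "m j = (exp (t * real (Suc j) / n) - exp (t * real j / n)) / (sqrt 2 * sinh t)"
      by (simp add: m_def cm_direction_def diff_divide_distrib[symmetric])
    also have "exp (t * real j / n) = exp (t * real (Suc j) / n) * exp (- \<delta>)"
      unfolding 1 by (simp add: exp_diff exp_minus field_simps)
    also have "(exp (t * real (Suc j) / n) - exp (t * real (Suc j) / n) * exp (- \<delta>)) / (sqrt 2 * sinh t)
       = (1 - exp (- \<delta>)) * exp t / (2 * sinh t) * (sqrt 2 * exp (t * real (Suc j) / n - t))"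
      using sinh_t by (simp add: exp_diff field_simps sq2)
    also have "\<dots> = \<kappa> * \<delta> * k j t"
      using \<delta> 2 by (simp add: \<kappa>_def k_def step_kernel_def indicator_def del: of_nat_Suc)
    finally show ?thesis .
  qed
  have OUb: "OU_step t n (cm_direction t) s = (\<Sum>j<n. m j * k j s)" for s
    unfolding OU_step_def m_def k_def ..
  have OUY: "Y \<omega> s = (\<Sum>j<n. D j \<omega> * k j s)" for s \<omega>
    unfolding OU_step_def Y_def D_def k_def ..
  have \<kappa>: "0 < \<kappa>" using \<delta> sinh_t by (simp add: \<kappa>_def)
  show "0 \<le> OU_step t n (cm_direction t) t"
    unfolding OUb
  proof (rule sum_nonneg)
    fix j assume "j \<in> {..<n}"
    then have "m j * k j t = \<kappa> * \<delta> * (k j t)\<^sup>2" by (simp add: mk power2_eq_square)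
    then show "0 \<le> m j * k j t" using \<delta> \<kappa> by simp
  qed
  have indep: "indep_vars (\<lambda>_. borel) D {..<n}"
  proof -
    have "0 \<le> t * real 0 / n \<and> mono (\<lambda>j. t * real j / n)"
      using t n by (auto simp: mono_def divide_right_mono)
    then show ?thesis
      using brownian_indep[of "\<lambda>j. t * real j / n" n] by (simp only: D_def[abs_def])
  qed
  have normal: "distributed M lborel (D j) (normal_density 0 (sqrt \<delta>))" for j
  proof -
    have eq: "t * real (Suc j) / n - t * real j / n = \<delta>" using n by (simp add: \<delta>_def field_simps)
    have "0 \<le> t * real j / n" using t by simp
    moreover have "t * real j / n < t * real (Suc j) / n"
      using t n by (intro divide_strict_right_mono) auto
    ultimately have "distributed M lborel (\<lambda>\<omega>. B (t * real (Suc j) / n) \<omega> - B (t * real j / n) \<omega>)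
        (normal_density 0 (sqrt (t * real (Suc j) / n - t * real j / n)))"
      by (rule brownian_increment)
    then show ?thesis unfolding eq D_def[abs_def] .
  qed
  have ne: "{..<n} \<noteq> {}" using n by (auto simp: lessThan_empty_iff)
  have sq: "sqrt \<delta> > 0" "(sqrt \<delta>)\<^sup>2 = \<delta>" using \<delta> by auto
  have restr: "F (\<lambda>j\<in>{..<n}. y j) = F y" for y
    unfolding F_def by (intro arg_cong2[where f="(*)"] arg_cong[where f=\<phi>] arg_cong[where f="\<lambda>u. exp (- u)"]
      sum.cong refl set_lebesgue_integral_cong) (auto intro!: arg_cong2[where f=U])
  have "expectation (\<lambda>\<omega>. F (\<lambda>j\<in>{..<n}. D j \<omega> + e * m j)) =
    expectation (\<lambda>\<omega>. exp ((\<Sum>j<n. e * m j * D j \<omega>) / \<delta> - (\<Sum>j<n. (e * m j)\<^sup>2) / (2 * \<delta>)) * F (\<lambda>j\<in>{..<n}. D j \<omega>))"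
    using expectation_shift_indep_normal[OF finite_lessThan ne sq(1) indep normal F, of "\<lambda>j. e * m j"]
    by (simp add: sq)
  moreover have "F (\<lambda>j\<in>{..<n}. D j \<omega> + e * m j) = \<phi> (Y \<omega> t + e * OU_step t n (cm_direction t) t) *
      exp (- (LINT s:{0..t}|lborel. U s (Y \<omega> s + e * OU_step t n (cm_direction t) s)))" for \<omega>
    unfolding restr unfolding F_def OUb OUY
    by (simp add: distrib_right sum.distrib sum_distrib_left mult.assoc)
  moreover have "F (\<lambda>j\<in>{..<n}. D j \<omega>) = \<phi> (Y \<omega> t) * exp (- (LINT s:{0..t}|lborel. U s (Y \<omega> s)))" for \<omega>
    unfolding restr unfolding F_def OUY ..
  moreover have "(\<Sum>j<n. e * m j * D j \<omega>) / \<delta> = e * \<kappa> * Y \<omega> t" for \<omega>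
    using \<delta> unfolding OUY sum_divide_distrib sum_distrib_left
    by (intro sum.cong refl) (simp add: mk)
  moreover have "(\<Sum>j<n. (e * m j)\<^sup>2) / (2 * \<delta>) = e\<^sup>2 * \<kappa> * OU_step t n (cm_direction t) t / 2"
    using \<delta> unfolding OUb sum_divide_distrib sum_distrib_left
    by (intro sum.cong refl) (simp add: mk power2_eq_square)
  ultimately show "expectation (\<lambda>\<omega>. \<phi> (Y \<omega> t + e * OU_step t n (cm_direction t) t) *
      exp (- (LINT s:{0..t}|lborel. U s (Y \<omega> s + e * OU_step t n (cm_direction t) s)))) =
    expectation (\<lambda>\<omega>. exp (e * \<kappa> * Y \<omega> t - e\<^sup>2 * \<kappa> * OU_step t n (cm_direction t) t / 2) *
      (\<phi> (Y \<omega> t) * exp (- (LINT s:{0..t}|lborel. U s (Y \<omega> s)))))"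
    by simp
qed

end

text \<open>The inverse of the variance of the Ornstein--Uhlenbeck process at time \<open>t\<close> when it starts at a point.\<close>

definition OU_precision :: "real \<Rightarrow> real" where
  "OU_precision t = exp t / (2 * sinh t)"

lemma OU_precision_eq: "OU_precision t = 1 / (1 - exp (- 2 * t))"
proof -
  have "2 * sinh t = exp t * (1 - exp (- 2 * t))"
    by (simp add: sinh_def right_diff_distrib exp_add[symmetric])
  then show ?thesis by (simp add: OU_precision_def)
qed

lemma OU_step_limits:
  assumes t: "0 < t" and w0: "w 0 = 0" and w: "continuous_on {0..t} w"
  obtains R where "\<And>n s. 0 \<le> s \<Longrightarrow> s \<le> t \<Longrightarrow> \<bar>OU_step t (Suc n) w s\<bar> \<le> R"
    and "\<And>s. 0 \<le> s \<Longrightarrow> s \<le> t \<Longrightarrow> (\<lambda>n. OU_step t (Suc n) w s) \<longlonglongrightarrow> OU_path w s"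
proof -
  obtain C where C: "\<And>r. 0 \<le> r \<Longrightarrow> r \<le> t \<Longrightarrow> \<bar>w r\<bar> \<le> C"
    by (rule bounded_continuous_interval[OF w]) blast
  show thesis
  proof (rule that)
    show "\<bar>OU_step t (Suc n) w s\<bar> \<le> sqrt 2 * (C + C * t)" if "0 \<le> s" "s \<le> t" for n s
      using OU_path_step_path_bound[where w=w, OF t that w0 C] by (simp add: OU_step_eq[OF t that(1)])
    show "(\<lambda>n. OU_step t (Suc n) w s) \<longlonglongrightarrow> OU_path w s" if "0 \<le> s" "s \<le> t" for s
      using OU_path_step_path_tendsto[where w=w, OF t that w0 w] by (simp add: OU_step_eq[OF t that(1)])
  qed
qed

lemma one_minus_exp_div_tendsto:
  assumes t: "0 < t"
  shows "(\<lambda>n. (1 - exp (- (t / real (Suc n)))) / (t / real (Suc n))) \<longlonglongrightarrow> 1"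
proof -
  have "((\<lambda>x::real. (exp x - 1) / x) \<longlongrightarrow> 1) (at 0)"
    using DERIV_exp[of "0::real"] by (simp add: DERIV_def)
  moreover have "filterlim (\<lambda>n. - (t / real (Suc n))) (at 0) sequentially"
  proof (rule filterlim_atI)
    show "(\<lambda>n. - (t / real (Suc n))) \<longlonglongrightarrow> 0"
      using tendsto_minus[OF LIMSEQ_Suc[OF lim_const_over_n[of t]]] by simp
    show "\<forall>\<^sub>F n in sequentially. - (t / real (Suc n)) \<noteq> 0"
      using t by simp
  qed
  ultimately have "(\<lambda>n. (exp (- (t / real (Suc n))) - 1) / (- (t / real (Suc n)))) \<longlonglongrightarrow> 1"
    by (rule filterlim_compose)
  moreover have "(exp (- (t / real (Suc n))) - 1) / (- (t / real (Suc n))) =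
      (1 - exp (- (t / real (Suc n)))) / (t / real (Suc n))" for n
    using minus_divide_divide[of "1 - exp (- (t / real (Suc n)))" "t / real (Suc n)"]
    by (simp del: of_nat_Suc minus_divide_divide)
  ultimately show ?thesis by simp
qed

context OU_from_zero
begin

context
  fixes t :: real assumes t: "0 < t"
begin

text \<open>For test functions \<open>\<phi>\<close> with bounded support all the discrete densities that occur are bounded by one
  constant, so the passage to the limit is a matter of dominated convergence.\<close>

lemma cameron_martin_test:
  fixes U :: "real \<Rightarrow> real \<Rightarrow> real" and \<phi> :: "real \<Rightarrow> real"
  assumes U: "continuous_on UNIV (\<lambda>(s, z). U s z)" and U_bound: "\<And>s z. - K \<le> U s z" and K: "0 \<le> K"
    and \<phi>: "continuous_on UNIV \<phi>" and \<phi>_bound: "\<And>y. \<bar>\<phi> y\<bar> \<le> C" and \<phi>_supp: "\<And>y. R < \<bar>y\<bar> \<Longrightarrow> \<phi> y = 0"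
  defines "\<kappa> \<equiv> OU_precision t"
  shows "expectation (\<lambda>\<omega>. \<phi> (Z t \<omega> + e) *
      exp (- (LINT s:{0..t}|lborel. U s (Z s \<omega> + e * (sinh s / sinh t))))) =
    expectation (\<lambda>\<omega>. exp (e * \<kappa> * Z t \<omega> - e\<^sup>2 * \<kappa> / 2) *
      (\<phi> (Z t \<omega>) * exp (- (LINT s:{0..t}|lborel. U s (Z s \<omega>)))))"
    (is "expectation ?L = expectation ?R")
proof -
  define Y where "Y n \<omega> s = OU_step t (Suc n) (\<lambda>r. B r \<omega>) s" for n \<omega> s
  define b where "b n s = OU_step t (Suc n) (cm_direction t) s" for n s
  define \<kappa>n where "\<kappa>n n = (1 - exp (- (t / real (Suc n)))) / (t / real (Suc n)) * exp t / (2 * sinh t)" for n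
  define Ln where "Ln n \<omega> = \<phi> (Y n \<omega> t + e * b n t) * exp (- (LINT s:{0..t}|lborel. U s (Y n \<omega> s + e * b n s)))" for n \<omega>
  define Rn where "Rn n \<omega> = exp (e * \<kappa>n n * Y n \<omega> t - e\<^sup>2 * \<kappa>n n * b n t / 2) *
      (\<phi> (Y n \<omega> t) * exp (- (LINT s:{0..t}|lborel. U s (Y n \<omega> s))))" for n \<omega>
  have sinh: "0 < sinh t" using t by simp
  have \<phi>m[measurable]: "\<phi> \<in> borel_measurable borel" by (rule borel_measurable_continuous_onI[OF \<phi>])
  have \<phi>c: "isCont \<phi> y" for y using \<phi> by (simp add: continuous_on_eq_continuous_at)
  have [measurable]: "(\<lambda>(s, z). U s z) \<in> borel_measurable (borel \<Otimes>\<^sub>M borel)"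
    using borel_measurable_continuous_onI[OF U] by (simp add: borel_prod)
  have Zm[measurable]: "Z t \<in> borel_measurable M" using Z_measurable t by simp
  have Ym: "(\<lambda>p. Y n (fst p) (snd p)) \<in> borel_measurable (M \<Otimes>\<^sub>M borel)" for n
  proof -
    have [measurable]: "B (t * real j / real (Suc n)) \<in> borel_measurable M" for j
      using t by (intro B_measurable) simp
    show ?thesis unfolding Y_def OU_step_def by measurable
  qed
  have Ym1[measurable]: "(\<lambda>\<omega>. Y n \<omega> s) \<in> borel_measurable M" for n s
  proof -
    have "(\<lambda>\<omega>. (\<omega>, s)) \<in> measurable M (M \<Otimes>\<^sub>M borel)" by measurable
    from measurable_compose[OF this Ym[of n]] show ?thesis by simp
  qed
  note Ym[measurable]
  have bm[measurable]: "b n \<in> borel_measurable borel" for n unfolding b_def[abs_def] by measurable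
  have eq: "expectation (Ln n) = expectation (Rn n)" and b0: "0 \<le> b n t" for n
    using cameron_martin_discrete(1)[where n="Suc n" and e=e, OF t zero_less_Suc U \<phi>m]
      cameron_martin_discrete(2)[where n="Suc n", OF t zero_less_Suc U \<phi>m]
    unfolding Ln_def[abs_def] Rn_def[abs_def] Y_def b_def \<kappa>n_def by auto
  have L_meas: "Ln n \<in> borel_measurable M" for n
    unfolding Ln_def[abs_def] set_lebesgue_integral_def by measurable
  have R_meas: "Rn n \<in> borel_measurable M" for n
    unfolding Rn_def[abs_def] set_lebesgue_integral_def by measurable
  have U': "continuous_on UNIV (\<lambda>(s, z). U s (z + e * (sinh s / sinh t)))"
  proof -
    have "continuous_on UNIV (\<lambda>p. (fst p, snd p + e * (sinh (fst p) / sinh t)))"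
      using sinh by (intro continuous_intros) auto
    from continuous_on_compose2[OF U this] show ?thesis by (simp add: split_beta)
  qed
  have Lm: "?L \<in> borel_measurable M"
    using Z_path_integral_measurable[OF U', of t] by measurable
  have Rm: "?R \<in> borel_measurable M"
    using Z_path_integral_measurable[OF U, of t] by measurable
  have dir: "cm_direction t 0 = 0" "continuous_on {0..t} (cm_direction t)"
    using sinh by (auto simp: cm_direction_def[abs_def] intro!: continuous_intros)
  obtain Rb where Rb: "\<And>n s. 0 \<le> s \<Longrightarrow> s \<le> t \<Longrightarrow> \<bar>b n s\<bar> \<le> Rb"
    and b_lim: "\<And>s. 0 \<le> s \<Longrightarrow> s \<le> t \<Longrightarrow> (\<lambda>n. b n s) \<longlonglongrightarrow> sinh s / sinh t"
    using OU_step_limits[OF t dir] OU_path_cm_direction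
    unfolding b_def by metis
  have b_lim_t: "(\<lambda>n. b n t) \<longlonglongrightarrow> 1" using b_lim[of t] t sinh by simp
  have \<kappa>_lim: "\<kappa>n \<longlonglongrightarrow> \<kappa>"
    unfolding \<kappa>n_def[abs_def] \<kappa>_def OU_precision_def
    using tendsto_mult[OF one_minus_exp_div_tendsto[OF t] tendsto_const[of "exp t / (2 * sinh t)"]] by simp
  have \<kappa>n_bound: "0 \<le> \<kappa>n n" "\<kappa>n n \<le> \<kappa>" for n
  proof -
    have d: "0 < t / real (Suc n)" using t by simp
    have "1 - exp (- (t / real (Suc n))) \<le> t / real (Suc n)"
      using exp_ge_add_one_self[of "- (t / real (Suc n))"] by linarith
    then have "(1 - exp (- (t / real (Suc n)))) / (t / real (Suc n)) \<le> 1"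
      using d by (simp only: divide_le_eq_1_pos)
    then show "\<kappa>n n \<le> \<kappa>"
      using mult_right_mono[of _ 1 "exp t / (2 * sinh t)"] sinh unfolding \<kappa>n_def \<kappa>_def OU_precision_def by fastforce
    show "0 \<le> \<kappa>n n" using d sinh unfolding \<kappa>n_def by simp
  qed
  have C0: "0 \<le> C" using \<phi>_bound[of 0] by linarith
  have expU: "exp (- (LINT s:{0..t}|lborel. U s (z s))) \<le> exp (K * t)" for z :: "real \<Rightarrow> real"
    by (rule exp_neg_path_integral_le) (use U_bound K t in auto)
  have lims: "AE \<omega> in M. (\<lambda>n. Ln n \<omega>) \<longlonglongrightarrow> ?L \<omega> \<and> (\<lambda>n. Rn n \<omega>) \<longlonglongrightarrow> ?R \<omega>"
    using AE_paths
  proof eventually_elim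
    case (elim \<omega>)
    then have "continuous_on {0..t} (\<lambda>r. B r \<omega>)" "B 0 \<omega> = 0"
      by (auto intro: continuous_on_subset)
    then obtain RY where RY: "\<And>n s. 0 \<le> s \<Longrightarrow> s \<le> t \<Longrightarrow> \<bar>Y n \<omega> s\<bar> \<le> RY"
      and Y_lim: "\<And>s. 0 \<le> s \<Longrightarrow> s \<le> t \<Longrightarrow> (\<lambda>n. Y n \<omega> s) \<longlonglongrightarrow> Z s \<omega>"
      using OU_step_limits[OF t, of "\<lambda>r. B r \<omega>"] elim unfolding Y_def by metis
    have Y_lim_t: "(\<lambda>n. Y n \<omega> t) \<longlonglongrightarrow> Z t \<omega>" using Y_lim[of t] t by simp
    have Ys: "Y n \<omega> \<in> borel_measurable borel" for n unfolding Y_def by measurable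
    have 1: "(\<lambda>n. LINT s:{0..t}|lborel. U s (Y n \<omega> s)) \<longlonglongrightarrow> (LINT s:{0..t}|lborel. U s (Z s \<omega>))"
      by (rule path_integral_tendsto[OF U Ys Y_lim RY])
    have 2: "(\<lambda>n. LINT s:{0..t}|lborel. U s (Y n \<omega> s + e * b n s)) \<longlonglongrightarrow>
        (LINT s:{0..t}|lborel. U s (Z s \<omega> + e * (sinh s / sinh t)))"
    proof (rule path_integral_tendsto[OF U])
      show "(\<lambda>s. Y n \<omega> s + e * b n s) \<in> borel_measurable borel" for n using Ys by measurable
      show "(\<lambda>n. Y n \<omega> s + e * b n s) \<longlonglongrightarrow> Z s \<omega> + e * (sinh s / sinh t)" if "0 \<le> s" "s \<le> t" for s
        using that by (intro tendsto_intros Y_lim b_lim)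
      show "\<bar>Y n \<omega> s + e * b n s\<bar> \<le> RY + \<bar>e\<bar> * Rb" if "0 \<le> s" "s \<le> t" for n s
      proof -
        have "\<bar>e * b n s\<bar> \<le> \<bar>e\<bar> * Rb"
          unfolding abs_mult using Rb[OF that] by (intro mult_left_mono) auto
        then show ?thesis using RY[OF that, of n] by linarith
      qed
    qed
    have "(\<lambda>n. \<phi> (Y n \<omega> t)) \<longlonglongrightarrow> \<phi> (Z t \<omega>)" "(\<lambda>n. \<phi> (Y n \<omega> t + e * b n t)) \<longlonglongrightarrow> \<phi> (Z t \<omega> + e * 1)"
      by (intro isCont_tendsto_compose[OF \<phi>c] tendsto_intros Y_lim_t b_lim_t)+
    moreover have "(\<lambda>n. exp (e * \<kappa>n n * Y n \<omega> t - e\<^sup>2 * \<kappa>n n * b n t / 2)) \<longlonglongrightarrow>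
        exp (e * \<kappa> * Z t \<omega> - e\<^sup>2 * \<kappa> * 1 / 2)"
      by (intro tendsto_intros Y_lim_t b_lim_t \<kappa>_lim) auto
    ultimately show ?case
      unfolding Ln_def Rn_def using 1 2 by (auto intro!: tendsto_intros)
  qed
  have "(\<lambda>n. expectation (Ln n)) \<longlonglongrightarrow> expectation ?L"
  proof (rule integral_dominated_convergence[where w="\<lambda>_. C * exp (K * t)", OF Lm L_meas])
    show "AE \<omega> in M. (\<lambda>n. Ln n \<omega>) \<longlonglongrightarrow> ?L \<omega>" using lims by eventually_elim simp
    show "AE \<omega> in M. norm (Ln n \<omega>) \<le> C * exp (K * t)" for n
      unfolding Ln_def by (intro AE_I2) (auto simp: abs_mult intro!: mult_mono \<phi>_bound expU C0)
  qed simp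
  moreover have "(\<lambda>n. expectation (Rn n)) \<longlonglongrightarrow> expectation ?R"
  proof (rule integral_dominated_convergence[where w="\<lambda>_. exp (\<bar>e\<bar> * \<kappa> * R) * (C * exp (K * t))", OF Rm R_meas])
    show "AE \<omega> in M. (\<lambda>n. Rn n \<omega>) \<longlonglongrightarrow> ?R \<omega>" using lims by eventually_elim simp
    have "norm (Rn n \<omega>) \<le> exp (\<bar>e\<bar> * \<kappa> * R) * (C * exp (K * t))" for n \<omega>
    proof (cases "R < \<bar>Y n \<omega> t\<bar>")
      case True
      then show ?thesis using C0 by (simp add: Rn_def \<phi>_supp)
    next
      case False
      have "e * \<kappa>n n * Y n \<omega> t \<le> \<bar>e\<bar> * \<kappa>n n * \<bar>Y n \<omega> t\<bar>"
        using \<kappa>n_bound(1)[of n] by (metis abs_ge_self abs_mult abs_of_nonneg)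
      also have "\<dots> \<le> \<bar>e\<bar> * \<kappa> * R"
        using False \<kappa>n_bound[of n] by (intro mult_mono) auto
      finally have "e * \<kappa>n n * Y n \<omega> t - e\<^sup>2 * \<kappa>n n * b n t / 2 \<le> \<bar>e\<bar> * \<kappa> * R"
        using \<kappa>n_bound(1)[of n] b0[of n] by (smt (verit) mult_nonneg_nonneg zero_le_power2 divide_nonneg_nonneg)
      then show ?thesis
        unfolding Rn_def by (auto simp: abs_mult intro!: mult_mono \<phi>_bound expU C0 mult_nonneg_nonneg)
    qed
    then show "AE \<omega> in M. norm (Rn n \<omega>) \<le> exp (\<bar>e\<bar> * \<kappa> * R) * (C * exp (K * t))" for n by (intro AE_I2)
  qed simp
  ultimately show ?thesis
    unfolding eq by (rule LIMSEQ_unique)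
qed

end

end

lemma OU_precision_gt_1: "0 < t \<Longrightarrow> 1 < OU_precision t"
  by (simp add: OU_precision_eq)

lemma measure_eqI_compact_support_tests:
  fixes N1 N2 :: "real measure"
  assumes sets: "sets N1 = sets borel" "sets N2 = sets borel"
    and fin: "emeasure N1 (space N1) < \<infinity>"
    and eq: "\<And>\<phi> R. continuous_on UNIV \<phi> \<Longrightarrow> (\<And>y. 0 \<le> \<phi> y) \<Longrightarrow> (\<And>y. \<phi> y \<le> 1) \<Longrightarrow>
      (\<And>y. R < \<bar>y\<bar> \<Longrightarrow> \<phi> y = 0) \<Longrightarrow>
      (\<integral>\<^sup>+y. ennreal (\<phi> y) \<partial>N1) = (\<integral>\<^sup>+y. ennreal (\<phi> y) \<partial>N2)"
  shows "N1 = N2"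
proof (rule measure_eqI_lessThan[OF sets])
  fix x :: real
  show "emeasure N1 {x<..} < \<infinity>"
    using fin emeasure_mono[of "{x<..}" "space N1" N1] sets sets_eq_imp_space_eq[OF sets(1)]
    by (simp add: order_le_less_trans)
  \<comment> \<open>Continuous functions with bounded support that increase to the indicator of \<open>{x<..}\<close>.\<close>
  define \<phi> where "\<phi> k y = max 0 (min 1 (min (real k * (y - x)) (real k - y)))" for k :: nat and y
  have c: "continuous_on UNIV (\<phi> k)" for k
    unfolding \<phi>_def[abs_def] by (intro continuous_intros)
  have \<phi>m: "\<phi> k \<in> borel_measurable borel" for k by (rule borel_measurable_continuous_onI[OF c])
  have inc: "\<phi> k y \<le> \<phi> (Suc k) y" for k y
  proof (cases "y \<le> x")
    case True
    then have "real k * (y - x) \<le> 0" by (simp add: mult_nonneg_nonpos)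
    then show ?thesis by (simp add: \<phi>_def)
  next
    case False
    then have "real k * (y - x) \<le> real (Suc k) * (y - x)" by (intro mult_right_mono) auto
    then show ?thesis by (auto simp: \<phi>_def)
  qed
  have supp: "\<phi> k y = 0" if "max \<bar>x\<bar> (real k) < \<bar>y\<bar>" for k y
  proof (cases "y \<le> x")
    case True
    then have "real k * (y - x) \<le> 0" by (simp add: mult_nonneg_nonpos)
    then show ?thesis by (simp add: \<phi>_def)
  next
    case False
    with that have "real k - y \<le> 0" by linarith
    then show ?thesis by (simp add: \<phi>_def)
  qed
  have lim: "(\<lambda>k. ennreal (\<phi> k y)) \<longlonglongrightarrow> indicator {x<..} y" for y
  proof (cases "y \<le> x")
    case True
    then have "real k * (y - x) \<le> 0" for k by (simp add: mult_nonneg_nonpos)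
    then have "\<phi> k y = 0" for k unfolding \<phi>_def by (smt (verit))
    then show ?thesis using True by simp
  next
    case False
    obtain k0 :: nat where k0: "max (1 / (y - x)) (1 + y) < real k0" using reals_Archimedean2 by blast
    have "\<phi> k y = 1" if "k0 \<le> k" for k
    proof -
      have "1 / (y - x) < real k" "1 + y < real k" using k0 that by linarith+
      then have "1 < real k * (y - x)" "1 < real k - y" using False by (auto simp: field_simps)
      then show ?thesis by (simp add: \<phi>_def)
    qed
    then have "eventually (\<lambda>k. ennreal (\<phi> k y) = 1) sequentially"
      unfolding eventually_sequentially by (intro exI[of _ k0]) auto
    then show ?thesis using False by (simp add: tendsto_eventually)
  qed
  have em: "(\<lambda>k. \<integral>\<^sup>+y. ennreal (\<phi> k y) \<partial>N) \<longlonglongrightarrow> emeasure N {x<..}" if "sets N = sets borel" for N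
  proof -
    have "(\<lambda>k. \<integral>\<^sup>+y. ennreal (\<phi> k y) \<partial>N) \<longlonglongrightarrow> (\<integral>\<^sup>+y. indicator {x<..} y \<partial>N)"
    proof (rule nn_integral_LIMSEQ)
      show "incseq (\<lambda>k y. ennreal (\<phi> k y))"
        by (rule incseq_SucI) (auto simp: le_fun_def intro!: ennreal_leI inc)
      show "(\<lambda>y. ennreal (\<phi> k y)) \<in> borel_measurable N" for k
        using \<phi>m[of k] that by (simp cong: measurable_cong_sets)
    qed (rule lim)
    then show ?thesis using that by simp
  qed
  have "(\<integral>\<^sup>+y. ennreal (\<phi> k y) \<partial>N1) = (\<integral>\<^sup>+y. ennreal (\<phi> k y) \<partial>N2)" for k
    by (rule eq[where R="max \<bar>x\<bar> (real k)", OF c _ _ supp]) (auto simp: \<phi>_def)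
  then show "emeasure N1 {x<..} = emeasure N2 {x<..}"
    using em[OF sets(1)] em[OF sets(2)] by (auto intro: LIMSEQ_unique)
qed

context OU_from_zero
begin

context
  fixes t :: real assumes t: "0 < t"
begin

lemma Z_shifted_path_integral_measurable:
  fixes U :: "real \<Rightarrow> real \<Rightarrow> real"
  assumes U: "continuous_on UNIV (\<lambda>(s, z). U s z)"
  shows "(\<lambda>\<omega>. LINT s:{0..t}|lborel. U s (Z s \<omega> + e * (sinh s / sinh t))) \<in> borel_measurable M"
proof (rule Z_path_integral_measurable[where U="\<lambda>s z. U s (z + e * (sinh s / sinh t))"])
  have "continuous_on UNIV (\<lambda>p. (fst p, snd p + e * (sinh (fst p) / sinh t)))"
    using t by (intro continuous_intros) auto
  from continuous_on_compose2[OF U this]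
  show "continuous_on UNIV (\<lambda>(s, z). U s (z + e * (sinh s / sinh t)))" by (simp add: split_beta)
qed

lemma cameron_martin:
  fixes U :: "real \<Rightarrow> real \<Rightarrow> real" and q :: "real \<Rightarrow> ennreal"
  assumes U: "continuous_on UNIV (\<lambda>(s, z). U s z)" and U_bound: "\<And>s z. - K \<le> U s z" and K: "0 \<le> K"
    and q[measurable]: "q \<in> borel_measurable borel"
  defines "\<kappa> \<equiv> OU_precision t"
  shows "(\<integral>\<^sup>+\<omega>. q (Z t \<omega> + e) *
      ennreal (exp (- (LINT s:{0..t}|lborel. U s (Z s \<omega> + e * (sinh s / sinh t))))) \<partial>M) =
    (\<integral>\<^sup>+\<omega>. q (Z t \<omega>) * ennreal (exp (e * \<kappa> * Z t \<omega> - e\<^sup>2 * \<kappa> / 2) *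
      exp (- (LINT s:{0..t}|lborel. U s (Z s \<omega>)))) \<partial>M)"
proof -
  define G1 where "G1 \<omega> = exp (- (LINT s:{0..t}|lborel. U s (Z s \<omega> + e * (sinh s / sinh t))))" for \<omega>
  define G2 where "G2 \<omega> = exp (e * \<kappa> * Z t \<omega> - e\<^sup>2 * \<kappa> / 2) *
      exp (- (LINT s:{0..t}|lborel. U s (Z s \<omega>)))" for \<omega>
  have [measurable]: "Z t \<in> borel_measurable M" using Z_measurable t by simp
  have [measurable]: "G1 \<in> borel_measurable M"
    using Z_shifted_path_integral_measurable[OF U] unfolding G1_def[abs_def] by measurable
  have [measurable]: "G2 \<in> borel_measurable M"
    using Z_path_integral_measurable[OF U, of t] unfolding G2_def[abs_def] by measurable
  have G1_bound: "G1 \<omega> \<le> exp (K * t)" for \<omega>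
    unfolding G1_def by (rule exp_neg_path_integral_le) (use U_bound K t in auto)
  have G0: "0 \<le> G1 \<omega>" "0 \<le> G2 \<omega>" for \<omega> by (simp_all add: G1_def G2_def)
  define N1 where "N1 = distr (density M (\<lambda>\<omega>. ennreal (G1 \<omega>))) borel (\<lambda>\<omega>. Z t \<omega> + e)"
  define N2 where "N2 = distr (density M (\<lambda>\<omega>. ennreal (G2 \<omega>))) borel (Z t)"
  have int1: "(\<integral>\<^sup>+y. f y \<partial>N1) = (\<integral>\<^sup>+\<omega>. f (Z t \<omega> + e) * ennreal (G1 \<omega>) \<partial>M)"
    if [measurable]: "f \<in> borel_measurable borel" for f
    unfolding N1_def by (simp add: nn_integral_distr nn_integral_density mult.commute)
  have int2: "(\<integral>\<^sup>+y. f y \<partial>N2) = (\<integral>\<^sup>+\<omega>. f (Z t \<omega>) * ennreal (G2 \<omega>) \<partial>M)"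
    if [measurable]: "f \<in> borel_measurable borel" for f
    unfolding N2_def by (simp add: nn_integral_distr nn_integral_density mult.commute)
  have "N1 = N2"
  proof (rule measure_eqI_compact_support_tests)
    show "sets N1 = sets borel" "sets N2 = sets borel" by (simp_all add: N1_def N2_def)
    have "emeasure N1 (space N1) = (\<integral>\<^sup>+\<omega>. ennreal (G1 \<omega>) \<partial>M)"
      unfolding N1_def by (subst emeasure_distr) (auto simp: emeasure_density)
    also have "\<dots> \<le> (\<integral>\<^sup>+\<omega>. ennreal (exp (K * t)) \<partial>M)"
      by (intro nn_integral_mono ennreal_leI G1_bound)
    also have "\<dots> < \<infinity>" by (simp add: emeasure_space_1)
    finally show "emeasure N1 (space N1) < \<infinity>" .
  next
    fix \<phi> :: "real \<Rightarrow> real" and R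
    assume \<phi>: "continuous_on UNIV \<phi>" and \<phi>0: "\<And>y. 0 \<le> \<phi> y" and \<phi>1: "\<And>y. \<phi> y \<le> 1"
      and supp: "\<And>y. R < \<bar>y\<bar> \<Longrightarrow> \<phi> y = 0"
    have [measurable]: "\<phi> \<in> borel_measurable borel" by (rule borel_measurable_continuous_onI[OF \<phi>])
    have \<kappa>: "0 \<le> \<kappa>" using OU_precision_gt_1[OF t] by (simp add: \<kappa>_def)
    have i1: "integrable M (\<lambda>\<omega>. \<phi> (Z t \<omega> + e) * G1 \<omega>)"
    proof (rule integrable_const_bound[where B="1 * exp (K * t)"])
      show "AE \<omega> in M. norm (\<phi> (Z t \<omega> + e) * G1 \<omega>) \<le> 1 * exp (K * t)"
        using \<phi>0 \<phi>1 G0 G1_bound unfolding real_norm_def abs_mult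
        by (intro AE_I2 mult_mono) auto
    qed measurable
    have i2: "integrable M (\<lambda>\<omega>. \<phi> (Z t \<omega>) * G2 \<omega>)"
    proof (rule integrable_const_bound[where B="exp (\<bar>e\<bar> * \<kappa> * R) * exp (K * t)"])
      have "\<phi> (Z t \<omega>) * G2 \<omega> \<le> exp (\<bar>e\<bar> * \<kappa> * R) * exp (K * t)" for \<omega>
      proof (cases "R < \<bar>Z t \<omega>\<bar>")
        case False
        have "e * \<kappa> * Z t \<omega> \<le> \<bar>e\<bar> * \<kappa> * \<bar>Z t \<omega>\<bar>"
          using \<kappa> by (metis abs_ge_self abs_mult abs_of_nonneg)
        also have "\<dots> \<le> \<bar>e\<bar> * \<kappa> * R" using False \<kappa> by (intro mult_mono) auto
        finally have "e * \<kappa> * Z t \<omega> - e\<^sup>2 * \<kappa> / 2 \<le> \<bar>e\<bar> * \<kappa> * R"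
          using \<kappa> by (smt (verit) mult_nonneg_nonneg zero_le_power2 divide_nonneg_nonneg)
        then have "G2 \<omega> \<le> exp (\<bar>e\<bar> * \<kappa> * R) * exp (K * t)"
          unfolding G2_def by (intro mult_mono exp_neg_path_integral_le) (use U_bound K t in auto)
        then show ?thesis
          using mult_mono[OF \<phi>1[of "Z t \<omega>"], of "G2 \<omega>" "exp (\<bar>e\<bar> * \<kappa> * R) * exp (K * t)"] G0[of \<omega>] by simp
      qed (simp add: supp)
      then show "AE \<omega> in M. norm (\<phi> (Z t \<omega>) * G2 \<omega>) \<le> exp (\<bar>e\<bar> * \<kappa> * R) * exp (K * t)"
        using \<phi>0 G0 by (intro AE_I2) simp
    qed measurable
    have \<phi>b: "\<bar>\<phi> y\<bar> \<le> 1" for y using \<phi>0[of y] \<phi>1[of y] by simp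
    have "expectation (\<lambda>\<omega>. \<phi> (Z t \<omega> + e) * G1 \<omega>) =
        expectation (\<lambda>\<omega>. exp (e * \<kappa> * Z t \<omega> - e\<^sup>2 * \<kappa> / 2) *
          (\<phi> (Z t \<omega>) * exp (- (LINT s:{0..t}|lborel. U s (Z s \<omega>)))))"
      unfolding G1_def \<kappa>_def by (rule cameron_martin_test[OF t U U_bound K \<phi> \<phi>b supp])
    also have "\<dots> = expectation (\<lambda>\<omega>. \<phi> (Z t \<omega>) * G2 \<omega>)"
      by (intro Bochner_Integration.integral_cong refl) (simp only: G2_def mult_ac)
    finally have "(\<integral>\<^sup>+\<omega>. ennreal (\<phi> (Z t \<omega> + e) * G1 \<omega>) \<partial>M) = (\<integral>\<^sup>+\<omega>. ennreal (\<phi> (Z t \<omega>) * G2 \<omega>) \<partial>M)"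
      using i1 i2 \<phi>0 G0 by (simp add: nn_integral_eq_integral)
    then show "(\<integral>\<^sup>+y. ennreal (\<phi> y) \<partial>N1) = (\<integral>\<^sup>+y. ennreal (\<phi> y) \<partial>N2)"
      using \<phi>0 G0 by (simp add: int1 int2 ennreal_mult)
  qed
  then have "(\<integral>\<^sup>+y. q y \<partial>N1) = (\<integral>\<^sup>+y. q y \<partial>N2)" by simp
  then show ?thesis by (simp add: int1 int2 G1_def G2_def)
qed

text \<open>The law of \<open>Z t\<close> comes out of the Cameron--Martin identity with \<open>U = 0\<close>. For every nonnegative \<open>k\<close>, the
  integral over \<open>e\<close> of the expectation of \<open>k (Z t + e)\<close> is the Lebesgue integral of \<open>k\<close>, while the
  same integral of the other side, with \<open>k\<close> the centred Gaussian density restricted to \<open>A\<close>, is the probability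
  that \<open>Z t\<close> lies in \<open>A\<close>.\<close>

lemma Z_normal: "distributed M lborel (Z t) (normal_density 0 (1 / sqrt (OU_precision t)))"
proof -
  define \<kappa> where "\<kappa> = OU_precision t"
  define \<sigma> where "\<sigma> = 1 / sqrt \<kappa>"
  have \<kappa>: "0 < \<kappa>" using OU_precision_gt_1[OF t] by (simp add: \<kappa>_def)
  have \<sigma>: "0 < \<sigma>" "\<sigma>\<^sup>2 = 1 / \<kappa>" using \<kappa> by (simp_all add: \<sigma>_def power_divide)
  have Zm[measurable]: "Z t \<in> borel_measurable M" using Z_measurable t by simp
  interpret P: pair_sigma_finite M lborel
    by (simp add: pair_sigma_finite_def sigma_finite_measure_axioms sigma_finite_lborel)
  \<comment> \<open>As a function of \<open>e\<close> the product is a probability density again.\<close>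
  have nd: "normal_density 0 \<sigma> z * exp (e * \<kappa> * z - e\<^sup>2 * \<kappa> / 2) = normal_density z \<sigma> e" for z e
  proof -
    have "- (z - 0)\<^sup>2 / (2 * \<sigma>\<^sup>2) + (e * \<kappa> * z - e\<^sup>2 * \<kappa> / 2) = - (e - z)\<^sup>2 / (2 * \<sigma>\<^sup>2)"
      unfolding \<sigma>(2) using \<kappa> by (simp add: field_simps power2_eq_square)
    then show ?thesis
      unfolding normal_density_def by (simp only: mult.assoc exp_add[symmetric])
  qed
  define k where "k A z = indicator A z * ennreal (normal_density 0 \<sigma> z)" for A z
  have kn: "k A z * ennreal (exp (e * \<kappa> * z - e\<^sup>2 * \<kappa> / 2)) = indicator A z * ennreal (normal_density z \<sigma> e)" for A z e
    by (subst nd[symmetric]) (simp add: k_def ennreal_mult mult.assoc)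
  have "distr M lborel (Z t) = density lborel (normal_density 0 \<sigma>)"
  proof (rule measure_eqI)
    fix A assume "A \<in> sets (distr M lborel (Z t))"
    then have A[measurable]: "A \<in> sets borel" by simp
    have [measurable]: "k A \<in> borel_measurable borel" unfolding k_def[abs_def] by measurable
    have "(\<integral>\<^sup>+z. k A z \<partial>lborel) = (\<integral>\<^sup>+\<omega>. (\<integral>\<^sup>+e. k A (Z t \<omega> + e) \<partial>lborel) \<partial>M)"
    proof -
      have "(\<integral>\<^sup>+e. k A (c + e) \<partial>lborel) = (\<integral>\<^sup>+z. k A z \<partial>lborel)" for c
        using nn_integral_real_affine[of "k A" 1 c] by simp
      then show ?thesis by (simp add: emeasure_space_1)
    qed
    also have "\<dots> = (\<integral>\<^sup>+e. (\<integral>\<^sup>+\<omega>. k A (Z t \<omega> + e) \<partial>M) \<partial>lborel)"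
      by (rule P.Fubini'[symmetric]) measurable
    also have "\<dots> = (\<integral>\<^sup>+e. (\<integral>\<^sup>+\<omega>. k A (Z t \<omega>) * ennreal (exp (e * \<kappa> * Z t \<omega> - e\<^sup>2 * \<kappa> / 2)) \<partial>M) \<partial>lborel)"
      using cameron_martin[where U="\<lambda>_ _. 0" and K=0 and q="k A"]
      by (simp add: set_lebesgue_integral_def \<kappa>_def)
    also have "\<dots> = (\<integral>\<^sup>+\<omega>. (\<integral>\<^sup>+e. k A (Z t \<omega>) * ennreal (exp (e * \<kappa> * Z t \<omega> - e\<^sup>2 * \<kappa> / 2)) \<partial>lborel) \<partial>M)"
      by (rule P.Fubini') measurable
    also have "\<dots> = (\<integral>\<^sup>+\<omega>. (\<integral>\<^sup>+e. indicator A (Z t \<omega>) * ennreal (normal_density (Z t \<omega>) \<sigma> e) \<partial>lborel) \<partial>M)"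
      by (simp only: kn)
    also have "\<dots> = (\<integral>\<^sup>+\<omega>. indicator A (Z t \<omega>) \<partial>M)"
      using \<sigma> by (simp add: nn_integral_cmult nn_integral_eq_integral)
    also have "\<dots> = (\<integral>\<^sup>+y. indicator A y \<partial>distr M borel (Z t))"
      by (subst nn_integral_distr) auto
    also have "\<dots> = emeasure (distr M borel (Z t)) A" by simp
    also have "\<dots> = emeasure (distr M lborel (Z t)) A" by (simp add: emeasure_distr)
    finally show "emeasure (distr M lborel (Z t)) A = emeasure (density lborel (normal_density 0 \<sigma>)) A"
      by (simp add: emeasure_density k_def mult.commute)
  qed simp
  then show ?thesis
    unfolding distributed_def by (simp add: \<sigma>_def \<kappa>_def)
qed

end

end

section \<open>Mixtures of exponentials\<close>

lemma DERIV_under_integral: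
  fixes g g' :: "real \<Rightarrow> 'a \<Rightarrow> real"
  assumes int: "\<And>x. \<bar>x - x0\<bar> < 1 \<Longrightarrow> integrable M (g x)"
    and deriv: "\<And>x \<omega>. \<omega> \<in> space M \<Longrightarrow> \<bar>x - x0\<bar> < 1 \<Longrightarrow> ((\<lambda>x. g x \<omega>) has_real_derivative g' x \<omega>) (at x)"
    and meas: "g' x0 \<in> borel_measurable M"
    and w: "integrable M w"
    and bound: "\<And>x \<omega>. \<omega> \<in> space M \<Longrightarrow> \<bar>x - x0\<bar> < 1 \<Longrightarrow> \<bar>g' x \<omega>\<bar> \<le> w \<omega>"
  shows "((\<lambda>x. integral\<^sup>L M (g x)) has_real_derivative integral\<^sup>L M (g' x0)) (at x0)"
  unfolding has_field_derivative_iff tendsto_at_iff_sequentially comp_def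
proof (intro allI impI)
  fix X :: "nat \<Rightarrow> real" assume X: "\<forall>i. X i \<in> UNIV - {x0}" and lim: "X \<longlonglongrightarrow> x0"
  obtain N where N: "\<And>i. N \<le> i \<Longrightarrow> \<bar>X i - x0\<bar> < 1"
    using LIMSEQ_D[OF lim, of 1] by auto
  define Y where "Y i = X (i + N)" for i
  have Y: "\<bar>Y i - x0\<bar> < 1" "Y i \<noteq> x0" for i using N X by (auto simp: Y_def)
  have Ylim: "Y \<longlonglongrightarrow> x0" unfolding Y_def using lim by (rule LIMSEQ_ignore_initial_segment)
  have eq: "(integral\<^sup>L M (g (Y i)) - integral\<^sup>L M (g x0)) / (Y i - x0) =
      (\<integral>\<omega>. (g (Y i) \<omega> - g x0 \<omega>) / (Y i - x0) \<partial>M)" for i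
    using int[OF Y(1)] int[of x0] by simp
  have "(\<lambda>i. \<integral>\<omega>. (g (Y i) \<omega> - g x0 \<omega>) / (Y i - x0) \<partial>M) \<longlonglongrightarrow> integral\<^sup>L M (g' x0)"
  proof (rule integral_dominated_convergence[where w=w, OF meas _ w])
    show "(\<lambda>\<omega>. (g (Y i) \<omega> - g x0 \<omega>) / (Y i - x0)) \<in> borel_measurable M" for i
      using int[OF Y(1)] int[of x0] by (auto intro!: borel_measurable_divide borel_measurable_diff)
    show "AE \<omega> in M. (\<lambda>i. (g (Y i) \<omega> - g x0 \<omega>) / (Y i - x0)) \<longlonglongrightarrow> g' x0 \<omega>"
    proof (rule AE_I2)
      fix \<omega> assume "\<omega> \<in> space M"
      from deriv[OF this, of x0]
      have "((\<lambda>y. (g y \<omega> - g x0 \<omega>) / (y - x0)) \<longlongrightarrow> g' x0 \<omega>) (at x0)"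
        unfolding has_field_derivative_iff by simp
      then show "(\<lambda>i. (g (Y i) \<omega> - g x0 \<omega>) / (Y i - x0)) \<longlonglongrightarrow> g' x0 \<omega>"
        unfolding tendsto_at_iff_sequentially comp_def using Y Ylim by auto
    qed
    show "AE \<omega> in M. norm ((g (Y i) \<omega> - g x0 \<omega>) / (Y i - x0)) \<le> w \<omega>" for i
    proof (rule AE_I2)
      fix \<omega> assume \<omega>: "\<omega> \<in> space M"
      have "norm (g (Y i) \<omega> - g x0 \<omega>) \<le> w \<omega> * norm (Y i - x0)"
      proof (rule field_differentiable_bound[where S="ball x0 1" and f'="\<lambda>x. g' x \<omega>"])
        fix x assume "x \<in> ball x0 1"
        then have x: "\<bar>x - x0\<bar> < 1" by (simp add: dist_real_def abs_minus_commute)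
        show "((\<lambda>x. g x \<omega>) has_field_derivative g' x \<omega>) (at x within ball x0 1)"
          using deriv[OF \<omega> x] by (rule has_field_derivative_at_within)
        show "norm (g' x \<omega>) \<le> w \<omega>" using bound[OF \<omega> x] by simp
      qed (use Y(1)[of i] in \<open>auto simp: dist_real_def abs_minus_commute\<close>)
      then show "norm ((g (Y i) \<omega> - g x0 \<omega>) / (Y i - x0)) \<le> w \<omega>"
        using Y(2)[of i] by (simp add: divide_le_eq)
    qed
  qed
  then have "(\<lambda>i. (integral\<^sup>L M (g (Y i)) - integral\<^sup>L M (g x0)) / (Y i - x0)) \<longlonglongrightarrow> integral\<^sup>L M (g' x0)"
    unfolding eq .
  then show "(\<lambda>i. (integral\<^sup>L M (g (X i)) - integral\<^sup>L M (g x0)) / (X i - x0)) \<longlonglongrightarrow> integral\<^sup>L M (g' x0)"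
    unfolding Y_def by (rule LIMSEQ_offset)
qed

text \<open>A mixture, with nonnegative weights \<open>Q\<close>, of the functions \<open>exp (E x \<omega>)\<close> of \<open>x\<close>; \<open>E1\<close> and \<open>E2\<close> are the
  first two derivatives of \<open>E\<close> in \<open>x\<close>. The domination hypothesis is local in \<open>x\<close> and covers the
  integrands of the mixture and of its first two derivatives.\<close>

locale exponential_mixture =
  fixes M :: "'a measure" and Q :: "'a \<Rightarrow> real" and E E1 E2 :: "real \<Rightarrow> 'a \<Rightarrow> real"
  assumes Q_measurable: "Q \<in> borel_measurable M"
    and Q_nonneg: "AE \<omega> in M. 0 \<le> Q \<omega>" and Q_nonzero: "\<not> (AE \<omega> in M. Q \<omega> = 0)"
    and E_measurable: "\<And>x. E x \<in> borel_measurable M" "\<And>x. E1 x \<in> borel_measurable M" "\<And>x. E2 x \<in> borel_measurable M"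
    and E_deriv: "\<And>x \<omega>. \<omega> \<in> space M \<Longrightarrow> ((\<lambda>x. E x \<omega>) has_real_derivative E1 x \<omega>) (at x)"
    and E1_deriv: "\<And>x \<omega>. \<omega> \<in> space M \<Longrightarrow> ((\<lambda>x. E1 x \<omega>) has_real_derivative E2 x \<omega>) (at x)"
    and dominated: "\<And>x0. \<exists>w. integrable M w \<and> (\<forall>x. \<forall>\<omega>\<in>space M. \<bar>x - x0\<bar> < 1 \<longrightarrow>
      \<bar>Q \<omega>\<bar> * exp (E x \<omega>) * ((1 + \<bar>E1 x \<omega>\<bar>)\<^sup>2 + \<bar>E2 x \<omega>\<bar>) \<le> w \<omega>)"
begin

text \<open>The mixture and, by \<open>DERIV_u\<close> and \<open>DERIV_u1\<close>, its first two derivatives.\<close>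

definition u :: "real \<Rightarrow> real" where "u x = (\<integral>\<omega>. Q \<omega> * exp (E x \<omega>) \<partial>M)"
definition u1 :: "real \<Rightarrow> real" where "u1 x = (\<integral>\<omega>. Q \<omega> * exp (E x \<omega>) * E1 x \<omega> \<partial>M)"
definition u2 :: "real \<Rightarrow> real" where "u2 x = (\<integral>\<omega>. Q \<omega> * exp (E x \<omega>) * ((E1 x \<omega>)\<^sup>2 + E2 x \<omega>) \<partial>M)"

lemma integrable_terms:
  "integrable M (\<lambda>\<omega>. Q \<omega> * exp (E x \<omega>))"
  "integrable M (\<lambda>\<omega>. Q \<omega> * exp (E x \<omega>) * E1 x \<omega>)"
  "integrable M (\<lambda>\<omega>. Q \<omega> * exp (E x \<omega>) * (E1 x \<omega>)\<^sup>2)"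
  "integrable M (\<lambda>\<omega>. Q \<omega> * exp (E x \<omega>) * E2 x \<omega>)"
proof -
  note [measurable] = Q_measurable E_measurable
  obtain w where w: "integrable M w" and le: "\<And>\<omega>. \<omega> \<in> space M \<Longrightarrow>
      \<bar>Q \<omega>\<bar> * exp (E x \<omega>) * ((1 + \<bar>E1 x \<omega>\<bar>)\<^sup>2 + \<bar>E2 x \<omega>\<bar>) \<le> w \<omega>"
    using dominated[of x] by fastforce
  have dom: "integrable M (\<lambda>\<omega>. Q \<omega> * exp (E x \<omega>) * r \<omega>)"
    if [measurable]: "r \<in> borel_measurable M" and "\<And>\<omega>. \<bar>r \<omega>\<bar> \<le> (1 + \<bar>E1 x \<omega>\<bar>)\<^sup>2 + \<bar>E2 x \<omega>\<bar>" for r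
  proof (rule Bochner_Integration.integrable_bound[OF w])
    show "AE \<omega> in M. norm (Q \<omega> * exp (E x \<omega>) * r \<omega>) \<le> norm (w \<omega>)"
    proof (rule AE_I2)
      fix \<omega> assume "\<omega> \<in> space M"
      have "norm (Q \<omega> * exp (E x \<omega>) * r \<omega>) \<le> \<bar>Q \<omega>\<bar> * exp (E x \<omega>) * ((1 + \<bar>E1 x \<omega>\<bar>)\<^sup>2 + \<bar>E2 x \<omega>\<bar>)"
        unfolding real_norm_def abs_mult using that(2)[of \<omega>] by (intro mult_mono) auto
      also have "\<dots> \<le> norm (w \<omega>)" using le[OF \<open>\<omega> \<in> space M\<close>] by simp
      finally show "norm (Q \<omega> * exp (E x \<omega>) * r \<omega>) \<le> norm (w \<omega>)" .
    qed
  qed measurable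
  have e: "1 \<le> (1 + \<bar>y\<bar>)\<^sup>2 + \<bar>z\<bar>" "\<bar>y\<bar> \<le> (1 + \<bar>y\<bar>)\<^sup>2 + \<bar>z\<bar>" "y\<^sup>2 \<le> (1 + \<bar>y\<bar>)\<^sup>2 + \<bar>z\<bar>" "\<bar>z\<bar> \<le> (1 + \<bar>y\<bar>)\<^sup>2 + \<bar>z\<bar>"
    for y z :: real
    by (auto simp: power2_sum)
  show "integrable M (\<lambda>\<omega>. Q \<omega> * exp (E x \<omega>))" using dom[of "\<lambda>_. 1"] e by simp
  show "integrable M (\<lambda>\<omega>. Q \<omega> * exp (E x \<omega>) * E1 x \<omega>)" using e by (intro dom) auto
  show "integrable M (\<lambda>\<omega>. Q \<omega> * exp (E x \<omega>) * (E1 x \<omega>)\<^sup>2)" using e by (intro dom) auto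
  show "integrable M (\<lambda>\<omega>. Q \<omega> * exp (E x \<omega>) * E2 x \<omega>)" using e by (intro dom) auto
qed

lemma DERIV_u: "(u has_real_derivative u1 x) (at x)"
  and DERIV_u1: "(u1 has_real_derivative u2 x) (at x)"
proof -
  note [measurable] = Q_measurable E_measurable
  obtain w where w: "integrable M w" and le: "\<And>y \<omega>. \<omega> \<in> space M \<Longrightarrow> \<bar>y - x\<bar> < 1 \<Longrightarrow>
      \<bar>Q \<omega>\<bar> * exp (E y \<omega>) * ((1 + \<bar>E1 y \<omega>\<bar>)\<^sup>2 + \<bar>E2 y \<omega>\<bar>) \<le> w \<omega>"
    using dominated[of x] by fastforce
  have dom: "\<bar>Q \<omega> * exp (E y \<omega>) * r\<bar> \<le> w \<omega>"
    if "\<omega> \<in> space M" "\<bar>y - x\<bar> < 1" "\<bar>r\<bar> \<le> (1 + \<bar>E1 y \<omega>\<bar>)\<^sup>2 + \<bar>E2 y \<omega>\<bar>" for r y \<omega>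
  proof -
    have "\<bar>Q \<omega> * exp (E y \<omega>) * r\<bar> \<le> \<bar>Q \<omega>\<bar> * exp (E y \<omega>) * ((1 + \<bar>E1 y \<omega>\<bar>)\<^sup>2 + \<bar>E2 y \<omega>\<bar>)"
      unfolding abs_mult using that(3) by (intro mult_mono) auto
    also have "\<dots> \<le> w \<omega>" using le that by simp
    finally show ?thesis .
  qed
  have "((\<lambda>x. \<integral>\<omega>. Q \<omega> * exp (E x \<omega>) \<partial>M) has_real_derivative (\<integral>\<omega>. Q \<omega> * exp (E x \<omega>) * E1 x \<omega> \<partial>M)) (at x)"
  proof (rule DERIV_under_integral[OF _ _ _ w])
    show "((\<lambda>x. Q \<omega> * exp (E x \<omega>)) has_real_derivative Q \<omega> * exp (E y \<omega>) * E1 y \<omega>) (at y)"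
      if "\<omega> \<in> space M" for y \<omega>
      by (auto intro!: derivative_eq_intros E_deriv that)
    show "\<bar>Q \<omega> * exp (E y \<omega>) * E1 y \<omega>\<bar> \<le> w \<omega>" if "\<omega> \<in> space M" "\<bar>y - x\<bar> < 1" for y \<omega>
      using that by (intro dom) (auto simp: power2_sum)
  qed (use integrable_terms in auto)
  then show "(u has_real_derivative u1 x) (at x)" unfolding u_def[abs_def] u1_def .
  have "((\<lambda>x. \<integral>\<omega>. Q \<omega> * exp (E x \<omega>) * E1 x \<omega> \<partial>M) has_real_derivative
      (\<integral>\<omega>. Q \<omega> * exp (E x \<omega>) * ((E1 x \<omega>)\<^sup>2 + E2 x \<omega>) \<partial>M)) (at x)"
  proof (rule DERIV_under_integral[OF _ _ _ w])
    show "((\<lambda>x. Q \<omega> * exp (E x \<omega>) * E1 x \<omega>) has_real_derivative Q \<omega> * exp (E y \<omega>) * ((E1 y \<omega>)\<^sup>2 + E2 y \<omega>)) (at y)"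
      if "\<omega> \<in> space M" for y \<omega>
      by (auto intro!: derivative_eq_intros E_deriv E1_deriv that simp: algebra_simps power2_eq_square)
    show "\<bar>Q \<omega> * exp (E y \<omega>) * ((E1 y \<omega>)\<^sup>2 + E2 y \<omega>)\<bar> \<le> w \<omega>" if "\<omega> \<in> space M" "\<bar>y - x\<bar> < 1" for y \<omega>
    proof (rule dom[OF that])
      have "\<bar>(E1 y \<omega>)\<^sup>2 + E2 y \<omega>\<bar> \<le> \<bar>E1 y \<omega>\<bar>\<^sup>2 + \<bar>E2 y \<omega>\<bar>"
        using abs_triangle_ineq[of "(E1 y \<omega>)\<^sup>2" "E2 y \<omega>"] by simp
      also have "\<bar>E1 y \<omega>\<bar>\<^sup>2 \<le> (1 + \<bar>E1 y \<omega>\<bar>)\<^sup>2" by (intro power_mono) auto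
      finally show "\<bar>(E1 y \<omega>)\<^sup>2 + E2 y \<omega>\<bar> \<le> (1 + \<bar>E1 y \<omega>\<bar>)\<^sup>2 + \<bar>E2 y \<omega>\<bar>" by simp
    qed
  qed (use integrable_terms in auto)
  then show "(u1 has_real_derivative u2 x) (at x)" unfolding u1_def[abs_def] u2_def .
qed

lemma u_pos: "0 < u x"
proof -
  have nn: "AE \<omega> in M. 0 \<le> Q \<omega> * exp (E x \<omega>)" using Q_nonneg by eventually_elim simp
  have "u x \<noteq> 0"
  proof
    assume "u x = 0"
    then have "AE \<omega> in M. Q \<omega> * exp (E x \<omega>) = 0"
      unfolding u_def using integral_nonneg_eq_0_iff_AE[OF integrable_terms(1) nn] by simp
    then show False using Q_nonzero by simp
  qed
  moreover have "0 \<le> u x" unfolding u_def using nn by (rule integral_nonneg_AE)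
  ultimately show ?thesis by simp
qed

text \<open>A mixture inherits lower bounds for the second derivative of the logarithm: the logarithmic derivative
  \<open>m\<close> of \<open>u\<close> is the mean of \<open>E1\<close> under the weights \<open>Q * exp E\<close>, and the second derivative of \<open>ln u\<close> is
  the mean of \<open>E2\<close> plus the variance of \<open>E1\<close>.\<close>

lemma log_second_derivative_ge:
  assumes E2: "\<And>\<omega>. \<omega> \<in> space M \<Longrightarrow> - k \<le> E2 x \<omega>"
  shows "- k \<le> u2 x / u x - (u1 x / u x)\<^sup>2"
proof -
  define m where "m = u1 x / u x"
  have pos: "0 < u x" by (rule u_pos)
  let ?p = "\<lambda>\<omega>. Q \<omega> * exp (E x \<omega>)"
  let ?v = "\<integral>\<omega>. ?p \<omega> * (E1 x \<omega>)\<^sup>2 \<partial>M" and ?z = "\<integral>\<omega>. ?p \<omega> * E2 x \<omega> \<partial>M"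
  note I = integrable_terms[of x]
  have u2: "u2 x = ?v + ?z"
    unfolding u2_def distrib_left using I by (simp add: Bochner_Integration.integral_add)
  have "0 \<le> (\<integral>\<omega>. ?p \<omega> * (E1 x \<omega> - m)\<^sup>2 \<partial>M)"
    by (rule integral_nonneg_AE) (use Q_nonneg in eventually_elim, simp)
  also have "(\<lambda>\<omega>. ?p \<omega> * (E1 x \<omega> - m)\<^sup>2) =
      (\<lambda>\<omega>. ?p \<omega> * (E1 x \<omega>)\<^sup>2 - 2 * m * (?p \<omega> * E1 x \<omega>) + m\<^sup>2 * ?p \<omega>)"
    by (simp add: fun_eq_iff power2_eq_square algebra_simps)
  also have "(\<integral>\<omega>. ?p \<omega> * (E1 x \<omega>)\<^sup>2 - 2 * m * (?p \<omega> * E1 x \<omega>) + m\<^sup>2 * ?p \<omega> \<partial>M) =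
      ?v - 2 * m * u1 x + m\<^sup>2 * u x"
    unfolding u_def u1_def using I by (simp del: mult.assoc)
  also have "\<dots> = ?v - m\<^sup>2 * u x"
    using pos by (simp add: m_def power2_eq_square)
  finally have v: "m\<^sup>2 * u x \<le> ?v" by simp
  have "(\<integral>\<omega>. - k * ?p \<omega> \<partial>M) \<le> ?z"
  proof (rule integral_mono_AE)
    show "AE \<omega> in M. - k * ?p \<omega> \<le> ?p \<omega> * E2 x \<omega>"
      using Q_nonneg AE_space
    proof eventually_elim
      case (elim \<omega>)
      then have "?p \<omega> * (- k) \<le> ?p \<omega> * E2 x \<omega>" by (intro mult_left_mono E2) auto
      then show ?case by (simp add: mult.commute)
    qed
  qed (use I in auto)
  then have z: "- k * u x \<le> ?z" unfolding u_def by simp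
  have "(m\<^sup>2 - k) * u x \<le> u2 x" using v z u2 by (simp add: left_diff_distrib)
  then have "m\<^sup>2 - k \<le> u2 x / u x" using pos by (simp add: pos_le_divide_eq)
  then show ?thesis by (simp add: m_def)
qed

lemma DERIV_ln_u: "((\<lambda>x. ln (u x)) has_real_derivative u1 x / u x) (at x)"
  using u_pos[of x] by (auto intro!: derivative_eq_intros DERIV_u)

lemma DERIV_ln_u1: "((\<lambda>x. u1 x / u x) has_real_derivative u2 x / u x - (u1 x / u x)\<^sup>2) (at x)"
  using u_pos[of x]
  by (auto intro!: derivative_eq_intros DERIV_u DERIV_u1 simp: field_simps power2_eq_square)

end

section \<open>Integrals along a path\<close>

lemma set_lebesgue_integral_eq_integral_continuous:
  fixes f :: "real \<Rightarrow> real"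
  assumes "continuous_on {a..b} f"
  shows "(LINT s:{a..b}|lborel. f s) = integral {a..b} f"
  using set_borel_integral_eq_integral(2)[OF borel_integrable_atLeastAtMost'[OF assms]] .

lemma DERIV_path_integral:
  fixes a z G G' :: "real \<Rightarrow> real"
  assumes a: "continuous_on {0..t} a" and z: "continuous_on {0..t} z"
    and G: "\<And>y. (G has_real_derivative G' y) (at y)" and G': "continuous_on UNIV G'"
  shows "((\<lambda>x. integral {0..t} (\<lambda>s. a s ^ k * G (a s * x + z s))) has_real_derivative
    integral {0..t} (\<lambda>s. a s ^ Suc k * G' (a s * x + z s))) (at x)"
proof -
  have Gc: "continuous_on UNIV G"
    using G by (auto intro!: DERIV_isCont continuous_at_imp_continuous_on)
  have "((\<lambda>x. integral (cbox 0 t) (\<lambda>s. a s ^ k * G (a s * x + z s))) has_field_derivative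
    integral (cbox 0 t) (\<lambda>s. a s ^ Suc k * G' (a s * x + z s))) (at x within UNIV)"
  proof (rule leibniz_rule_field_derivative)
    show "((\<lambda>x. a s ^ k * G (a s * x + z s)) has_field_derivative a s ^ Suc k * G' (a s * y + z s)) (at y within UNIV)"
      for y s
      by (auto intro!: derivative_eq_intros DERIV_chain2[OF G])
    show "(\<lambda>s. a s ^ k * G (a s * y + z s)) integrable_on cbox 0 t" for y
      using a z by (intro integrable_continuous continuous_intros continuous_on_compose2[OF Gc]) auto
    have "continuous_on (UNIV \<times> {0..t}) (\<lambda>p. a (snd p))" "continuous_on (UNIV \<times> {0..t}) (\<lambda>p. z (snd p))"
      by (auto intro!: continuous_on_compose2[OF a] continuous_on_compose2[OF z] continuous_intros)
    then show "continuous_on (UNIV \<times> cbox 0 t) (\<lambda>(x, s). a s ^ Suc k * G' (a s * x + z s))"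
      unfolding split_beta by (intro continuous_intros continuous_on_compose2[OF G']) auto
  qed auto
  then show ?thesis by simp
qed

lemma integral_square_le:
  fixes Y :: "real \<Rightarrow> real"
  assumes t: "0 < t" and Y: "continuous_on {0..t} Y"
  shows "(integral {0..t} Y)\<^sup>2 \<le> t * integral {0..t} (\<lambda>s. (Y s)\<^sup>2)"
proof -
  \<comment> \<open>The variance of \<open>Y\<close> around its mean \<open>m\<close> is nonnegative.\<close>
  define m where "m = integral {0..t} Y / t"
  have i1: "(Y has_integral integral {0..t} Y) {0..t}"
    and i2: "((\<lambda>s. (Y s)\<^sup>2) has_integral integral {0..t} (\<lambda>s. (Y s)\<^sup>2)) {0..t}"
    using Y by (auto intro!: integrable_integral integrable_continuous_real continuous_intros)
  have i3: "((\<lambda>s. m\<^sup>2) has_integral t * m\<^sup>2) {0..t}"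
    using has_integral_const_real[of "m\<^sup>2" 0 t] t by simp
  have "((\<lambda>s. (Y s)\<^sup>2 - 2 * m * Y s + m\<^sup>2) has_integral
      (integral {0..t} (\<lambda>s. (Y s)\<^sup>2) - 2 * m * integral {0..t} Y + t * m\<^sup>2)) {0..t}"
    by (intro has_integral_add has_integral_diff has_integral_mult_right i1 i2 i3)
  moreover have "(\<lambda>s. (Y s)\<^sup>2 - 2 * m * Y s + m\<^sup>2) = (\<lambda>s. (Y s - m)\<^sup>2)"
    by (simp add: fun_eq_iff power2_eq_square algebra_simps)
  ultimately have "0 \<le> integral {0..t} (\<lambda>s. (Y s)\<^sup>2) - 2 * m * integral {0..t} Y + t * m\<^sup>2"
    using has_integral_nonneg[where S="{0..t}" and f="\<lambda>s. (Y s - m)\<^sup>2"] by auto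
  then have "0 \<le> t * (integral {0..t} (\<lambda>s. (Y s)\<^sup>2) - 2 * m * integral {0..t} Y + t * m\<^sup>2)"
    using t by simp
  also have "\<dots> = t * integral {0..t} (\<lambda>s. (Y s)\<^sup>2) - (integral {0..t} Y)\<^sup>2"
    using t by (simp add: m_def field_simps power2_eq_square)
  finally show ?thesis by simp
qed

section \<open>Moments of the Ornstein--Uhlenbeck process\<close>

lemma integrable_std_normal_shifted_moment:
  "integrable lborel (\<lambda>y. std_normal_density y * (b + \<bar>y\<bar>) ^ N)"
proof -
  have "integrable lborel (\<lambda>y. \<Sum>k\<le>N. of_nat (N choose k) * b ^ k * (std_normal_density y * \<bar>y\<bar> ^ (N - k)))"
    by (intro Bochner_Integration.integrable_sum integrable_mult_right integrable_std_normal_moment_abs)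
  also have "(\<lambda>y. \<Sum>k\<le>N. of_nat (N choose k) * b ^ k * (std_normal_density y * \<bar>y\<bar> ^ (N - k))) =
      (\<lambda>y. std_normal_density y * (b + \<bar>y\<bar>) ^ N)"
    by (simp add: binomial_ring sum_distrib_left mult_ac)
  finally show ?thesis .
qed

context OU_from_zero
begin

text \<open>The bound does not depend on \<open>s\<close>, because \<open>Z s\<close> has variance at most \<open>1\<close>.\<close>

lemma Z_moment_le:
  assumes s: "0 < s" and b: "0 \<le> b"
  shows "(\<integral>\<^sup>+\<omega>. ennreal ((b + \<bar>Z s \<omega>\<bar>) ^ N) \<partial>M) \<le>
    ennreal (\<integral>y. std_normal_density y * (b + \<bar>y\<bar>) ^ N \<partial>lborel)"
proof -
  define \<sigma> where "\<sigma> = 1 / sqrt (OU_precision s)"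
  have \<sigma>: "0 < \<sigma>" "\<sigma> \<le> 1" using OU_precision_gt_1[OF s] by (simp_all add: \<sigma>_def)
  have [measurable]: "Z s \<in> borel_measurable M" using Z_measurable s by simp
  have std: "distributed M lborel (\<lambda>\<omega>. Z s \<omega> / \<sigma>) std_normal_density"
    using Z_normal[OF s] normal_standard_normal_convert[OF \<sigma>(1), of "Z s" 0] by (simp add: \<sigma>_def)
  have "(\<integral>\<^sup>+\<omega>. ennreal ((b + \<bar>Z s \<omega>\<bar>) ^ N) \<partial>M) \<le> (\<integral>\<^sup>+\<omega>. ennreal ((b + \<bar>Z s \<omega> / \<sigma>\<bar>) ^ N) \<partial>M)"
  proof (intro nn_integral_mono ennreal_leI power_mono add_left_mono)
    fix \<omega>
    have "\<bar>Z s \<omega>\<bar> * \<sigma> \<le> \<bar>Z s \<omega>\<bar> * 1" using \<sigma> by (intro mult_left_mono) auto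
    then show "\<bar>Z s \<omega>\<bar> \<le> \<bar>Z s \<omega> / \<sigma>\<bar>" using \<sigma> by (simp add: pos_le_divide_eq)
  qed (use b in auto)
  also have "\<dots> = (\<integral>\<^sup>+y. ennreal (std_normal_density y) * ennreal ((b + \<bar>y\<bar>) ^ N) \<partial>lborel)"
    by (rule distributed_nn_integral[OF std, symmetric]) measurable
  also have "\<dots> = (\<integral>\<^sup>+y. ennreal (std_normal_density y * (b + \<bar>y\<bar>) ^ N) \<partial>lborel)"
    using b by (simp add: ennreal_mult)
  also have "\<dots> = ennreal (\<integral>y. std_normal_density y * (b + \<bar>y\<bar>) ^ N \<partial>lborel)"
    using b by (intro nn_integral_eq_integral integrable_std_normal_shifted_moment) auto
  finally show ?thesis .
qed

lemma integrable_Z_moment: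
  assumes s: "0 < s" and b: "0 \<le> b"
  shows "integrable M (\<lambda>\<omega>. (b + \<bar>Z s \<omega>\<bar>) ^ N)"
proof (rule integrableI_nonneg)
  show "(\<lambda>\<omega>. (b + \<bar>Z s \<omega>\<bar>) ^ N) \<in> borel_measurable M"
    using Z_measurable[OF less_imp_le[OF s]] by measurable
  show "AE \<omega> in M. 0 \<le> (b + \<bar>Z s \<omega>\<bar>) ^ N" using b by simp
  show "(\<integral>\<^sup>+\<omega>. ennreal ((b + \<bar>Z s \<omega>\<bar>) ^ N) \<partial>M) < \<infinity>"
    using Z_moment_le[OF s b, of N] by (simp add: order_le_less_trans)
qed

lemma Z_continuous_interval: "\<omega> \<in> space M \<Longrightarrow> continuous_on {0..t} (\<lambda>s. Z s \<omega>)"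
  using Z_continuous[of \<omega>] by (rule continuous_on_subset) auto

lemma integrable_Z_path_moment:
  assumes t: "0 < t" and b: "0 \<le> b"
  shows "integrable M (\<lambda>\<omega>. integral {0..t} (\<lambda>s. (b + \<bar>Z s \<omega>\<bar>) ^ N))"
proof -
  let ?Y = "\<lambda>s \<omega>. (b + \<bar>Z s \<omega>\<bar>) ^ N"
  define C where "C = (\<integral>y. std_normal_density y * (b + \<bar>y\<bar>) ^ N \<partial>lborel)"
  interpret P: pair_sigma_finite M lborel
    by (simp add: pair_sigma_finite_def sigma_finite_measure_axioms sigma_finite_lborel)
  note Z_jointly_measurable[measurable]
  have Yc: "continuous_on {0..t} (\<lambda>s. ?Y s \<omega>)" if "\<omega> \<in> space M" for \<omega>
    using Z_continuous_interval[OF that] by (intro continuous_intros)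
  have eq: "integral {0..t} (\<lambda>s. ?Y s \<omega>) = (LINT s:{0..t}|lborel. ?Y s \<omega>)" if "\<omega> \<in> space M" for \<omega>
    using set_lebesgue_integral_eq_integral_continuous[OF Yc[OF that]] by simp
  have meas: "(\<lambda>\<omega>. LINT s:{0..t}|lborel. ?Y s \<omega>) \<in> borel_measurable M"
    by (rule Z_path_integral_measurable[where U="\<lambda>s z. (b + \<bar>z\<bar>) ^ N"])
       (auto simp: split_beta intro!: continuous_intros)
  have nn: "0 \<le> (LINT s:{0..t}|lborel. ?Y s \<omega>)" for \<omega>
    unfolding set_lebesgue_integral_def using b by (intro integral_nonneg_AE AE_I2) simp
  have "integrable M (\<lambda>\<omega>. LINT s:{0..t}|lborel. ?Y s \<omega>)"
  proof (rule integrableI_nonneg[OF meas])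
    show "AE \<omega> in M. 0 \<le> (LINT s:{0..t}|lborel. ?Y s \<omega>)" using nn by simp
    have "(\<integral>\<^sup>+\<omega>. ennreal (LINT s:{0..t}|lborel. ?Y s \<omega>) \<partial>M) =
        (\<integral>\<^sup>+\<omega>. (\<integral>\<^sup>+s. indicator {0..t} s * ennreal (?Y (max 0 s) \<omega>) \<partial>lborel) \<partial>M)"
    proof (rule nn_integral_cong)
      fix \<omega> assume "\<omega> \<in> space M"
      then have "integrable lborel (\<lambda>s. indicator {0..t} s *\<^sub>R ?Y s \<omega>)"
        using borel_integrable_atLeastAtMost'[OF Yc] by (simp add: set_integrable_def)
      then have "ennreal (LINT s:{0..t}|lborel. ?Y s \<omega>) = (\<integral>\<^sup>+s. ennreal (indicator {0..t} s *\<^sub>R ?Y s \<omega>) \<partial>lborel)"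
        unfolding set_lebesgue_integral_def using b by (intro nn_integral_eq_integral[symmetric]) auto
      also have "\<dots> = (\<integral>\<^sup>+s. indicator {0..t} s * ennreal (?Y (max 0 s) \<omega>) \<partial>lborel)"
        by (intro nn_integral_cong) (auto simp: indicator_def)
      finally show "ennreal (LINT s:{0..t}|lborel. ?Y s \<omega>) =
          (\<integral>\<^sup>+s. indicator {0..t} s * ennreal (?Y (max 0 s) \<omega>) \<partial>lborel)" .
    qed
    also have "\<dots> = (\<integral>\<^sup>+s. (\<integral>\<^sup>+\<omega>. indicator {0..t} s * ennreal (?Y (max 0 s) \<omega>) \<partial>M) \<partial>lborel)"
      by (rule P.Fubini'[symmetric]) measurable
    also have "\<dots> \<le> (\<integral>\<^sup>+s. indicator {0..t} s * ennreal C \<partial>lborel)"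
    proof (rule nn_integral_mono_AE)
      show "AE s in lborel. (\<integral>\<^sup>+\<omega>. indicator {0..t} s * ennreal (?Y (max 0 s) \<omega>) \<partial>M) \<le> indicator {0..t} s * ennreal C"
        \<comment> \<open>The moment bound is available for \<open>s > 0\<close> only.\<close>
        using AE_lborel_singleton[of 0]
      proof eventually_elim
        case (elim s)
        then show ?case
          using Z_moment_le[of s b N] b by (cases "s \<in> {0..t}") (auto simp: C_def)
      qed
    qed
    also have "\<dots> = ennreal C * ennreal t"
      using t by (simp add: mult.commute nn_integral_cmult)
    also have "\<dots> < \<infinity>" by (simp add: ennreal_mult_less_top)
    finally show "(\<integral>\<^sup>+\<omega>. ennreal (LINT s:{0..t}|lborel. ?Y s \<omega>) \<partial>M) < \<infinity>" .
  qed
  then show ?thesis by (subst Bochner_Integration.integrable_cong[OF refl eq]) auto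
qed

end

section \<open>The Feynman--Kac functional as a mixture\<close>

lemma (in prob_space) AE_normal_iff:
  assumes Y: "distributed M lborel Y (normal_density m \<sigma>)" and \<sigma>: "0 < \<sigma>"
    and P[measurable]: "Measurable.pred borel P"
  shows "(AE \<omega> in M. P (Y \<omega>)) \<longleftrightarrow> (AE y in lborel. P y)"
proof -
  have Ym: "Y \<in> measurable M lborel" using distributed_measurable[OF Y] .
  have "(AE \<omega> in M. P (Y \<omega>)) \<longleftrightarrow> (AE y in distr M lborel Y. P y)"
    by (subst AE_distr_iff[OF Ym]) auto
  also have "\<dots> \<longleftrightarrow> (AE y in lborel. 0 < ennreal (normal_density m \<sigma> y) \<longrightarrow> P y)"
    unfolding distributed_distr_eq_density[OF Y] by (subst AE_density) auto
  finally show ?thesis using normal_density_pos[OF \<sigma>] by simp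
qed

text \<open>A potential \<open>V\<close> of class \<open>C\<^sup>2\<close>, bounded below, whose first two derivatives \<open>V1\<close> and \<open>V2\<close> have polynomial
  growth, and a nonnegative terminal function \<open>q\<close>, not almost everywhere zero and square integrable with respect
  to the stationary law of the Ornstein--Uhlenbeck process.\<close>

locale OU_Feynman_Kac = OU_from_zero M B Z for M :: "'w measure" and B Z +
  fixes t K C :: real and N :: nat and V V1 V2 q :: "real \<Rightarrow> real"
  assumes t: "0 < t"
    and V_deriv: "\<And>y. (V has_real_derivative V1 y) (at y)"
    and V1_deriv: "\<And>y. (V1 has_real_derivative V2 y) (at y)"
    and V2_continuous: "continuous_on UNIV V2"
    and V_ge: "\<And>y. - K \<le> V y" and K: "0 \<le> K"
    and V1_growth: "\<And>y. \<bar>V1 y\<bar> \<le> C * (1 + \<bar>y\<bar>) ^ N"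
    and V2_growth: "\<And>y. \<bar>V2 y\<bar> \<le> C * (1 + \<bar>y\<bar>) ^ N"
    and q_measurable: "q \<in> borel_measurable borel"
    and q_integrable: "integrable lborel (\<lambda>y. (q y)\<^sup>2 * exp (- y\<^sup>2 / 2))"
    and q_nonneg: "AE y in lborel. 0 \<le> q y" and q_nonzero: "\<not> (AE y in lborel. q y = 0)"
begin

text \<open>The weight of the starting point in the conditional mean at time \<open>s\<close> of the Ornstein--Uhlenbeck process given
  its value at time \<open>t\<close>.\<close>

definition bridge_weight :: "real \<Rightarrow> real" where
  "bridge_weight s = sinh (t - s) / sinh t"

text \<open>The logarithm of the Cameron--Martin density for the translation \<open>exp (- t) * x\<close> of the end point, minus the
  potential along the path translated by the remaining part \<open>bridge_weight s * x\<close>. The trivial factor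
  \<open>bridge_weight s ^ 0\<close> gives the integrand the same shape as in the derivatives with respect to \<open>x\<close>.\<close>

definition log_weight :: "real \<Rightarrow> 'w \<Rightarrow> real" where
  "log_weight x \<omega> = exp (- t) * x * OU_precision t * Z t \<omega> - (exp (- t) * x)\<^sup>2 * OU_precision t / 2
    - integral {0..t} (\<lambda>s. bridge_weight s ^ 0 * V (bridge_weight s * x + Z s \<omega>))"

text \<open>The first two derivatives of \<open>log_weight\<close> in \<open>x\<close> (see \<open>log_weight_DERIV\<close>).\<close>

definition log_weight1 :: "real \<Rightarrow> 'w \<Rightarrow> real" where
  "log_weight1 x \<omega> = exp (- t) * OU_precision t * Z t \<omega> - (exp (- t))\<^sup>2 * OU_precision t * x
    - integral {0..t} (\<lambda>s. bridge_weight s ^ Suc 0 * V1 (bridge_weight s * x + Z s \<omega>))"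

definition log_weight2 :: "real \<Rightarrow> 'w \<Rightarrow> real" where
  "log_weight2 x \<omega> = - (exp (- t))\<^sup>2 * OU_precision t
    - integral {0..t} (\<lambda>s. bridge_weight s ^ Suc (Suc 0) * V2 (bridge_weight s * x + Z s \<omega>))"

lemma sinh_t_pos: "0 < sinh t" using t by simp

lemma V_continuous: "continuous_on UNIV V" and V1_continuous: "continuous_on UNIV V1"
  using V_deriv V1_deriv by (auto intro!: DERIV_isCont continuous_at_imp_continuous_on)

lemma bridge_weight_continuous: "continuous_on A bridge_weight"
  unfolding bridge_weight_def[abs_def] using sinh_t_pos by (intro continuous_intros) auto

text \<open>The translation \<open>exp (- s) * x\<close> due to the starting point splits into a part that vanishes at time \<open>t\<close> and a multiple
  of \<open>sinh s / sinh t\<close>.\<close>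

lemma bridge_weight_shift: "bridge_weight s * x + exp (- t) * x * (sinh s / sinh t) = exp (- s) * x"
proof -
  have "sinh (t - s) + exp (- t) * sinh s = exp (- s) * sinh t"
    by (simp add: sinh_def algebra_simps exp_add[symmetric])
  then have "bridge_weight s + exp (- t) * (sinh s / sinh t) = exp (- s)"
    using sinh_t_pos by (simp add: bridge_weight_def add_divide_distrib[symmetric])
  moreover have "bridge_weight s * x + exp (- t) * x * (sinh s / sinh t) =
      (bridge_weight s + exp (- t) * (sinh s / sinh t)) * x"
    by (simp only: distrib_right) (simp only: mult_ac)
  ultimately show ?thesis by simp
qed

lemma bridge_weight_bounds:
  assumes "s \<in> {0..t}"
  shows "0 \<le> bridge_weight s" "bridge_weight s \<le> exp (- s)" "bridge_weight s \<le> 1"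
proof -
  show "0 \<le> bridge_weight s" using assms sinh_t_pos by (simp add: bridge_weight_def)
  have "0 \<le> exp (- t) * (sinh s / sinh t)" using assms sinh_t_pos by simp
  then show 1: "bridge_weight s \<le> exp (- s)" using bridge_weight_shift[of s 1] by simp
  then show "bridge_weight s \<le> 1" using assms by (auto intro: order_trans)
qed

lemma integral_bridge_weight_square: "integral {0..t} (\<lambda>s. (bridge_weight s)\<^sup>2) \<le> 1 / 2"
proof -
  have "((\<lambda>s. exp (- 2 * s)) has_integral (- exp (- 2 * t) / 2 - (- exp (- 2 * 0) / 2))) {0..t}"
    by (rule fundamental_theorem_of_calculus)
      (use t in \<open>auto intro!: derivative_eq_intros simp: has_real_derivative_iff_has_vector_derivative[symmetric]\<close>)
  then have e: "integral {0..t} (\<lambda>s. exp (- 2 * s)) = (1 - exp (- 2 * t)) / 2" "(\<lambda>s. exp (- 2 * s)) integrable_on {0..t}"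
    by (auto dest: integral_unique simp: diff_divide_distrib)
  have "integral {0..t} (\<lambda>s. (bridge_weight s)\<^sup>2) \<le> integral {0..t} (\<lambda>s. exp (- 2 * s))"
  proof (rule integral_le[OF _ e(2)])
    show "(\<lambda>s. (bridge_weight s)\<^sup>2) integrable_on {0..t}"
      by (intro integrable_continuous_real continuous_intros bridge_weight_continuous)
    show "(bridge_weight s)\<^sup>2 \<le> exp (- 2 * s)" if "s \<in> {0..t}" for s
      using power_mono[OF bridge_weight_bounds(2,1)[OF that], of 2] by (simp add: exp_double[symmetric])
  qed
  also have "\<dots> \<le> 1 / 2" unfolding e by simp
  finally show ?thesis .
qed

lemma log_weight_DERIV:
  assumes "\<omega> \<in> space M"
  shows "((\<lambda>x. log_weight x \<omega>) has_real_derivative log_weight1 x \<omega>) (at x)"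
    and "((\<lambda>x. log_weight1 x \<omega>) has_real_derivative log_weight2 x \<omega>) (at x)"
proof -
  note D0 = DERIV_path_integral[OF bridge_weight_continuous Z_continuous_interval[OF assms] V_deriv V1_continuous, where k=0]
  note D1 = DERIV_path_integral[OF bridge_weight_continuous Z_continuous_interval[OF assms] V1_deriv V2_continuous, where k="Suc 0"]
  have "((\<lambda>x. exp (- t) * x * OU_precision t * Z t \<omega> - (exp (- t) * x)\<^sup>2 * OU_precision t / 2) has_real_derivative
      exp (- t) * OU_precision t * Z t \<omega> - (exp (- t))\<^sup>2 * OU_precision t * x) (at x)"
    by (auto intro!: derivative_eq_intros simp: power2_eq_square)
  from DERIV_diff[OF this D0] show "((\<lambda>x. log_weight x \<omega>) has_real_derivative log_weight1 x \<omega>) (at x)"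
    unfolding log_weight_def log_weight1_def .
  have "((\<lambda>x. exp (- t) * OU_precision t * Z t \<omega> - (exp (- t))\<^sup>2 * OU_precision t * x) has_real_derivative
      - (exp (- t))\<^sup>2 * OU_precision t) (at x)"
    by (auto intro!: derivative_eq_intros)
  from DERIV_diff[OF this D1] show "((\<lambda>x. log_weight1 x \<omega>) has_real_derivative log_weight2 x \<omega>) (at x)"
    unfolding log_weight1_def log_weight2_def .
qed

lemma potential_integral_eq:
  assumes "\<omega> \<in> space M" and G: "continuous_on UNIV G"
  shows "(LINT s:{0..t}|lborel. bridge_weight s ^ k * G (bridge_weight s * x + Z s \<omega>)) =
    integral {0..t} (\<lambda>s. bridge_weight s ^ k * G (bridge_weight s * x + Z s \<omega>))"
  by (intro set_lebesgue_integral_eq_integral_continuous continuous_intros bridge_weight_continuous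
      Z_continuous_interval[OF assms(1)] continuous_on_compose2[OF G]) auto

lemma potential_continuous:
  assumes G: "continuous_on UNIV G"
  shows "continuous_on UNIV (\<lambda>(s, z). bridge_weight s ^ k * G (bridge_weight s * x + z :: real) :: real)"
proof -
  have "continuous_on UNIV (\<lambda>p. bridge_weight (fst p :: real) :: real)"
    by (rule continuous_on_compose2[OF bridge_weight_continuous[of UNIV]]) (auto intro: continuous_intros)
  then show ?thesis
    unfolding split_beta by (intro continuous_intros continuous_on_compose2[OF G]) auto
qed

lemma potential_integral_measurable:
  assumes G: "continuous_on UNIV G"
  shows "(\<lambda>\<omega>. integral {0..t} (\<lambda>s. bridge_weight s ^ k * G (bridge_weight s * x + Z s \<omega>))) \<in> borel_measurable M"
  using Z_path_integral_measurable[OF potential_continuous[OF G, of k x], of t]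
  by (subst measurable_cong[OF potential_integral_eq[symmetric]]) (auto simp: G)

lemma Z_t_measurable: "Z t \<in> borel_measurable M"
  using Z_measurable t by simp

lemma log_weight_measurable:
  "log_weight x \<in> borel_measurable M" "log_weight1 x \<in> borel_measurable M" "log_weight2 x \<in> borel_measurable M"
proof -
  note [measurable] = Z_t_measurable potential_integral_measurable[OF V_continuous]
    potential_integral_measurable[OF V1_continuous] potential_integral_measurable[OF V2_continuous]
  show "log_weight x \<in> borel_measurable M" unfolding log_weight_def[abs_def] by measurable
  show "log_weight1 x \<in> borel_measurable M" unfolding log_weight1_def[abs_def] by measurable
  show "log_weight2 x \<in> borel_measurable M" unfolding log_weight2_def[abs_def] by measurable
qed

lemma sigma_pos: "0 < 1 / sqrt (OU_precision t)"
  using OU_precision_gt_1[OF t] by simp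

text \<open>The Gaussian density of \<open>Z t\<close> is \<open>exp (- y\<^sup>2 / 2)\<close> times \<open>exp (- d * y\<^sup>2)\<close> with \<open>d > 0\<close>, up to a constant;
  the second factor absorbs the exponential.\<close>

lemma integrable_q_exp: "integrable M (\<lambda>\<omega>. (q (Z t \<omega>))\<^sup>2 * exp (l * \<bar>Z t \<omega>\<bar>))"
proof -
  define \<kappa> where "\<kappa> = OU_precision t"
  define d where "d = (\<kappa> - 1) / 2"
  define A where "A = 1 / sqrt (2 * pi * (1 / sqrt \<kappa>)\<^sup>2)"
  have d: "0 < d" using OU_precision_gt_1[OF t] by (simp add: d_def \<kappa>_def)
  have \<kappa>: "0 < \<kappa>" using OU_precision_gt_1[OF t] by (simp add: \<kappa>_def)
  note [measurable] = q_measurable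
  have A: "0 \<le> A" by (simp add: A_def)
  have nd: "normal_density 0 (1 / sqrt \<kappa>) y = A * (exp (- y\<^sup>2 / 2) * exp (- d * y\<^sup>2))" for y
  proof -
    have "- (y - 0)\<^sup>2 / (2 * (1 / sqrt \<kappa>)\<^sup>2) = - y\<^sup>2 / 2 + - d * y\<^sup>2"
      using \<kappa> by (simp add: power_divide d_def field_simps)
    then show ?thesis unfolding normal_density_def A_def by (simp only: exp_add)
  qed
  have bnd: "exp (- d * y\<^sup>2) * exp (l * \<bar>y\<bar>) \<le> exp (l\<^sup>2 / (4 * d))" for y
  proof -
    have "0 \<le> d * (\<bar>y\<bar> - l / (2 * d))\<^sup>2" using d by simp
    also have "\<dots> = d * y\<^sup>2 - l * \<bar>y\<bar> + l\<^sup>2 / (4 * d)"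
      using d by (simp add: power2_diff field_simps) (simp add: power2_eq_square field_simps)
    finally show ?thesis by (simp add: exp_add[symmetric])
  qed
  have "integrable lborel (\<lambda>y. normal_density 0 (1 / sqrt \<kappa>) y * ((q y)\<^sup>2 * exp (l * \<bar>y\<bar>)))"
  proof (rule Bochner_Integration.integrable_bound)
    show "integrable lborel (\<lambda>y. A * exp (l\<^sup>2 / (4 * d)) * ((q y)\<^sup>2 * exp (- y\<^sup>2 / 2)))"
      by (intro integrable_mult_right q_integrable)
    show "AE y in lborel. norm (normal_density 0 (1 / sqrt \<kappa>) y * ((q y)\<^sup>2 * exp (l * \<bar>y\<bar>)))
        \<le> norm (A * exp (l\<^sup>2 / (4 * d)) * ((q y)\<^sup>2 * exp (- y\<^sup>2 / 2)))"
    proof (rule AE_I2)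
      fix y
      have "normal_density 0 (1 / sqrt \<kappa>) y * ((q y)\<^sup>2 * exp (l * \<bar>y\<bar>)) =
          (exp (- d * y\<^sup>2) * exp (l * \<bar>y\<bar>)) * (A * ((q y)\<^sup>2 * exp (- y\<^sup>2 / 2)))"
        by (simp add: nd mult_ac)
      also have "\<dots> \<le> exp (l\<^sup>2 / (4 * d)) * (A * ((q y)\<^sup>2 * exp (- y\<^sup>2 / 2)))"
        using A by (intro mult_right_mono bnd) auto
      finally show "norm (normal_density 0 (1 / sqrt \<kappa>) y * ((q y)\<^sup>2 * exp (l * \<bar>y\<bar>)))
        \<le> norm (A * exp (l\<^sup>2 / (4 * d)) * ((q y)\<^sup>2 * exp (- y\<^sup>2 / 2)))"
        using A by (simp add: abs_mult mult_ac)
    qed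
  qed measurable
  then show ?thesis
    by (subst (asm) distributed_integrable[OF Z_normal[OF t, folded \<kappa>_def]]) auto
qed

lemma bridge_path_growth:
  assumes "s \<in> {0..t}" "\<bar>x\<bar> \<le> L" "\<omega> \<in> space M" and G: "\<And>y. \<bar>G y\<bar> \<le> C * (1 + \<bar>y\<bar>) ^ N"
  shows "\<bar>bridge_weight s ^ k * G (bridge_weight s * x + Z s \<omega>)\<bar> \<le> C * (1 + L + \<bar>Z s \<omega>\<bar>) ^ N"
proof -
  note a = bridge_weight_bounds[OF assms(1)]
  have C: "0 \<le> C" using V1_growth[of 0] by simp
  have "bridge_weight s * \<bar>x\<bar> \<le> 1 * L" using a assms(2) by (intro mult_mono) auto
  then have "\<bar>bridge_weight s * x\<bar> \<le> L" using a by (simp add: abs_mult)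
  then have "1 + \<bar>bridge_weight s * x + Z s \<omega>\<bar> \<le> 1 + L + \<bar>Z s \<omega>\<bar>" by linarith
  then have "C * (1 + \<bar>bridge_weight s * x + Z s \<omega>\<bar>) ^ N \<le> C * (1 + L + \<bar>Z s \<omega>\<bar>) ^ N"
    using C by (intro mult_left_mono power_mono) auto
  then have 1: "\<bar>G (bridge_weight s * x + Z s \<omega>)\<bar> \<le> C * (1 + L + \<bar>Z s \<omega>\<bar>) ^ N"
    using G order_trans by blast
  have "\<bar>bridge_weight s ^ k\<bar> \<le> 1" using a by (simp add: power_le_one)
  then have "\<bar>bridge_weight s ^ k\<bar> * \<bar>G (bridge_weight s * x + Z s \<omega>)\<bar> \<le> 1 * (C * (1 + L + \<bar>Z s \<omega>\<bar>) ^ N)"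
    using 1 by (intro mult_mono) auto
  then show ?thesis by (simp add: abs_mult)
qed

lemma potential_integral_growth:
  assumes "\<bar>x\<bar> \<le> L" "\<omega> \<in> space M" and G: "\<And>y. \<bar>G y\<bar> \<le> C * (1 + \<bar>y\<bar>) ^ N" and Gc: "continuous_on UNIV G"
  shows "\<bar>integral {0..t} (\<lambda>s. bridge_weight s ^ k * G (bridge_weight s * x + Z s \<omega>))\<bar> \<le>
    integral {0..t} (\<lambda>s. C * (1 + L + \<bar>Z s \<omega>\<bar>) ^ N)"
proof -
  have "norm (integral {0..t} (\<lambda>s. bridge_weight s ^ k * G (bridge_weight s * x + Z s \<omega>))) \<le>
    integral {0..t} (\<lambda>s. C * (1 + L + \<bar>Z s \<omega>\<bar>) ^ N)"
  proof (rule integral_norm_bound_integral)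
    show "(\<lambda>s. bridge_weight s ^ k * G (bridge_weight s * x + Z s \<omega>)) integrable_on {0..t}"
      by (intro integrable_continuous_real continuous_intros bridge_weight_continuous
          Z_continuous_interval[OF assms(2)] continuous_on_compose2[OF Gc]) auto
    show "(\<lambda>s. C * (1 + L + \<bar>Z s \<omega>\<bar>) ^ N) integrable_on {0..t}"
      by (intro integrable_continuous_real continuous_intros Z_continuous_interval[OF assms(2)])
    show "norm (bridge_weight s ^ k * G (bridge_weight s * x + Z s \<omega>)) \<le> C * (1 + L + \<bar>Z s \<omega>\<bar>) ^ N"
      if "s \<in> {0..t}" for s
      using bridge_path_growth[OF that assms(1,2) G] by simp
  qed
  then show ?thesis by simp
qed

text \<open>The weight \<open>exp (log_weight x \<omega>)\<close> grows at most exponentially in \<open>\<bar>Z t \<omega>\<bar>\<close>, and the derivatives of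
  \<open>log_weight\<close> at most polynomially in \<open>Z\<close> along the path. The product with \<open>q (Z t \<omega>)\<close> is bounded by a sum of
  integrable terms by means of \<open>a * b \<le> a\<^sup>2 + b\<^sup>2\<close>, which is applied under the time integral to avoid moments
  of the supremum of the path.\<close>

lemma dominated_log_weight:
  "\<exists>w. integrable M w \<and> (\<forall>x. \<forall>\<omega>\<in>space M. \<bar>x - x0\<bar> < 1 \<longrightarrow>
    \<bar>q (Z t \<omega>)\<bar> * exp (log_weight x \<omega>) * ((1 + \<bar>log_weight1 x \<omega>\<bar>)\<^sup>2 + \<bar>log_weight2 x \<omega>\<bar>) \<le> w \<omega>)"
proof -
  define L where "L = \<bar>x0\<bar> + 1"
  define c1 where "c1 = exp (- t) * OU_precision t"
  define c2 where "c2 = (exp (- t))\<^sup>2 * OU_precision t"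
  have c: "0 \<le> c1" "0 \<le> c2" "0 \<le> L"
    using OU_precision_gt_1[OF t] by (auto simp: c1_def c2_def L_def)
  define Q' where "Q' \<omega> = \<bar>q (Z t \<omega>)\<bar> * exp (c1 * L * \<bar>Z t \<omega>\<bar>)" for \<omega>
  define R where "R \<omega> = 2 * (1 + c1 * \<bar>Z t \<omega>\<bar> + c2 * L)\<^sup>2 + c2 + 1" for \<omega>
  define Y where "Y \<omega> s = C * (1 + L + \<bar>Z s \<omega>\<bar>) ^ N" for \<omega> s
  define T where "T \<omega> = integral {0..t} (Y \<omega>)" for \<omega>
  define J where "J \<omega> = integral {0..t} (\<lambda>s. (Y \<omega> s) ^ 4)" for \<omega>
  define w where "w \<omega> = exp (K * t) * ((Q' \<omega>)\<^sup>2 + (R \<omega>)\<^sup>2 + 3 * t * (t * (Q' \<omega>)\<^sup>2 + J \<omega>))" for \<omega>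
  note [measurable] = Z_t_measurable q_measurable
  have "integrable M (\<lambda>\<omega>. (Q' \<omega>)\<^sup>2)"
    using integrable_q_exp[of "2 * (c1 * L)"]
    by (simp add: Q'_def power_mult_distrib exp_double[symmetric] mult.assoc)
  moreover have "integrable M (\<lambda>\<omega>. (R \<omega>)\<^sup>2)"
  proof (rule Bochner_Integration.integrable_bound)
    define D where "D = 1 + c1 + c2 * L"
    define K1 where "K1 = 2 * D\<^sup>2 + c2 + 1"
    show "integrable M (\<lambda>\<omega>. K1\<^sup>2 * (1 + \<bar>Z t \<omega>\<bar>) ^ 4)"
      using integrable_Z_moment[OF t, of 1 4] by simp
    have "R \<omega> \<le> K1 * (1 + \<bar>Z t \<omega>\<bar>)\<^sup>2" "0 \<le> R \<omega>" for \<omega>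
    proof -
      have "1 + c1 * \<bar>Z t \<omega>\<bar> + c2 * L \<le> D * (1 + \<bar>Z t \<omega>\<bar>)"
        using c by (simp add: D_def algebra_simps)
      then have "(1 + c1 * \<bar>Z t \<omega>\<bar> + c2 * L)\<^sup>2 \<le> (D * (1 + \<bar>Z t \<omega>\<bar>))\<^sup>2"
        using c by (intro power_mono) auto
      moreover have "(c2 + 1) * 1 \<le> (c2 + 1) * (1 + \<bar>Z t \<omega>\<bar>)\<^sup>2"
        using c by (intro mult_left_mono one_le_power) auto
      ultimately show "R \<omega> \<le> K1 * (1 + \<bar>Z t \<omega>\<bar>)\<^sup>2"
        by (simp add: R_def K1_def power_mult_distrib distrib_right)
      show "0 \<le> R \<omega>" using c by (simp add: R_def)
    qed
    then have "(R \<omega>)\<^sup>2 \<le> (K1 * (1 + \<bar>Z t \<omega>\<bar>)\<^sup>2)\<^sup>2" for \<omega> by (intro power_mono)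
    then show "AE \<omega> in M. norm ((R \<omega>)\<^sup>2) \<le> norm (K1\<^sup>2 * (1 + \<bar>Z t \<omega>\<bar>) ^ 4)"
      by (intro AE_I2) (simp add: power_mult_distrib power_mult[symmetric])
    show "(\<lambda>\<omega>. (R \<omega>)\<^sup>2) \<in> borel_measurable M" unfolding R_def by measurable
  qed
  moreover have "integrable M J"
    using integrable_Z_path_moment[OF t, of "1 + L" "N * 4"] c
    unfolding J_def Y_def by (simp add: power_mult_distrib power_mult)
  ultimately have wi: "integrable M w" unfolding w_def by (intro integrable_mult_right Bochner_Integration.integrable_add)
  have "\<bar>q (Z t \<omega>)\<bar> * exp (log_weight x \<omega>) * ((1 + \<bar>log_weight1 x \<omega>\<bar>)\<^sup>2 + \<bar>log_weight2 x \<omega>\<bar>) \<le> w \<omega>"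
    if \<omega>: "\<omega> \<in> space M" and x: "\<bar>x - x0\<bar> < 1" for x \<omega>
  proof -
    have xL: "\<bar>x\<bar> \<le> L" using x by (simp add: L_def)
    have Yc: "continuous_on {0..t} (Y \<omega>)"
      unfolding Y_def by (intro continuous_intros Z_continuous_interval[OF \<omega>])
    define A1 where "A1 = integral {0..t} (\<lambda>s. bridge_weight s ^ Suc 0 * V1 (bridge_weight s * x + Z s \<omega>))"
    define A2 where "A2 = integral {0..t} (\<lambda>s. bridge_weight s ^ Suc (Suc 0) * V2 (bridge_weight s * x + Z s \<omega>))"
    have A: "\<bar>A1\<bar> \<le> T \<omega>" "\<bar>A2\<bar> \<le> T \<omega>"
      unfolding A1_def A2_def T_def Y_def
      by (rule potential_integral_growth[OF xL \<omega> V1_growth V1_continuous]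
        potential_integral_growth[OF xL \<omega> V2_growth V2_continuous])+
    have T2: "(T \<omega>)\<^sup>2 \<le> t * integral {0..t} (\<lambda>s. (Y \<omega> s)\<^sup>2)"
      unfolding T_def by (rule integral_square_le[OF t Yc])
    have V_int: "- (K * t) \<le> integral {0..t} (\<lambda>s. bridge_weight s ^ 0 * V (bridge_weight s * x + Z s \<omega>))"
    proof -
      have "integral {0..t} (\<lambda>s. - K) \<le> integral {0..t} (\<lambda>s. bridge_weight s ^ 0 * V (bridge_weight s * x + Z s \<omega>))"
        by (intro integral_le integrable_continuous_real continuous_intros bridge_weight_continuous
          Z_continuous_interval[OF \<omega>] continuous_on_compose2[OF V_continuous]) (auto simp: V_ge)
      then show ?thesis using t by (simp add: mult.commute)
    qed
    have "x * Z t \<omega> \<le> L * \<bar>Z t \<omega>\<bar>"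
      using mult_right_mono[OF xL, of "\<bar>Z t \<omega>\<bar>"] by (metis abs_ge_self abs_ge_zero abs_mult order_trans)
    then have "c1 * (x * Z t \<omega>) \<le> c1 * (L * \<bar>Z t \<omega>\<bar>)" using c by (intro mult_left_mono) auto
    moreover have "0 \<le> (exp (- t) * x)\<^sup>2 * OU_precision t / 2" using OU_precision_gt_1[OF t] by simp
    ultimately have "log_weight x \<omega> \<le> c1 * L * \<bar>Z t \<omega>\<bar> + K * t"
      using V_int unfolding log_weight_def by (simp add: c1_def mult_ac)
    then have exp_le: "exp (log_weight x \<omega>) \<le> exp (c1 * L * \<bar>Z t \<omega>\<bar>) * exp (K * t)"
      by (simp add: exp_add[symmetric])
    have sum_square_le: "(a + b)\<^sup>2 \<le> 2 * a\<^sup>2 + 2 * b\<^sup>2" for a b :: real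
      using zero_le_power2[of "a - b"] unfolding power2_sum power2_diff by linarith
    have "\<bar>c2 * x\<bar> \<le> c2 * L" using c xL by (simp add: abs_mult mult_left_mono)
    moreover have "\<bar>c1 * Z t \<omega>\<bar> = c1 * \<bar>Z t \<omega>\<bar>" using c by (simp add: abs_mult)
    moreover have "log_weight1 x \<omega> = c1 * Z t \<omega> - c2 * x - A1"
      by (simp add: log_weight1_def c1_def c2_def A1_def)
    ultimately have "1 + \<bar>log_weight1 x \<omega>\<bar> \<le> (1 + c1 * \<bar>Z t \<omega>\<bar> + c2 * L) + T \<omega>"
      using A by linarith
    then have "(1 + \<bar>log_weight1 x \<omega>\<bar>)\<^sup>2 \<le> ((1 + c1 * \<bar>Z t \<omega>\<bar> + c2 * L) + T \<omega>)\<^sup>2"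
      by (intro power_mono) auto
    also have "\<dots> \<le> 2 * (1 + c1 * \<bar>Z t \<omega>\<bar> + c2 * L)\<^sup>2 + 2 * (T \<omega>)\<^sup>2"
      by (rule sum_square_le)
    finally have e1: "(1 + \<bar>log_weight1 x \<omega>\<bar>)\<^sup>2 \<le> 2 * (1 + c1 * \<bar>Z t \<omega>\<bar> + c2 * L)\<^sup>2 + 2 * (T \<omega>)\<^sup>2" .
    have "log_weight2 x \<omega> = - c2 - A2" by (simp add: log_weight2_def c2_def A2_def)
    moreover have "T \<omega> \<le> 1 + (T \<omega>)\<^sup>2"
      using zero_le_power2[of "T \<omega> - 1 / 2"] by (simp add: power2_diff power_divide)
    ultimately have e2: "\<bar>log_weight2 x \<omega>\<bar> \<le> c2 + 1 + (T \<omega>)\<^sup>2" using A c by linarith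
    have e: "(1 + \<bar>log_weight1 x \<omega>\<bar>)\<^sup>2 + \<bar>log_weight2 x \<omega>\<bar> \<le> R \<omega> + 3 * (T \<omega>)\<^sup>2"
      using e1 e2 by (simp add: R_def)
    have amgm: "a * b \<le> a\<^sup>2 + b\<^sup>2" for a b :: real
      using zero_le_power2[of "a - b"] zero_le_power2[of a] zero_le_power2[of b]
      unfolding power2_diff by linarith
    have Q'0: "0 \<le> Q' \<omega>" by (simp add: Q'_def)
    have "Q' \<omega> * (T \<omega>)\<^sup>2 \<le> Q' \<omega> * (t * integral {0..t} (\<lambda>s. (Y \<omega> s)\<^sup>2))"
      using T2 Q'0 by (intro mult_left_mono)
    also have "\<dots> = t * integral {0..t} (\<lambda>s. Q' \<omega> * (Y \<omega> s)\<^sup>2)" by simp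
    also have "\<dots> \<le> t * integral {0..t} (\<lambda>s. (Q' \<omega>)\<^sup>2 + (Y \<omega> s) ^ 4)"
    proof (intro mult_left_mono integral_le integrable_continuous_real continuous_intros Yc)
      show "Q' \<omega> * (Y \<omega> s)\<^sup>2 \<le> (Q' \<omega>)\<^sup>2 + (Y \<omega> s) ^ 4" for s
        using amgm[of "Q' \<omega>" "(Y \<omega> s)\<^sup>2"] by (simp add: power_mult[symmetric])
    qed (use t in auto)
    also have "\<dots> = t * (t * (Q' \<omega>)\<^sup>2 + J \<omega>)"
      unfolding J_def using t
      by (subst Henstock_Kurzweil_Integration.integral_add) (auto intro!: integrable_continuous_real continuous_intros Yc)
    finally have QT: "Q' \<omega> * (T \<omega>)\<^sup>2 \<le> t * (t * (Q' \<omega>)\<^sup>2 + J \<omega>)" .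
    have "\<bar>q (Z t \<omega>)\<bar> * exp (log_weight x \<omega>) * ((1 + \<bar>log_weight1 x \<omega>\<bar>)\<^sup>2 + \<bar>log_weight2 x \<omega>\<bar>)
      \<le> (\<bar>q (Z t \<omega>)\<bar> * (exp (c1 * L * \<bar>Z t \<omega>\<bar>) * exp (K * t))) * (R \<omega> + 3 * (T \<omega>)\<^sup>2)"
      by (intro mult_mono exp_le e) auto
    also have "\<dots> = exp (K * t) * (Q' \<omega> * R \<omega> + 3 * (Q' \<omega> * (T \<omega>)\<^sup>2))"
      by (simp add: Q'_def algebra_simps)
    also have "\<dots> \<le> w \<omega>"
      unfolding w_def using amgm[of "Q' \<omega>" "R \<omega>"] QT by (intro mult_left_mono) (simp_all add: algebra_simps)
    finally show ?thesis .
  qed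
  with wi show ?thesis by blast
qed

sublocale exponential_mixture M "\<lambda>\<omega>. q (Z t \<omega>)" log_weight log_weight1 log_weight2
proof
  note [measurable] = q_measurable Z_t_measurable
  show "(\<lambda>\<omega>. q (Z t \<omega>)) \<in> borel_measurable M" by measurable
  show "AE \<omega> in M. 0 \<le> q (Z t \<omega>)"
    by (subst AE_normal_iff[OF Z_normal[OF t] sigma_pos]) (auto simp: q_nonneg)
  show "\<not> (AE \<omega> in M. q (Z t \<omega>) = 0)"
    by (subst AE_normal_iff[OF Z_normal[OF t] sigma_pos]) (auto simp: q_nonzero)
qed (fact log_weight_measurable log_weight_DERIV dominated_log_weight | (rule log_weight_measurable log_weight_DERIV dominated_log_weight; assumption))+

end

context OU_Feynman_Kac
begin

text \<open>The Cameron--Martin identity is applied to the potential \<open>z \<mapsto> V (bridge_weight s * x + z)\<close>, which depends on the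
  time \<open>s\<close>, and to the translation \<open>e = exp (- t) * x\<close> of the end point.\<close>

lemma feynman_kac:
  assumes X: "OU_process M B x X"
  shows "expectation (\<lambda>\<omega>. q (X t \<omega>) * exp (- integral {0..t} (\<lambda>s. V (X s \<omega>)))) = u x"
proof -
  define e where "e = exp (- t) * x"
  define U where "U s z = bridge_weight s ^ 0 * V (bridge_weight s * x + z)" for s z
  have Uc: "continuous_on UNIV (\<lambda>(s, z). U s z)"
    unfolding U_def using potential_continuous[OF V_continuous, of 0 x] .
  have U_ge: "- K \<le> U s z" for s z using V_ge by (simp add: U_def)
  note [measurable] = q_measurable Z_t_measurable
  have Xm: "X s \<in> borel_measurable M" if "0 \<le> s" for s
    using X that by (simp add: OU_process_def)
  have Xc: "continuous_on {0..} (\<lambda>s. X s \<omega>)" if "\<omega> \<in> space M" for \<omega>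
    using X that by (simp add: OU_process_def)
  have [measurable]: "X t \<in> borel_measurable M" using Xm t by simp
  have VX: "(LINT s:{0..t}|lborel. V (X s \<omega>)) = integral {0..t} (\<lambda>s. V (X s \<omega>))" if "\<omega> \<in> space M" for \<omega>
    by (intro set_lebesgue_integral_eq_integral_continuous continuous_on_compose2[OF V_continuous]
        continuous_on_subset[OF Xc[OF that]]) auto
  have Vc: "continuous_on UNIV (\<lambda>(s :: real, z). V z)"
    unfolding split_beta by (intro continuous_on_compose2[OF V_continuous] continuous_intros) auto
  have [measurable]: "(\<lambda>\<omega>. LINT s:{0..t}|lborel. V (X s \<omega>)) \<in> borel_measurable M"
    by (rule path_integral_measurable[where Z=X and U="\<lambda>_ z. V z", OF Xm Xc Vc])
  have [measurable]: "(\<lambda>\<omega>. LINT s:{0..t}|lborel. U s (Z s \<omega> + e * (sinh s / sinh t))) \<in> borel_measurable M"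
    by (rule Z_shifted_path_integral_measurable[OF t Uc])
  have AE_X: "AE \<omega> in M. q (X t \<omega>) * exp (- (LINT s:{0..t}|lborel. V (X s \<omega>))) =
      q (Z t \<omega> + e) * exp (- (LINT s:{0..t}|lborel. U s (Z s \<omega> + e * (sinh s / sinh t))))"
    using AE_OU_process_eq[OF X]
  proof eventually_elim
    case (elim \<omega>)
    have "V (X s \<omega>) = U s (Z s \<omega> + e * (sinh s / sinh t))" if "s \<in> {0..t}" for s
      using elim that bridge_weight_shift[of s x] by (simp add: U_def e_def algebra_simps)
    then have "(LINT s:{0..t}|lborel. V (X s \<omega>)) = (LINT s:{0..t}|lborel. U s (Z s \<omega> + e * (sinh s / sinh t)))"
      by (intro set_lebesgue_integral_cong) auto
    then show ?case using elim t by (simp add: e_def add.commute)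
  qed
  have shifted: "distributed M lborel (\<lambda>\<omega>. Z t \<omega> + e) (normal_density e (1 / sqrt (OU_precision t)))"
    using normal_density_affine[OF Z_normal[OF t] sigma_pos, of 1 e] by (simp add: add.commute)
  have nn1: "AE \<omega> in M. 0 \<le> q (Z t \<omega> + e)"
    by (subst AE_normal_iff[OF shifted sigma_pos]) (auto simp: q_nonneg)
  have nn1': "AE \<omega> in M. 0 \<le> q (Z t \<omega> + e) *
      exp (- (LINT s:{0..t}|lborel. U s (Z s \<omega> + e * (sinh s / sinh t))))"
    using nn1 by eventually_elim simp
  have nn2: "AE \<omega> in M. 0 \<le> q (Z t \<omega>)"
    by (subst AE_normal_iff[OF Z_normal[OF t] sigma_pos]) (auto simp: q_nonneg)
  have "expectation (\<lambda>\<omega>. q (X t \<omega>) * exp (- integral {0..t} (\<lambda>s. V (X s \<omega>)))) =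
      expectation (\<lambda>\<omega>. q (X t \<omega>) * exp (- (LINT s:{0..t}|lborel. V (X s \<omega>))))"
    by (intro Bochner_Integration.integral_cong refl) (simp add: VX)
  also have "\<dots> = expectation (\<lambda>\<omega>. q (Z t \<omega> + e) *
      exp (- (LINT s:{0..t}|lborel. U s (Z s \<omega> + e * (sinh s / sinh t)))))"
    by (rule integral_cong_AE[OF _ _ AE_X]) measurable
  also have "\<dots> = enn2real (\<integral>\<^sup>+\<omega>. ennreal (q (Z t \<omega> + e) *
      exp (- (LINT s:{0..t}|lborel. U s (Z s \<omega> + e * (sinh s / sinh t))))) \<partial>M)"
    by (rule integral_eq_nn_integral[OF _ nn1']) measurable
  also have "(\<integral>\<^sup>+\<omega>. ennreal (q (Z t \<omega> + e) *
      exp (- (LINT s:{0..t}|lborel. U s (Z s \<omega> + e * (sinh s / sinh t))))) \<partial>M) =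
    (\<integral>\<^sup>+\<omega>. ennreal (q (Z t \<omega> + e)) *
      ennreal (exp (- (LINT s:{0..t}|lborel. U s (Z s \<omega> + e * (sinh s / sinh t))))) \<partial>M)"
    by (simp add: ennreal_mult'')
  also have "\<dots> = (\<integral>\<^sup>+\<omega>. ennreal (q (Z t \<omega>)) *
      ennreal (exp (e * OU_precision t * Z t \<omega> - e\<^sup>2 * OU_precision t / 2) *
      exp (- (LINT s:{0..t}|lborel. U s (Z s \<omega>)))) \<partial>M)"
    by (rule cameron_martin[OF t Uc U_ge K]) measurable
  also have "\<dots> = (\<integral>\<^sup>+\<omega>. ennreal (q (Z t \<omega>) * exp (log_weight x \<omega>)) \<partial>M)"
  proof (rule nn_integral_cong)
    fix \<omega> assume "\<omega> \<in> space M"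
    then have "exp (log_weight x \<omega>) = exp (e * OU_precision t * Z t \<omega> - e\<^sup>2 * OU_precision t / 2) *
      exp (- (LINT s:{0..t}|lborel. U s (Z s \<omega>)))"
      by (simp add: log_weight_def U_def e_def exp_add[symmetric] potential_integral_eq[OF _ V_continuous, of \<omega> 0, simplified])
    then show "ennreal (q (Z t \<omega>)) * ennreal (exp (e * OU_precision t * Z t \<omega> - e\<^sup>2 * OU_precision t / 2) *
      exp (- (LINT s:{0..t}|lborel. U s (Z s \<omega>)))) = ennreal (q (Z t \<omega>) * exp (log_weight x \<omega>))"
      by (simp add: ennreal_mult'')
  qed
  also have "enn2real \<dots> = u x"
    unfolding u_def
    by (rule integral_eq_nn_integral[symmetric])
       (use nn2 log_weight_measurable(1) in \<open>auto intro: eventually_mono\<close>)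
  finally show ?thesis .
qed

lemma log_weight2_ge:
  assumes S: "\<And>y. V2 y \<le> S" "0 \<le> S" and \<omega>: "\<omega> \<in> space M"
  shows "- ((c_coeff t)\<^sup>2 + S / 2) \<le> log_weight2 x \<omega>"
proof -
  have "integral {0..t} (\<lambda>s. bridge_weight s ^ Suc (Suc 0) * V2 (bridge_weight s * x + Z s \<omega>)) \<le>
      integral {0..t} (\<lambda>s. (bridge_weight s)\<^sup>2 * S)"
    by (intro integral_le integrable_continuous_real continuous_intros bridge_weight_continuous
        Z_continuous_interval[OF \<omega>] continuous_on_compose2[OF V2_continuous])
       (auto simp: power2_eq_square S intro!: mult_left_mono)
  also have "\<dots> = integral {0..t} (\<lambda>s. (bridge_weight s)\<^sup>2) * S" by simp
  also have "\<dots> \<le> 1 / 2 * S" by (intro mult_right_mono integral_bridge_weight_square S)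
  finally have "integral {0..t} (\<lambda>s. bridge_weight s ^ Suc (Suc 0) * V2 (bridge_weight s * x + Z s \<omega>)) \<le> S / 2"
    by simp
  moreover have "(c_coeff t)\<^sup>2 = (exp (- t))\<^sup>2 * OU_precision t"
    using t by (simp add: c_coeff_def OU_precision_eq power_divide)
  ultimately show ?thesis by (simp add: log_weight2_def)
qed

end

section \<open>The potential\<close>

lemma poly_growth_obtain:
  assumes "poly_growth g"
  obtains C n where "0 \<le> C" "\<And>x. \<bar>g x\<bar> \<le> C * (1 + \<bar>x\<bar>) ^ n"
proof -
  obtain C n where C: "\<And>x. \<bar>g x\<bar> \<le> C * (1 + \<bar>x\<bar>) ^ n" using assms by (auto simp: poly_growth_def)
  have "0 \<le> C" using C[of 0] by simp
  with C that show thesis by blast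
qed

lemma poly_growth_mono_exponent:
  fixes C C' x :: real
  assumes "0 \<le> C" "C \<le> C'" "n \<le> n'" "\<bar>y\<bar> \<le> C * (1 + \<bar>x\<bar>) ^ n"
  shows "\<bar>y\<bar> \<le> C' * (1 + \<bar>x\<bar>) ^ n'"
  using assms(4) by (rule order_trans) (use assms in \<open>intro mult_mono power_increasing, auto\<close>)

lemma poly_growth_add:
  assumes "poly_growth f" "poly_growth g"
  shows "poly_growth (\<lambda>x. f x + g x)"
proof -
  obtain C n where f: "0 \<le> C" "\<And>x. \<bar>f x\<bar> \<le> C * (1 + \<bar>x\<bar>) ^ n" by (rule poly_growth_obtain[OF assms(1)]) blast
  obtain D m where g: "0 \<le> D" "\<And>x. \<bar>g x\<bar> \<le> D * (1 + \<bar>x\<bar>) ^ m" by (rule poly_growth_obtain[OF assms(2)]) blast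
  have "\<bar>f x + g x\<bar> \<le> (C + D) * (1 + \<bar>x\<bar>) ^ max n m" for x
  proof -
    have "\<bar>f x\<bar> \<le> C * (1 + \<bar>x\<bar>) ^ max n m"
      by (rule poly_growth_mono_exponent[OF f(1) order_refl max.cobounded1 f(2)])
    moreover have "\<bar>g x\<bar> \<le> D * (1 + \<bar>x\<bar>) ^ max n m"
      by (rule poly_growth_mono_exponent[OF g(1) order_refl max.cobounded2 g(2)])
    ultimately show ?thesis unfolding distrib_right by linarith
  qed
  then show ?thesis unfolding poly_growth_def by blast
qed

lemma poly_growth_mult:
  assumes "poly_growth f" "poly_growth g"
  shows "poly_growth (\<lambda>x. f x * g x)"
proof -
  obtain C n where f: "0 \<le> C" "\<And>x. \<bar>f x\<bar> \<le> C * (1 + \<bar>x\<bar>) ^ n" by (rule poly_growth_obtain[OF assms(1)]) blast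
  obtain D m where g: "0 \<le> D" "\<And>x. \<bar>g x\<bar> \<le> D * (1 + \<bar>x\<bar>) ^ m" by (rule poly_growth_obtain[OF assms(2)]) blast
  have "\<bar>f x * g x\<bar> \<le> (C * D) * (1 + \<bar>x\<bar>) ^ (n + m)" for x
    using mult_mono[OF f(2) g(2), of x x] f(1) by (simp add: abs_mult power_add mult_ac)
  then show ?thesis unfolding poly_growth_def by blast
qed

lemma poly_growth_const: "poly_growth (\<lambda>_. c)"
  unfolding poly_growth_def by (intro exI[of _ "\<bar>c\<bar>"] exI[of _ 0]) simp

lemma poly_growth_ident: "poly_growth (\<lambda>x. x)"
  unfolding poly_growth_def by (intro exI[of _ 1]) (auto intro!: exI[of _ 1])

lemma D_class_4_derivatives:
  assumes "h \<in> D_class 4"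
  defines "h1 \<equiv> deriv h"
  defines "h2 \<equiv> deriv h1"
  defines "h3 \<equiv> deriv h2"
  defines "h4 \<equiv> deriv h3"
  shows "\<And>x. (h has_real_derivative h1 x) (at x)" "\<And>x. (h1 has_real_derivative h2 x) (at x)"
    "\<And>x. (h2 has_real_derivative h3 x) (at x)" "\<And>x. (h3 has_real_derivative h4 x) (at x)"
    "continuous_on UNIV h4"
    "poly_growth h1" "poly_growth h2" "poly_growth h3" "poly_growth h4"
proof -
  have e: "(deriv ^^ 0) h = h" "(deriv ^^ 1) h = h1" "(deriv ^^ 2) h = h2" "(deriv ^^ 3) h = h3" "(deriv ^^ 4) h = h4"
    by (simp_all add: h1_def h2_def h3_def h4_def eval_nat_numeral)
  have d: "(deriv ^^ j) h differentiable at x" if "j < 4" for j x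
    using assms(1) that by (simp add: D_class_def C_class_def)
  have g: "poly_growth ((deriv ^^ j) h)" if "j \<le> 4" for j
    using assms(1) that by (simp add: D_class_def)
  show "(h has_real_derivative h1 x) (at x)" for x
    using d[of 0 x] unfolding e h1_def by (simp add: DERIV_deriv_iff_real_differentiable)
  show "(h1 has_real_derivative h2 x) (at x)" for x
    using d[of 1 x] unfolding e h2_def by (simp add: DERIV_deriv_iff_real_differentiable)
  show "(h2 has_real_derivative h3 x) (at x)" for x
    using d[of 2 x] unfolding e h3_def by (simp add: DERIV_deriv_iff_real_differentiable)
  show "(h3 has_real_derivative h4 x) (at x)" for x
    using d[of 3 x] unfolding e h4_def by (simp add: DERIV_deriv_iff_real_differentiable)
  show "continuous_on UNIV h4"
    using assms(1) unfolding D_class_def C_class_def by (simp add: e)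
  show "poly_growth h1" "poly_growth h2" "poly_growth h3" "poly_growth h4"
    using g[of 1] g[of 2] g[of 3] g[of 4] unfolding e by simp_all
qed

lemma V_fun_derivatives:
  assumes h: "h \<in> D_class 4"
  obtains V1 V2 where "\<And>x. (V_fun h has_real_derivative V1 x) (at x)"
    "\<And>x. (V1 has_real_derivative V2 x) (at x)" "continuous_on UNIV V2" "poly_growth V1" "poly_growth V2"
proof -
  define h1 where "h1 = deriv h"
  define h2 where "h2 = deriv h1"
  define h3 where "h3 = deriv h2"
  define h4 where "h4 = deriv h3"
  note D = D_class_4_derivatives[OF h, folded h1_def, folded h2_def, folded h3_def, folded h4_def]
  define V1 where "V1 x = (- 1 / 2) * h3 x + ((- 1 / 2) * x + 1 / 2 * (h1 x * h2 x))" for x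
  define V2 where "V2 x = (- 1 / 2) * h4 x + (- 1 / 2 + 1 / 2 * (h2 x * h2 x + h1 x * h3 x))" for x
  have c: "continuous_on UNIV h1" "continuous_on UNIV h2" "continuous_on UNIV h3"
    using D(2-4) by (auto intro!: DERIV_isCont continuous_at_imp_continuous_on)
  show thesis
  proof (rule that)
    have "V_fun h = (\<lambda>x. 1 / 2 * (1 - h2 x) - 1 / 4 * (x\<^sup>2 - (h1 x)\<^sup>2))"
      by (simp add: fun_eq_iff V_fun_def h1_def h2_def)
    then show "(V_fun h has_real_derivative V1 x) (at x)" for x
      by (auto intro!: derivative_eq_intros D simp: V1_def algebra_simps)
    show "(V1 has_real_derivative V2 x) (at x)" for x
      unfolding V1_def[abs_def] V2_def
      by (auto intro!: derivative_eq_intros D simp: algebra_simps)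
    show "continuous_on UNIV V2"
      unfolding V2_def[abs_def] by (intro continuous_intros c D)
    show "poly_growth V1" "poly_growth V2"
      unfolding V1_def[abs_def] V2_def[abs_def]
      by (intro poly_growth_add poly_growth_mult poly_growth_const poly_growth_ident D)+
  qed
qed

text \<open>If \<open>V2\<close> had a negative upper bound \<open>S\<close>, then \<open>V\<close> would lie below a parabola that tends to \<open>- \<infinity>\<close>. The sum of the
  values at \<open>r\<close> and \<open>- r\<close> eliminates the linear term.\<close>

lemma second_derivative_bound_nonneg:
  fixes V V1 V2 :: "real \<Rightarrow> real"
  assumes V: "\<And>x. (V has_real_derivative V1 x) (at x)" and V1: "\<And>x. (V1 has_real_derivative V2 x) (at x)"
    and ge: "\<And>x. - K \<le> V x" and S: "\<And>x. V2 x \<le> S"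
  shows "0 \<le> S"
proof (rule ccontr)
  assume "\<not> 0 \<le> S"
  then have S0: "S < 0" by simp
  define F where "F x = V x - V 0 - V1 0 * x - S * x\<^sup>2 / 2" for x
  define F1 where "F1 x = V1 x - V1 0 - S * x" for x
  have F: "(F has_real_derivative F1 x) (at x)" for x
    unfolding F_def[abs_def] F1_def by (auto intro!: derivative_eq_intros V)
  have F1: "(F1 has_real_derivative V2 x - S) (at x)" for x
    unfolding F1_def[abs_def] by (auto intro!: derivative_eq_intros V1)
  have dec: "F1 y \<le> F1 x" if "x \<le> y" for x y
    by (rule DERIV_nonpos_imp_nonincreasing[OF that]) (use F1 S in fastforce)
  have F10: "F1 0 = 0" "F 0 = 0" by (simp_all add: F1_def F_def)
  have Fle: "F x \<le> 0" for x
  proof (cases "0 \<le> x")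
    case True
    have "F x \<le> F 0"
    proof (rule DERIV_nonpos_imp_nonincreasing[OF True])
      fix y :: real assume "0 \<le> y"
      then show "\<exists>d. (F has_real_derivative d) (at y) \<and> d \<le> 0" using F[of y] dec[of 0 y] F10 by auto
    qed
    then show ?thesis by (simp add: F10)
  next
    case False
    then have "x \<le> 0" by simp
    have "F x \<le> F 0"
    proof (rule DERIV_nonneg_imp_nondecreasing[OF \<open>x \<le> 0\<close>])
      fix y :: real assume "y \<le> 0"
      then show "\<exists>d. (F has_real_derivative d) (at y) \<and> 0 \<le> d" using F[of y] dec[of y 0] F10 by auto
    qed
    then show ?thesis by (simp add: F10)
  qed
  \<comment> \<open>Chosen such that \<open>S * r\<^sup>2 / 2 = - (K + \<bar>V 0\<bar> + 1)\<close>.\<close>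
  define r where "r = sqrt (2 * (K + \<bar>V 0\<bar> + 1) / - S)"
  have KV: "0 \<le> K + \<bar>V 0\<bar>" using ge[of 0] by linarith
  have r: "r\<^sup>2 = 2 * (K + \<bar>V 0\<bar> + 1) / - S"
    unfolding r_def using KV S0 by (intro real_sqrt_pow2 divide_nonneg_pos) auto
  have "S * r\<^sup>2 / 2 = - (K + \<bar>V 0\<bar> + 1)" unfolding r using S0 by (simp add: field_simps)
  then have "V r + V (- r) \<le> 2 * V 0 - 2 * (K + \<bar>V 0\<bar> + 1)"
    using Fle[of r] Fle[of "- r"] unfolding F_def by simp
  then show False using ge[of r] ge[of "- r"] abs_ge_self[of "V 0"] by (smt (verit))
qed

section \<open>The lower bound for the second logarithmic derivative\<close>

theorem proposition2p1:
  fixes h f :: "real \<Rightarrow> real"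
    and P :: "real \<Rightarrow> (real \<Rightarrow> real) \<Rightarrow> real \<Rightarrow> real"
    and M :: "'w measure"
    and B :: "real \<Rightarrow> 'w \<Rightarrow> real"
    and X :: "real \<Rightarrow> real \<Rightarrow> 'w \<Rightarrow> real"
    and t x :: real
  assumes h: "h \<in> D_class 4"
    and prob: "prob_space (mu h)"
    and V: "bdd_below (range (V_fun h))"
    and P: "semigroup_generated_by_L h P"
    and B: "brownian_motion M B"
    and X: "\<And>y. OU_process M B y (X y)"
    and P_pointwise: "\<And>s g y. s > 0 \<Longrightarrow> g \<in> L2 (mu h) \<Longrightarrow> P s g y = FK_repr M X h s g y"
    and f: "f \<in> L2 (mu h)"
    and f_nonneg: "AE y in mu h. 0 \<le> f y"
    and f_nonzero: "\<not> (AE y in mu h. f y = 0)"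
    and t: "t > 0"
  shows "(\<forall>y. P t f y > 0) \<and>
    (\<forall>y. (\<lambda>z. ln (P t f z)) differentiable at y) \<and>
    deriv (\<lambda>z. ln (P t f z)) differentiable at x \<and>
    ereal (deriv (deriv (\<lambda>z. ln (P t f z))) x) \<ge>
      ereal (- (c_coeff t)\<^sup>2 - 1 / 2 * (1 - deriv (deriv h) x))
        - ereal (1 / 2) * (SUP y. ereal (deriv (deriv (V_fun h)) y))"
proof -
  note Dh = D_class_4_derivatives[OF h]
  obtain V1 V2 where V_deriv: "\<And>x. (V_fun h has_real_derivative V1 x) (at x)"
    and V1_deriv: "\<And>x. (V1 has_real_derivative V2 x) (at x)"
    and V2c: "continuous_on UNIV V2" and V1g: "poly_growth V1" and V2g: "poly_growth V2"
    by (rule V_fun_derivatives[OF h]) blast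
  obtain C n where C: "0 \<le> C" "\<And>y. \<bar>V1 y\<bar> \<le> C * (1 + \<bar>y\<bar>) ^ n" by (rule poly_growth_obtain[OF V1g]) blast
  obtain C' n' where C': "0 \<le> C'" "\<And>y. \<bar>V2 y\<bar> \<le> C' * (1 + \<bar>y\<bar>) ^ n'" by (rule poly_growth_obtain[OF V2g]) blast
  obtain K0 where K0: "\<And>y. K0 \<le> V_fun h y" using V unfolding bdd_below_def by auto
  define K where "K = max 0 (- K0)"
  have K: "0 \<le> K" "\<And>y. - K \<le> V_fun h y"
    using K0 by (auto simp: K_def max_def) (smt (verit) K0)+
  have hc: "continuous_on UNIV h"
    using Dh(1) by (auto intro!: DERIV_isCont continuous_at_imp_continuous_on)
  have [measurable]: "h \<in> borel_measurable borel" by (rule borel_measurable_continuous_onI[OF hc])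
  have fm[measurable]: "f \<in> borel_measurable borel"
    using f unfolding L2_def mu_def by (simp cong: measurable_cong_sets)
  \<comment> \<open>\<open>W_fun h y - y\<^sup>2 / 2 = - h y\<close>, hence \<open>f \<in> L2 (mu h)\<close> is the integrability hypothesis on \<open>q\<close>.\<close>
  define q where "q y = exp (W_fun h y / 2) * f y" for y
  have AE_mu: "(AE y in mu h. R y) \<longleftrightarrow> (AE y in lborel. R y)" for R
    unfolding mu_def by (subst AE_density) auto
  interpret OU_Feynman_Kac M B "X 0" t K "max C C'" "max n n'" "V_fun h" V1 V2 q
  proof
    show "brownian_motion M B" "OU_process M B 0 (X 0)" "0 < t" "0 \<le> K" by (fact B X t K)+
    show "(V_fun h has_real_derivative V1 y) (at y)" "(V1 has_real_derivative V2 y) (at y)"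
      "- K \<le> V_fun h y" for y by (fact V_deriv V1_deriv K)+
    show "continuous_on UNIV V2" by (fact V2c)
    show "\<bar>V1 y\<bar> \<le> max C C' * (1 + \<bar>y\<bar>) ^ max n n'" for y
      by (rule poly_growth_mono_exponent[OF C(1) _ _ C(2)]) auto
    show "\<bar>V2 y\<bar> \<le> max C C' * (1 + \<bar>y\<bar>) ^ max n n'" for y
      by (rule poly_growth_mono_exponent[OF C'(1) _ _ C'(2)]) auto
    show "q \<in> borel_measurable borel" unfolding q_def[abs_def] W_fun_def by measurable
    have "integrable (mu h) (\<lambda>y. (f y)\<^sup>2)" using f by (simp add: L2_def)
    then have "integrable lborel (\<lambda>y. exp (- h y) * (f y)\<^sup>2)"
      unfolding mu_def by (subst (asm) integrable_density) auto
    also have "(\<lambda>y. exp (- h y) * (f y)\<^sup>2) = (\<lambda>y. (q y)\<^sup>2 * exp (- y\<^sup>2 / 2))"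
    proof
      fix y
      have "(exp (W_fun h y / 2))\<^sup>2 * exp (- y\<^sup>2 / 2) = exp (- h y)"
        by (simp add: W_fun_def exp_double[symmetric] exp_add[symmetric] diff_divide_distrib)
      then show "exp (- h y) * (f y)\<^sup>2 = (q y)\<^sup>2 * exp (- y\<^sup>2 / 2)"
        by (simp add: q_def power_mult_distrib mult_ac)
    qed
    finally show "integrable lborel (\<lambda>y. (q y)\<^sup>2 * exp (- y\<^sup>2 / 2))" .
    show "AE y in lborel. 0 \<le> q y" using f_nonneg unfolding AE_mu by eventually_elim (simp add: q_def)
    show "\<not> (AE y in lborel. q y = 0)" using f_nonzero unfolding AE_mu by (simp add: q_def)
  qed
  have Pu: "P t f y = exp (- W_fun h y / 2) * u y" for y
    using P_pointwise[OF t f, of y] feynman_kac[OF X[of y]]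
    unfolding FK_repr_def q_def by (simp add: mult.assoc)
  have pos: "0 < P t f y" for y using u_pos[of y] by (simp add: Pu)
  have lnP: "(\<lambda>z. ln (P t f z)) = (\<lambda>z. ln (u z) - W_fun h z / 2)"
  proof
    fix z show "ln (P t f z) = ln (u z) - W_fun h z / 2"
      using u_pos[of z] by (simp add: Pu ln_mult)
  qed
  have W: "((\<lambda>z. W_fun h z / 2) has_real_derivative (y - deriv h y) / 2) (at y)" for y
    unfolding W_fun_def by (auto intro!: derivative_eq_intros Dh)
  have D1: "((\<lambda>z. ln (P t f z)) has_real_derivative u1 y / u y - (y - deriv h y) / 2) (at y)" for y
    unfolding lnP by (intro DERIV_diff DERIV_ln_u W)
  have dP: "deriv (\<lambda>z. ln (P t f z)) = (\<lambda>y. u1 y / u y - (y - deriv h y) / 2)"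
    using D1 by (auto intro!: DERIV_imp_deriv)
  have W1: "((\<lambda>y. (y - deriv h y) / 2) has_real_derivative (1 - deriv (deriv h) x) / 2) (at x)"
    by (auto intro!: derivative_eq_intros Dh)
  have D2: "(deriv (\<lambda>z. ln (P t f z)) has_real_derivative
      u2 x / u x - (u1 x / u x)\<^sup>2 - (1 - deriv (deriv h) x) / 2) (at x)"
    unfolding dP by (intro DERIV_diff DERIV_ln_u1 W1)
  have dV: "deriv (deriv (V_fun h)) = V2"
    using V_deriv V1_deriv by (metis DERIV_imp_deriv ext)
  have bound: "ereal (- (c_coeff t)\<^sup>2 - 1 / 2 * (1 - deriv (deriv h) x))
        - ereal (1 / 2) * (SUP y. ereal (V2 y)) \<le>
      ereal (u2 x / u x - (u1 x / u x)\<^sup>2 - (1 - deriv (deriv h) x) / 2)"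
  proof (cases "SUP y. ereal (V2 y)")
    case PInf
    then show ?thesis by simp
  next
    case MInf
    moreover have "ereal (V2 0) \<le> (SUP y. ereal (V2 y))" by (rule SUP_upper) simp
    ultimately show ?thesis by simp
  next
    case (real S)
    have S: "V2 y \<le> S" for y
      using SUP_upper[of y UNIV "\<lambda>y. ereal (V2 y)"] unfolding real by simp
    have S0: "0 \<le> S"
      by (rule second_derivative_bound_nonneg[OF V_deriv V1_deriv V_ge S])
    have "- ((c_coeff t)\<^sup>2 + S / 2) \<le> u2 x / u x - (u1 x / u x)\<^sup>2"
      by (rule log_second_derivative_ge) (rule log_weight2_ge[OF S S0])
    then show ?thesis unfolding real by simp
  qed
  have "deriv (deriv (\<lambda>z. ln (P t f z))) x = u2 x / u x - (u1 x / u x)\<^sup>2 - (1 - deriv (deriv h) x) / 2"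
    by (rule DERIV_imp_deriv[OF D2])
  then show ?thesis
    using pos D1 D2 bound unfolding dV
    by (auto simp: real_differentiable_def)
qed

end
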